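(* Let $n\ge 1$ be an integer, let $p,q\in\mathbb{C}^\ast$ with $|p|<1$, $|q|<1$, and let $a_1,\ldots,a_6,t\in\mathbb{C}^\ast$ satisfy $|a_m|<1$ $(m=1,\ldots,6)$ and $|t|<1$. If the balancing condition $a_1a_2a_3a_4a_5a_6\,t^{2n-2}=pq$ holds, then $$ \frac{1}{(2\pi\sqrt{-1})^n} \int_{\mathbb{T}^n} \prod_{i=1}^{n} \frac{\prod_{m=1}^{6}\Gamma(a_mz_i^{\pm1};p,q)}{\Gamma(z_i^{\pm2};p,q)} \prod_{1\le j<k\le n} \frac{\Gamma(tz_j^{\pm1}z_k^{\pm1};p,q)}{\Gamma(z_j^{\pm1}z_k^{\pm1};p,q)} \frac{dz_1\cdots dz_n}{z_1\cdots z_n} = \frac{2^n n!}{(p;p)_\infty^n(q;q)_\infty^n} \prod_{i=1}^{n}\left( \frac{\Gamma(t^i;p,q)}{\Gamma(t;p,q)} \prod_{1\le j<k\le 6}\Gamma(t^{i-1}a_ja_k;p,q) \right). $$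
   Context: $\mathbb{C}^\ast=\mathbb{C}\setminus\{0\}$. For $|p|<1$, $|q|<1$: $(u;p)_\infty=\prod_{\mu\ge 0}(1-p^\mu u)$, $(u;p,q)_\infty=\prod_{\mu,\nu\ge 0}(1-p^\mu q^\nu u)$, and the Ruijsenaars elliptic gamma function is $\Gamma(u;p,q)=(pqu^{-1};p,q)_\infty/(u;p,q)_\infty$ for $u\in\mathbb{C}^\ast$. Double signs indicate the product over all possible sign choices: $\Gamma(az^{\pm1};p,q)=\Gamma(az;p,q)\Gamma(az^{-1};p,q)$, $\Gamma(z^{\pm2};p,q)=\Gamma(z^2;p,q)\Gamma(z^{-2};p,q)$, and $\Gamma(tz^{\pm1}w^{\pm1};p,q)$ is the product of the four factors $\Gamma(tzw)\Gamma(tzw^{-1})\Gamma(tz^{-1}w)\Gamma(tz^{-1}w^{-1})$ (with bases $p,q$), similarly with $t$ replaced by $1$. $\mathbb{T}^n=\{z\in(\mathbb{C}^\ast)^n : |z_i|=1\ (i=1,\ldots,n)\}$, each unit circle being positively oriented. (The reciprocals $1/\Gamma(z_i^{\pm2};p,q)$ and $1/\Gamma(z_j^{\pm1}z_k^{\pm1};p,q)$ are holomorphic near $\mathbb{T}^n$, so the integrand is holomorphic in a neighborhood of $\mathbb{T}^n$.) *)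

theory Defs
  imports "HOL-Analysis.Analysis"
begin

text \<open>
  The infinite products are meant for \<open>norm p < 1\<close> and \<open>norm q < 1\<close>, where they converge absolutely;
  in particular the product over all pairs of exponents may be taken as an iterated one.
  Note that \<^const>\<open>prodinf\<close> has the correct value 0 when some factors of such a product vanish.
\<close>

definition qpoch :: "complex \<Rightarrow> complex \<Rightarrow> complex" where
  "qpoch u p = (\<Prod>\<mu>. 1 - p ^ \<mu> * u)"

definition qpoch2 :: "complex \<Rightarrow> complex \<Rightarrow> complex \<Rightarrow> complex" where
  "qpoch2 u p q = (\<Prod>\<mu>. \<Prod>\<nu>. 1 - p ^ \<mu> * q ^ \<nu> * u)"

text \<open>
  At the poles \<open>u = p\<^sup>-\<^sup>\<mu> q\<^sup>-\<^sup>\<nu>\<close> the convention \<open>x / 0 = 0\<close> gives the value 0. For \<open>norm p < 1\<close>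
  and \<open>norm q < 1\<close> the reciprocal of the elliptic gamma function then still has its correct value 0
  at these points.
\<close>

definition ell_gamma :: "complex \<Rightarrow> complex \<Rightarrow> complex \<Rightarrow> complex" where
  "ell_gamma u p q = qpoch2 (p * q / u) p q / qpoch2 u p q"

text \<open>The double sign conventions \<open>\<Gamma>(c z\<^sup>\<plusminus>\<^sup>1; p, q)\<close> and \<open>\<Gamma>(c z\<^sup>\<plusminus>\<^sup>1 w\<^sup>\<plusminus>\<^sup>1; p, q)\<close>:\<close>

definition ell_gamma_pm :: "complex \<Rightarrow> complex \<Rightarrow> complex \<Rightarrow> complex \<Rightarrow> complex" where
  "ell_gamma_pm c z p q = ell_gamma (c * z) p q * ell_gamma (c / z) p q"

definition ell_gamma_pm_pm ::
    "complex \<Rightarrow> complex \<Rightarrow> complex \<Rightarrow> complex \<Rightarrow> complex \<Rightarrow> complex" where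
  "ell_gamma_pm_pm c z w p q =
     ell_gamma (c * z * w) p q * ell_gamma (c * z / w) p q *
     ell_gamma (c * w / z) p q * ell_gamma (c / (z * w)) p q"

text \<open>
  \<open>\<Gamma>(t\<^sup>i; p, q) / \<Gamma>(t; p, q)\<close> as a meromorphic function of \<open>t\<close>. For \<open>i = 1\<close> it is identically 1, also at
  the zeros \<open>t = p\<^sup>\<mu>\<^sup>+\<^sup>1 q\<^sup>\<nu>\<^sup>+\<^sup>1\<close> of the denominator, where the quotient of the values would be \<open>0 / 0 = 0\<close>.
\<close>

definition ell_gamma_quot :: "nat \<Rightarrow> complex \<Rightarrow> complex \<Rightarrow> complex \<Rightarrow> complex" where
  "ell_gamma_quot i t p q =
     (if i = 1 then 1 else ell_gamma (t ^ i) p q / ell_gamma t p q)"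

text \<open>
  The integral of the form \<open>f(z) dz\<^sub>1 \<dots> dz\<^sub>n\<close> over the torus \<open>norm z\<^sub>i = 1\<close>, each circle being
  positively oriented: it is pulled back along \<open>z\<^sub>i = exp (\<i> \<theta>\<^sub>i)\<close>, so that \<open>dz\<^sub>i = \<i> exp (\<i> \<theta>\<^sub>i) d\<theta>\<^sub>i\<close>.
  Points of the torus are functions of which only the values at \<open>1, \<dots>, n\<close> matter.
\<close>

definition torus_integral :: "nat \<Rightarrow> ((nat \<Rightarrow> complex) \<Rightarrow> complex) \<Rightarrow> complex" where
  "torus_integral n f =
     (LINT \<theta> : ({1..n} \<rightarrow>\<^sub>E {0..2*pi}) | PiM {1..n} (\<lambda>_. lborel).
        f (\<lambda>i. cis (\<theta> i)) * (\<Prod>i=1..n. \<i> * cis (\<theta> i)))"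

end

theory Submission
  imports Defs "HOL-Complex_Analysis.Complex_Analysis"
begin

text \<open>
  The proof goes through a second integral, called of type I here. It has \<open>2 n + 4\<close> parameters \<open>b\<^sub>m\<close>
  with \<open>norm b\<^sub>m < 1\<close> and product \<open>p q\<close>, the weight
  \<open>\<Prod>\<^sub>i (\<Prod>\<^sub>m \<Gamma>(b\<^sub>m z\<^sub>i\<^sup>\<plusminus>\<^sup>1) / \<Gamma>(z\<^sub>i\<^sup>\<plusminus>\<^sup>2)) / \<Prod>\<^sub>j\<^sub><\<^sub>k \<Gamma>(z\<^sub>j\<^sup>\<plusminus>\<^sup>1 z\<^sub>k\<^sup>\<plusminus>\<^sup>1)\<close>, and no parameter \<open>t\<close>. Up to a constant \<open>C\<^sub>n\<close> its value is
  \<open>\<Prod>\<^sub>m\<^sub><\<^sub>k \<Gamma>(b\<^sub>m b\<^sub>k)\<close>; the integral of the theorem is called of type II.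

  That the quotient of the integral of type I by its value does not depend on the parameters
  (\<open>typeI_ratio_const\<close>) follows from a difference equation. The factors \<open>\<Gamma>(z\<^sub>j\<^sup>\<plusminus>\<^sup>1 z\<^sub>k\<^sup>\<plusminus>\<^sup>1)\<close> in the
  denominator are products of theta functions with bases \<open>p\<close> and \<open>q\<close>, and \<open>\<Gamma>(q u) = \<theta>(u; p) \<Gamma>(u)\<close>. So if
  the parameters have the product \<open>p\<close>, multiplying \<open>b\<^sub>c\<close> or \<open>b\<^sub>d\<close> by \<open>q\<close> leads to two integrands that are
  a common function times products of theta functions with base \<open>p\<close>. Lagrange interpolation
  in the space of such theta functions (\<open>theta_interpolation\<close>) shows that the linear combination
  of the two integrands whose integral should vanish is a sum of terms, one for each variable \<open>z\<^sub>i\<close>. The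
  integral of such a term over \<open>z\<^sub>i\<close> is 0, by the symmetry of a shifted contour under \<open>z\<^sub>i \<mapsto> 1 / (q z\<^sub>i)\<close>
  (\<open>typeI_shift_relation\<close>). Hence the quotient is invariant under \<open>(b\<^sub>i, b\<^sub>j) \<mapsto> (q b\<^sub>i, b\<^sub>j / q)\<close>.
  Along the family \<open>(b\<^sub>i x, b\<^sub>j / x)\<close> it is holomorphic in \<open>x\<close> on an annulus that is, after a deformation of the
  other parameters, wider than the period \<open>q\<close>. So it is constant.

  The integrals of types I and II are connected by Fubini's theorem (\<open>typeII_recursion\<close>). A suitable
  function of \<open>n + 1\<close> variables \<open>z\<close> and \<open>n\<close> variables \<open>w\<close> with the interaction
  \<open>\<Prod>\<^sub>i\<^sub>k \<Gamma>(\<tau> z\<^sub>i\<^sup>\<plusminus>\<^sup>1 w\<^sub>k\<^sup>\<plusminus>\<^sup>1)\<close>, \<open>\<tau>\<^sup>2 = t\<close>, is of type I both in \<open>z\<close> and in \<open>w\<close>, since \<open>\<tau> w\<^sub>k\<^sup>\<plusminus>\<^sup>1\<close> or \<open>\<tau> z\<^sub>i\<^sup>\<plusminus>\<^sup>1\<close> act as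
  further parameters. Integrating over one of them leaves the integrand of type II in the other,
  because \<open>\<Gamma>(b\<^sub>m b\<^sub>k)\<close> at two such parameters is a factor \<open>\<Gamma>(t z\<^sub>j\<^sup>\<plusminus>\<^sup>1 z\<^sub>k\<^sup>\<plusminus>\<^sup>1)\<close>. This expresses the
  integral in \<open>n + 1\<close> variables by that in \<open>n\<close> variables, and the value claimed satisfies the same
  recursion. By induction the integral of type II is the value claimed up to the constant \<open>C\<^sub>n\<close>
  of type I. The recursion needs \<open>norm a\<^sub>6\<^sup>2 < norm t\<close>, which analytic continuation removes
  (\<open>typeII_continuation\<close>).

  The constants remain. For \<open>n = 1\<close> the parameters move such that poles pinch the circle at the
  points \<open>\<plusminus>\<i>\<close>, where the integral localises (\<open>typeI_ratio_one_variable\<close>). For larger \<open>n\<close>, letting \<open>t\<close> tend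
  to 1 cancels the interaction \<open>\<Gamma>(t z\<^sub>j\<^sup>\<plusminus>\<^sup>1 z\<^sub>k\<^sup>\<plusminus>\<^sup>1) / \<Gamma>(z\<^sub>j\<^sup>\<plusminus>\<^sup>1 z\<^sub>k\<^sup>\<plusminus>\<^sup>1)\<close>, so that the integral becomes an \<open>n\<close>-th power,
  while \<open>\<Gamma>(t\<^sup>i) / \<Gamma>(t)\<close> tends to \<open>1 / i\<close>. Therefore \<open>C\<^sub>n = n! C\<^sub>1\<^sup>n\<close> (\<open>typeII_constant\<close>).
\<close>

section \<open>Infinite products and the elliptic gamma function\<close>

lemma entire_lipschitz_at_0:
  fixes g :: "complex \<Rightarrow> complex"
  assumes "g holomorphic_on UNIV"
  obtains C where "C \<ge> 0" "\<And>x. norm x \<le> R \<Longrightarrow> norm (g x - g 0) \<le> C * norm x"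
proof -
  have "continuous_on (cball 0 R) (deriv g)"
    by (intro holomorphic_on_imp_continuous_on holomorphic_deriv[of _ UNIV, THEN holomorphic_on_subset]) (use assms in auto)
  then have "bounded (deriv g ` cball 0 R)"
    by (intro compact_imp_bounded compact_continuous_image) auto
  then obtain C where C: "\<And>x. norm x \<le> R \<Longrightarrow> norm (deriv g x) \<le> C" "C > 0"
    unfolding bounded_pos by (metis image_eqI mem_cball_0)
  have "norm (g x - g 0) \<le> C * norm x" if "norm x \<le> R" for x
  proof -
    have "R \<ge> 0" using that norm_ge_zero order_trans by blast
    have "norm (g x - g 0) \<le> C * norm (x - 0)"
    proof (rule field_differentiable_bound[of "cball 0 R" g "deriv g"])
      fix z assume "z \<in> cball (0::complex) R"
      show "(g has_field_derivative deriv g z) (at z within cball 0 R)"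
        using assms by (meson UNIV_I has_field_derivative_at_within holomorphic_derivI open_UNIV)
    qed (use C that \<open>R \<ge> 0\<close> in auto)
    then show ?thesis by simp
  qed
  with C(2) show ?thesis by (intro that[of C]) auto
qed

text \<open>
  Both infinite products of the definitions are of the form \<open>\<Prod>\<mu>. g (r ^ \<mu> * u)\<close> with an entire function \<open>g\<close>
  and \<open>g 0 = 1\<close>: \<open>g u = 1 - u\<close> gives the first, and \<open>g u = qpoch u q\<close> the second. So convergence, zeros
  and holomorphy are treated once, for a general \<open>g\<close>.
\<close>

context
  fixes g :: "complex \<Rightarrow> complex" and r :: complex
  assumes g: "g holomorphic_on UNIV" "g 0 = 1" and r: "norm r < 1"
begin

lemma geometric_factor_bound:
  obtains C where "C \<ge> 0" "\<And>u \<mu>. norm u \<le> R \<Longrightarrow> norm (g (r ^ \<mu> * u) - 1) \<le> norm r ^ \<mu> * (C * R)"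
proof -
  obtain C where C: "C \<ge> 0" "\<And>x. norm x \<le> R \<Longrightarrow> norm (g x - g 0) \<le> C * norm x"
    using entire_lipschitz_at_0[OF g(1)] by blast
  have "norm (g (r ^ \<mu> * u) - 1) \<le> norm r ^ \<mu> * (C * R)" if "norm u \<le> R" for u \<mu>
  proof -
    have "norm r ^ \<mu> \<le> 1" using r by (simp add: power_le_one)
    then have "norm (r ^ \<mu> * u) \<le> R"
      using that mult_left_le_one_le[of "norm u" "norm r ^ \<mu>"] by (simp add: norm_mult norm_power)
    then have "norm (g (r ^ \<mu> * u) - 1) \<le> C * norm (r ^ \<mu> * u)"
      using C(2) g(2) by metis
    also have "\<dots> \<le> norm r ^ \<mu> * (C * R)"
      using that C(1) by (simp add: norm_mult norm_power mult_left_mono mult.left_commute)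
    finally show ?thesis .
  qed
  with C(1) show ?thesis by (rule that)
qed

lemma summable_geometric_factors: "summable (\<lambda>\<mu>. norm (g (r ^ \<mu> * u) - 1))"
proof -
  obtain C where "\<And>v \<mu>. norm v \<le> norm u \<Longrightarrow> norm (g (r ^ \<mu> * v) - 1) \<le> norm r ^ \<mu> * (C * norm u)"
    using geometric_factor_bound by blast
  moreover have "summable (\<lambda>\<mu>. norm r ^ \<mu> * (C * norm u))"
    using r by (intro summable_mult2 summable_geometric) auto
  ultimately show ?thesis
    by (intro summable_comparison_test[of "\<lambda>\<mu>. norm (g (r ^ \<mu> * u) - 1)"]) auto
qed

lemma convergent_geometric_prod: "convergent_prod (\<lambda>\<mu>. g (r ^ \<mu> * u))"
  by (intro abs_convergent_prod_imp_convergent_prod summable_imp_abs_convergent_prod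
        summable_geometric_factors)

lemma geometric_prod_eq_0_iff: "(\<Prod>\<mu>. g (r ^ \<mu> * u)) = 0 \<longleftrightarrow> (\<exists>\<mu>. g (r ^ \<mu> * u) = 0)"
  using has_prod_eq_0_iff[OF convergent_prod_has_prod[OF convergent_geometric_prod[of u]]] by auto

lemma geometric_prod_split: "(\<Prod>\<mu>. g (r ^ \<mu> * u)) = g u * (\<Prod>\<mu>. g (r ^ \<mu> * (r * u)))"
proof (cases "g u = 0")
  case True
  then have "(\<Prod>\<mu>. g (r ^ \<mu> * u)) = 0"
    unfolding geometric_prod_eq_0_iff by (intro exI[of _ 0]) auto
  with True show ?thesis by simp
next
  case False
  then show ?thesis
    using prodinf_split_head[OF convergent_geometric_prod[of u]] by (simp add: mult_ac)
qed

lemma holomorphic_geometric_prod: "(\<lambda>u. \<Prod>\<mu>. g (r ^ \<mu> * u)) holomorphic_on UNIV"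
proof -
  have hol: "(\<lambda>u. g (r ^ \<mu> * u)) holomorphic_on A" for \<mu> A
    using holomorphic_on_compose_gen[of "\<lambda>u. r ^ \<mu> * u" A g UNIV] g(1)
    by (auto simp: o_def intro!: holomorphic_intros)
  have "\<exists>d>0. (\<lambda>u. \<Prod>\<mu>. g (r ^ \<mu> * u)) holomorphic_on ball z d" for z
  proof -
    define R where "R = norm z + 1"
    obtain C where C: "\<And>v \<mu>. norm v \<le> R \<Longrightarrow> norm (g (r ^ \<mu> * v) - 1) \<le> norm r ^ \<mu> * (C * R)"
      using geometric_factor_bound by blast
    have sub: "cball z 1 \<subseteq> cball 0 R"
      unfolding R_def by (auto simp: dist_norm) (smt (verit) norm_triangle_ineq2 norm_minus_commute)
    have "uniformly_convergent_on (cball z 1) (\<lambda>N x. \<Sum>n<N. norm (g (r ^ n * x) - 1))"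
    proof (rule Weierstrass_m_test'[where M = "\<lambda>\<mu>. norm r ^ \<mu> * (C * R)"])
      show "norm (norm (g (r ^ n * x) - 1)) \<le> norm r ^ n * (C * R)" if "x \<in> cball z 1" for n x
        using C[of x n] that sub by auto
      show "summable (\<lambda>\<mu>. norm r ^ \<mu> * (C * R))"
        using r by (intro summable_mult2 summable_geometric) auto
    qed
    then have "uniformly_convergent_on (cball z 1) (\<lambda>N x. \<Prod>n<N. g (r ^ n * x))"
      by (intro uniformly_convergent_on_prod' holomorphic_on_imp_continuous_on hol) auto
    then have "uniform_limit (cball z 1) (\<lambda>N x. \<Prod>n<N. g (r ^ n * x)) (\<lambda>x. lim (\<lambda>N. \<Prod>n<N. g (r ^ n * x))) sequentially"
      using uniformly_convergent_uniform_limit_iff by blast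
    moreover have "lim (\<lambda>N. \<Prod>n<N. g (r ^ n * x)) = (\<Prod>n. g (r ^ n * x))" for x
    proof (rule limI)
      have "(\<lambda>N. \<Prod>n\<le>N. g (r ^ n * x)) \<longlonglongrightarrow> (\<Prod>n. g (r ^ n * x))"
        using convergent_geometric_prod by (rule convergent_prod_LIMSEQ)
      then have "(\<lambda>N. \<Prod>n<Suc N. g (r ^ n * x)) \<longlonglongrightarrow> (\<Prod>n. g (r ^ n * x))"
        by (simp only: lessThan_Suc_atMost)
      then show "(\<lambda>N. \<Prod>n<N. g (r ^ n * x)) \<longlonglongrightarrow> (\<Prod>n. g (r ^ n * x))"
        by (rule LIMSEQ_imp_Suc)
    qed
    ultimately have lim: "uniform_limit (cball z 1) (\<lambda>N x. \<Prod>n<N. g (r ^ n * x)) (\<lambda>x. \<Prod>n. g (r ^ n * x)) sequentially"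
      by simp
    have "(\<lambda>x. \<Prod>n. g (r ^ n * x)) holomorphic_on ball z 1"
    proof (rule holomorphic_uniform_limit[OF _ lim])
      show "\<forall>\<^sub>F n in sequentially. continuous_on (cball z 1) (\<lambda>x. \<Prod>k<n. g (r ^ k * x)) \<and>
              (\<lambda>x. \<Prod>k<n. g (r ^ k * x)) holomorphic_on ball z 1"
        by (intro always_eventually allI conjI holomorphic_on_imp_continuous_on holomorphic_on_prod hol)
    qed auto
    then show ?thesis by (intro exI[of _ 1]) auto
  qed
  then show ?thesis
    by (metis UNIV_I centre_in_ball holomorphic_on_def holomorphic_on_open open_UNIV open_ball at_within_open)
qed

end

lemma qpoch_alt: "qpoch u p = (\<Prod>\<mu>. (\<lambda>x. 1 - x) (p ^ \<mu> * u))"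
  by (simp add: qpoch_def)

lemma qpoch2_alt: "qpoch2 u p q = (\<Prod>\<mu>. (\<lambda>x. qpoch x q) (p ^ \<mu> * u))"
  by (simp add: qpoch2_def qpoch_def mult_ac)

lemma qpoch_0 [simp]: "qpoch 0 p = 1"
  by (simp add: qpoch_def)

lemma holomorphic_qpoch_UNIV: "norm p < 1 \<Longrightarrow> (\<lambda>u. qpoch u p) holomorphic_on UNIV"
  unfolding qpoch_alt by (intro holomorphic_geometric_prod) (auto intro!: holomorphic_intros)

lemma holomorphic_qpoch2_UNIV:
  "norm p < 1 \<Longrightarrow> norm q < 1 \<Longrightarrow> (\<lambda>u. qpoch2 u p q) holomorphic_on UNIV"
  unfolding qpoch2_alt by (intro holomorphic_geometric_prod holomorphic_qpoch_UNIV) auto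

lemma qpoch_split: "norm p < 1 \<Longrightarrow> qpoch u p = (1 - u) * qpoch (p * u) p"
  unfolding qpoch_alt by (subst geometric_prod_split) (auto intro!: holomorphic_intros)

lemma qpoch_eq_0_iff: "norm p < 1 \<Longrightarrow> qpoch u p = 0 \<longleftrightarrow> (\<exists>\<mu>. p ^ \<mu> * u = 1)"
  unfolding qpoch_alt by (subst geometric_prod_eq_0_iff) (auto intro!: holomorphic_intros)

lemma qpoch2_split_row:
  "norm p < 1 \<Longrightarrow> norm q < 1 \<Longrightarrow> qpoch2 u p q = qpoch u q * qpoch2 (p * u) p q"
  unfolding qpoch2_alt by (subst geometric_prod_split) (auto intro!: holomorphic_qpoch_UNIV)

text \<open>
  The first factors of all rows together form \<open>qpoch u p\<close>, and convergent infinite products are multiplied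
  factor by factor.
\<close>

lemma qpoch2_split_column:
  assumes "norm p < 1" "norm q < 1"
  shows "qpoch2 u p q = qpoch u p * qpoch2 (q * u) p q"
proof -
  have "qpoch u p * qpoch2 (q * u) p q
      = (\<Prod>\<mu>. (\<lambda>x. 1 - x) (p ^ \<mu> * u)) * (\<Prod>\<mu>. (\<lambda>x. qpoch x q) (p ^ \<mu> * (q * u)))"
    by (simp only: qpoch_alt[of u p] qpoch2_alt)
  also have "\<dots> = (\<Prod>\<mu>. (1 - p ^ \<mu> * u) * qpoch (p ^ \<mu> * (q * u)) q)"
    by (rule prodinf_mult; rule convergent_geometric_prod)
       (use assms in \<open>auto intro!: holomorphic_intros holomorphic_qpoch_UNIV\<close>)
  also have "\<dots> = (\<Prod>\<mu>. qpoch (p ^ \<mu> * u) q)"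
    by (rule prodinf_cong, subst (2) qpoch_split) (use assms in \<open>auto simp: mult_ac\<close>)
  also have "\<dots> = qpoch2 u p q" by (simp add: qpoch2_alt)
  finally show ?thesis ..
qed

lemma qpoch2_eq_0_iff:
  assumes "norm p < 1" "norm q < 1"
  shows "qpoch2 u p q = 0 \<longleftrightarrow> (\<exists>\<mu> \<nu>. p ^ \<mu> * q ^ \<nu> * u = 1)"
proof -
  have "qpoch2 u p q = 0 \<longleftrightarrow> (\<exists>\<mu>. qpoch (p ^ \<mu> * u) q = 0)"
    unfolding qpoch2_alt using assms by (intro geometric_prod_eq_0_iff holomorphic_qpoch_UNIV) auto
  also have "\<dots> \<longleftrightarrow> (\<exists>\<mu> \<nu>. q ^ \<nu> * (p ^ \<mu> * u) = 1)"
    using assms by (simp add: qpoch_eq_0_iff)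
  finally show ?thesis by (simp add: mult_ac)
qed

text \<open>
  The multiplicative theta function with base \<open>r\<close>. By the triple product identity it is, up to a constant,
  the Laurent series \<open>\<Sum>\<^sub>k (-1)\<^sup>k r ^ (k (k - 1) / 2) u\<^sup>k\<close>.
\<close>

definition theta :: "complex \<Rightarrow> complex \<Rightarrow> complex" where
  "theta r u = qpoch u r * qpoch (r / u) r"

lemma holomorphic_qpoch [holomorphic_intros]:
  assumes "f holomorphic_on A" "norm r < 1"
  shows "(\<lambda>x. qpoch (f x) r) holomorphic_on A"
  using holomorphic_on_compose_gen[OF assms(1) holomorphic_qpoch_UNIV[OF assms(2)]] by (auto simp: o_def)

lemma holomorphic_qpoch2 [holomorphic_intros]:
  assumes "f holomorphic_on A" "norm p < 1" "norm q < 1"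
  shows "(\<lambda>x. qpoch2 (f x) p q) holomorphic_on A"
  using holomorphic_on_compose_gen[OF assms(1) holomorphic_qpoch2_UNIV[OF assms(2,3)]] by (auto simp: o_def)

lemma holomorphic_theta [holomorphic_intros]:
  assumes "f holomorphic_on A" "norm r < 1" "\<And>x. x \<in> A \<Longrightarrow> f x \<noteq> 0"
  shows "(\<lambda>x. theta r (f x)) holomorphic_on A"
  unfolding theta_def using assms by (intro holomorphic_intros) auto

lemma theta_factor: "norm r < 1 \<Longrightarrow> theta r u = (1 - u) * (qpoch (r * u) r * qpoch (r / u) r)"
  unfolding theta_def using qpoch_split[of r u] by simp

lemma theta_1 [simp]: "norm r < 1 \<Longrightarrow> theta r 1 = 0"
  by (simp add: theta_factor)

lemma theta_inverse:
  assumes "norm r < 1" "u \<noteq> 0"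
  shows "theta r (1 / u) = - theta r u / u"
  using assms by (simp add: theta_factor field_simps)

lemma theta_shift:
  assumes "norm r < 1" "r \<noteq> 0" "u \<noteq> 0"
  shows "theta r (r * u) = - theta r u / u"
  using assms theta_inverse[of r u] by (simp add: theta_def mult.commute)

lemma qpoch_nonzero:
  assumes "norm r < 1" "norm u < 1"
  shows "qpoch u r \<noteq> 0"
proof
  assume "qpoch u r = 0"
  then obtain \<mu> where "r ^ \<mu> * u = 1" using qpoch_eq_0_iff[OF assms(1)] by auto
  then have "norm r ^ \<mu> * norm u = 1" by (metis norm_mult norm_one norm_power)
  moreover have "norm r ^ \<mu> * norm u \<le> norm u"
    using assms(1) by (simp add: mult_left_le_one_le power_le_one)
  ultimately show False using assms(2) by simp
qed

lemma qpoch2_nonzero: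
  assumes "norm p < 1" "norm q < 1" "norm u < 1"
  shows "qpoch2 u p q \<noteq> 0"
proof
  assume "qpoch2 u p q = 0"
  then obtain \<mu> \<nu> where "p ^ \<mu> * q ^ \<nu> * u = 1" using qpoch2_eq_0_iff[OF assms(1,2)] by auto
  then have "norm p ^ \<mu> * norm q ^ \<nu> * norm u = 1" by (metis norm_mult norm_one norm_power)
  moreover have "norm p ^ \<mu> * norm q ^ \<nu> * norm u \<le> norm u"
    using assms(1,2) by (intro mult_left_le_one_le) (auto simp: mult_le_one power_le_one)
  ultimately show False using assms(3) by simp
qed

lemma theta_nonzero:
  assumes "norm r < 1" "u \<noteq> 1" "norm r < norm u" "norm (r * u) < 1"
  shows "theta r u \<noteq> 0"
proof -
  have "norm (r / u) < 1" using assms(3) by (auto simp: norm_divide divide_less_eq)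
  then show ?thesis using assms by (simp add: theta_factor qpoch_nonzero)
qed

text \<open>
  The multiplicative analogue of \<open>\<sigma>(x - y) \<sigma>(x + y)\<close>, with \<open>z = exp x\<close> and \<open>w = exp y\<close>.
\<close>

definition theta_pm :: "complex \<Rightarrow> complex \<Rightarrow> complex \<Rightarrow> complex" where
  "theta_pm r z w = theta r (z * w) * theta r (z / w) / z"

lemma theta_pm_inverse:
  assumes "norm r < 1" "z \<noteq> 0" "w \<noteq> 0"
  shows "theta_pm r (1 / z) w = theta_pm r z w"
proof -
  have "theta_pm r (1 / z) w = theta r (1 / (z / w)) * theta r (1 / (z * w)) * z"
    by (simp add: theta_pm_def)
  also have "\<dots> = theta_pm r z w"
    using assms by (simp only: theta_inverse theta_pm_def mult_eq_0_iff divide_eq_0_iff simp_thms) (simp add: field_simps)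
  finally show ?thesis .
qed

lemma theta_pm_swap:
  assumes "norm r < 1" "z \<noteq> 0" "w \<noteq> 0"
  shows "theta_pm r w z = - theta_pm r z w"
proof -
  have "theta r (w / z) = - theta r (z / w) / (z / w)"
    using theta_inverse[of r "z / w"] assms by simp
  then have "theta_pm r w z = theta r (z * w) * (- theta r (z / w) / (z / w)) / w"
    by (simp add: theta_pm_def mult.commute)
  also have "\<dots> = - theta_pm r z w"
    using assms by (simp add: theta_pm_def)
  finally show ?thesis .
qed

lemma theta_pm_shift:
  assumes "norm r < 1" "r \<noteq> 0" "z \<noteq> 0" "w \<noteq> 0"
  shows "theta_pm r (r * z) w = theta_pm r z w / (r * z\<^sup>2)"
proof -
  have "theta r (r * z * w) = - theta r (z * w) / (z * w)" "theta r (r * z / w) = - theta r (z / w) / (z / w)"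
    using theta_shift[of r "z * w"] theta_shift[of r "z / w"] assms by (simp_all add: mult.assoc)
  then have "theta_pm r (r * z) w = (- theta r (z * w) / (z * w)) * (- theta r (z / w) / (z / w)) / (r * z)"
    by (simp only: theta_pm_def)
  also have "\<dots> = theta_pm r z w / (r * z\<^sup>2)"
    using assms by (simp add: theta_pm_def power2_eq_square)
  finally show ?thesis .
qed

lemma theta_pm_self [simp]: "norm r < 1 \<Longrightarrow> w \<noteq> 0 \<Longrightarrow> theta_pm r w w = 0"
  by (simp add: theta_pm_def)

lemma holomorphic_theta_pm [holomorphic_intros]:
  assumes "f holomorphic_on A" "g holomorphic_on A" "norm r < 1" "\<And>x. x \<in> A \<Longrightarrow> f x \<noteq> 0" "\<And>x. x \<in> A \<Longrightarrow> g x \<noteq> 0"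
  shows "(\<lambda>x. theta_pm r (f x) (g x)) holomorphic_on A"
  unfolding theta_pm_def using assms by (intro holomorphic_intros) auto

lemma theta_mult_theta: "z \<noteq> 0 \<Longrightarrow> b \<noteq> 0 \<Longrightarrow> theta r (b * z) * theta r (b / z) = b * theta_pm r b z"
  by (simp add: theta_pm_def)

locale elliptic_bases =
  fixes p q :: complex
  assumes p_nz: "p \<noteq> 0" and norm_p: "norm p < 1" and q_nz: "q \<noteq> 0" and norm_q: "norm q < 1"
begin

abbreviation \<Gamma> :: "complex \<Rightarrow> complex" where "\<Gamma> u \<equiv> ell_gamma u p q"

lemma norm_pq: "norm (p * q) < 1"
  using norm_p norm_q p_nz mult_strict_mono[of "norm p" 1 "norm q" 1] by (simp add: norm_mult)

lemma Gamma_mult_q: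
  assumes "u \<noteq> 0" "norm u < 1"
  shows "\<Gamma> (q * u) = theta p u * \<Gamma> u"
proof -
  have nz: "qpoch u p \<noteq> 0" using assms norm_p by (simp add: qpoch_nonzero)
  have "qpoch2 (p / u) p q = qpoch (p / u) p * qpoch2 (p * q / u) p q"
    using qpoch2_split_column[OF norm_p norm_q, of "p / u"] by (simp add: mult.commute)
  moreover have "qpoch2 u p q = qpoch u p * qpoch2 (q * u) p q"
    by (rule qpoch2_split_column[OF norm_p norm_q])
  moreover have "p * q / (q * u) = p / u" using q_nz by simp
  ultimately show ?thesis
    using nz by (simp add: ell_gamma_def theta_def)
qed

lemma Gamma_reflect:
  assumes "u \<noteq> 0" "norm u < 1" "norm (p * q) < norm u"
  shows "\<Gamma> u * \<Gamma> (p * q / u) = 1"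
proof -
  have "norm (p * q / u) < 1" using assms by (auto simp: norm_divide divide_less_eq)
  then have "qpoch2 (p * q / u) p q \<noteq> 0" "qpoch2 u p q \<noteq> 0"
    using assms norm_p norm_q qpoch2_nonzero by blast+
  then show ?thesis using p_nz q_nz assms(1) by (simp add: ell_gamma_def)
qed

lemma Gamma_nonzero:
  assumes "norm u < 1" "norm (p * q) < norm u"
  shows "\<Gamma> u \<noteq> 0"
proof -
  have "u \<noteq> 0" using assms(2) by auto
  then show ?thesis using Gamma_reflect[of u] assms by auto
qed

text \<open>
  In \<open>\<Gamma> u * \<Gamma> (1 / u)\<close> most factors cancel in pairs, apart from a row and a column of the double products. At
  \<open>u = 1\<close> the left-hand side is 0 by the conventions on division, which is the value of the right-hand side.
\<close>

lemma inverse_Gamma_Gamma: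
  assumes "norm u = 1"
  shows "1 / (\<Gamma> u * \<Gamma> (1 / u)) = theta p u * theta q (1 / u)"
proof -
  have u: "u \<noteq> 0" using assms by auto
  have "norm (p * q * u) < 1" "norm (p * q / u) < 1"
    using assms norm_pq by (auto simp: norm_mult norm_divide)
  then have nz: "qpoch2 (p * q * u) p q \<noteq> 0" "qpoch2 (p * q / u) p q \<noteq> 0"
    using norm_p norm_q qpoch2_nonzero by blast+
  have 1: "qpoch2 (1 / u) p q = qpoch (1 / u) q * qpoch (p / u) p * qpoch2 (p * q / u) p q"
    using qpoch2_split_row[OF norm_p norm_q, of "1 / u"] qpoch2_split_column[OF norm_p norm_q, of "p / u"]
    by (simp add: mult_ac)
  have 2: "qpoch2 u p q = qpoch u p * qpoch (q * u) q * qpoch2 (p * q * u) p q"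
    using qpoch2_split_column[OF norm_p norm_q, of u] qpoch2_split_row[OF norm_p norm_q, of "q * u"]
    by (simp add: mult_ac)
  have "1 / (\<Gamma> u * \<Gamma> (1 / u)) = (qpoch2 u p q / qpoch2 (p * q * u) p q) * (qpoch2 (1 / u) p q / qpoch2 (p * q / u) p q)"
    by (simp add: ell_gamma_def)
  also have "\<dots> = theta p u * theta q (1 / u)"
    unfolding 1 2 using nz u by (simp add: theta_def mult.commute)
  finally show ?thesis .
qed

text \<open>
  \<open>\<kappa>\<close> and \<open>\<omega>\<close> continue the reciprocals of \<open>\<Gamma>(z\<^sup>\<plusminus>\<^sup>1 w\<^sup>\<plusminus>\<^sup>1)\<close> and \<open>\<Gamma>(z\<^sup>\<plusminus>\<^sup>2)\<close> from the torus to all nonzero \<open>z\<close> and \<open>w\<close>.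
\<close>

definition \<kappa> :: "complex \<Rightarrow> complex \<Rightarrow> complex" where
  "\<kappa> z w = theta_pm p z w * theta_pm q z w"

definition \<omega> :: "complex \<Rightarrow> complex" where
  "\<omega> z = theta p (z\<^sup>2) * theta q (1 / z\<^sup>2)"

lemma inverse_ell_gamma_pm_pm:
  assumes "norm z = 1" "norm w = 1"
  shows "1 / ell_gamma_pm_pm 1 z w p q = \<kappa> z w"
proof -
  have nz: "z \<noteq> 0" "w \<noteq> 0" using assms by auto
  have "1 / ell_gamma_pm_pm 1 z w p q
      = (1 / (\<Gamma> (z * w) * \<Gamma> (1 / (z * w)))) * (1 / (\<Gamma> (z / w) * \<Gamma> (1 / (z / w))))"
    by (simp add: ell_gamma_pm_pm_def mult_ac)
  also have "\<dots> = theta p (z * w) * theta q (1 / (z * w)) * (theta p (z / w) * theta q (1 / (z / w)))"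
    using assms by (subst (1 2) inverse_Gamma_Gamma) (auto simp: norm_mult norm_divide)
  also have "\<dots> = theta_pm p z w * theta_pm q (1 / z) w"
    using nz by (simp add: theta_pm_def mult_ac)
  also have "\<dots> = \<kappa> z w"
    using nz by (simp add: \<kappa>_def theta_pm_inverse norm_q)
  finally show ?thesis .
qed

lemma inverse_ell_gamma_pm:
  assumes "norm z = 1"
  shows "1 / ell_gamma_pm 1 (z\<^sup>2) p q = \<omega> z"
  using inverse_Gamma_Gamma[of "z\<^sup>2"] assms
  by (simp add: ell_gamma_pm_def \<omega>_def norm_power)

lemma \<kappa>_sym: "z \<noteq> 0 \<Longrightarrow> w \<noteq> 0 \<Longrightarrow> \<kappa> z w = \<kappa> w z"
  unfolding \<kappa>_def using theta_pm_swap[OF norm_p, of z w] theta_pm_swap[OF norm_q, of z w] by simp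

lemma holomorphic_Gamma:
  assumes "f holomorphic_on A" "\<And>x. x \<in> A \<Longrightarrow> f x \<noteq> 0" "\<And>x. x \<in> A \<Longrightarrow> norm (f x) < 1"
  shows "(\<lambda>x. \<Gamma> (f x)) holomorphic_on A"
  unfolding ell_gamma_def using assms norm_p norm_q
  by (intro holomorphic_intros) (auto simp: qpoch2_nonzero)

lemma holomorphic_\<omega>:
  assumes "f holomorphic_on A" "\<And>x. x \<in> A \<Longrightarrow> f x \<noteq> 0"
  shows "(\<lambda>x. \<omega> (f x)) holomorphic_on A"
  unfolding \<omega>_def using assms norm_p norm_q by (intro holomorphic_intros) auto

text \<open>The elliptic gamma function with its pole at 1 removed.\<close>

definition Gamma_reg :: "complex \<Rightarrow> complex" where
  "Gamma_reg u = qpoch2 (p * q / u) p q / (qpoch (q * u) q * qpoch2 (p * u) p q)"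

lemma Gamma_conv_reg: "\<Gamma> u = Gamma_reg u / (1 - u)"
proof -
  have "qpoch2 u p q = (1 - u) * (qpoch (q * u) q * qpoch2 (p * u) p q)"
    using qpoch2_split_row[OF norm_p norm_q, of u] qpoch_split[OF norm_q, of u] by simp
  then show ?thesis by (simp add: ell_gamma_def Gamma_reg_def)
qed

lemma Gamma_reg_1: "Gamma_reg 1 = 1 / (qpoch p p * qpoch q q)"
proof -
  have "qpoch2 (p * q) p q \<noteq> 0" using norm_p norm_q norm_pq by (intro qpoch2_nonzero)
  moreover have "qpoch2 p p q = qpoch p p * qpoch2 (p * q) p q"
    using qpoch2_split_column[OF norm_p norm_q, of p] by (simp add: mult.commute)
  ultimately show ?thesis by (simp add: Gamma_reg_def mult.commute)
qed

lemma Gamma_reg_1_nonzero: "Gamma_reg 1 \<noteq> 0"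
  using norm_p norm_q by (simp add: Gamma_reg_1 qpoch_nonzero)

lemma holomorphic_Gamma_reg:
  assumes "f holomorphic_on A" "\<And>x. x \<in> A \<Longrightarrow> f x \<noteq> 0" "\<And>x. x \<in> A \<Longrightarrow> norm (p * f x) < 1" "\<And>x. x \<in> A \<Longrightarrow> norm (q * f x) < 1"
  shows "(\<lambda>x. Gamma_reg (f x)) holomorphic_on A"
  unfolding Gamma_reg_def using assms norm_p norm_q
  by (intro holomorphic_intros) (auto simp: qpoch2_nonzero qpoch_nonzero)

end

section \<open>Holomorphic functions: parameters, periods and zeros\<close>

text \<open>
  Cauchy's inequality turns the local bound on \<open>g\<close> into one on the derivative in the parameter. So the difference
  quotients are bounded, and dominated convergence applies.
\<close>

lemma has_field_derivative_parametric_integral: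
  fixes g :: "complex \<Rightarrow> 'a \<Rightarrow> complex"
  assumes M: "finite_measure M" and S: "open S" "s \<in> S"
    and hol: "\<And>w. w \<in> space M \<Longrightarrow> (\<lambda>s. g s w) holomorphic_on S"
    and meas: "\<And>s. s \<in> S \<Longrightarrow> g s \<in> borel_measurable M"
    and bdd: "\<And>s. s \<in> S \<Longrightarrow> \<exists>r>0. \<exists>K. cball s r \<subseteq> S \<and> (\<forall>s'\<in>cball s r. \<forall>w\<in>space M. norm (g s' w) \<le> K)"
  shows "((\<lambda>s. \<integral>w. g s w \<partial>M) has_field_derivative (\<integral>w. deriv (\<lambda>s. g s w) s \<partial>M)) (at s)"
proof -
  interpret finite_measure M by (rule M)
  obtain r K where r: "r > 0" "cball s r \<subseteq> S"
    and K: "\<And>s' w. s' \<in> cball s r \<Longrightarrow> w \<in> space M \<Longrightarrow> norm (g s' w) \<le> K"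
    using bdd[OF S(2)] by blast
  have int: "integrable M (g s')" if "s' \<in> cball s r" for s'
    using that r K meas by (intro integrable_const_bound[where B = K]) (auto intro!: AE_I2)
  have deriv_bound: "norm (deriv (\<lambda>s. g s w) s') \<le> 2 * K / r"
    if "w \<in> space M" "s' \<in> cball s (r / 2)" for w s'
  proof -
    have sub: "cball s' (r / 2) \<subseteq> cball s r"
    proof
      fix x assume "x \<in> cball s' (r / 2)"
      then show "x \<in> cball s r" using that(2) dist_triangle[of s x s'] by auto
    qed
    have "norm ((deriv ^^ 1) (\<lambda>s. g s w) s') \<le> fact 1 * K / (r / 2) ^ 1"
    proof (rule Cauchy_inequality)
      show "(\<lambda>s. g s w) holomorphic_on ball s' (r / 2)"
        using sub r(2) ball_subset_cball by (intro holomorphic_on_subset[OF hol[OF that(1)]]) blast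
      show "continuous_on (cball s' (r / 2)) (\<lambda>s. g s w)"
        using sub r(2) by (intro holomorphic_on_imp_continuous_on holomorphic_on_subset[OF hol[OF that(1)]]) blast
      show "norm (g x w) \<le> K" if "norm (s' - x) = r / 2" for x
        using sub that K[OF _ \<open>w \<in> space M\<close>] by (metis dist_norm mem_cball order_refl subsetD)
    qed (use r in auto)
    then show ?thesis by (simp add: field_simps)
  qed
  have lip: "norm (g s' w - g s w) \<le> 2 * K / r * norm (s' - s)"
    if "w \<in> space M" "s' \<in> cball s (r / 2)" for w s'
  proof (rule field_differentiable_bound[of "cball s (r / 2)" "\<lambda>s. g s w" "deriv (\<lambda>s. g s w)"])
    fix z assume z: "z \<in> cball s (r / 2)"
    then have "z \<in> S" using r by (auto simp: subset_iff)
    then show "((\<lambda>s. g s w) has_field_derivative deriv (\<lambda>s. g s w) z) (at z within cball s (r / 2))"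
      using hol[OF that(1)] S(1) by (meson has_field_derivative_at_within holomorphic_derivI)
  qed (use that r deriv_bound in auto)
  show ?thesis
    unfolding has_field_derivative_iff
  proof (subst tendsto_within_open[of s "ball s (r / 2)", symmetric])
    show "((\<lambda>y. ((\<integral>w. g y w \<partial>M) - (\<integral>w. g s w \<partial>M)) / (y - s)) \<longlongrightarrow>
           (\<integral>w. deriv (\<lambda>s. g s w) s \<partial>M)) (at s within ball s (r / 2))"
      unfolding tendsto_at_iff_sequentially o_def
    proof (intro allI impI)
      fix X :: "nat \<Rightarrow> complex"
      assume X: "\<forall>i. X i \<in> ball s (r / 2) - {s}" "X \<longlonglongrightarrow> s"
      have Xs: "X i \<in> cball s (r / 2)" "X i \<in> cball s r" "X i \<noteq> s" for i
      proof -
        have "dist s (X i) < r / 2" using X(1) by auto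
        then show "X i \<in> cball s (r / 2)" "X i \<in> cball s r" using r(1) by auto
        show "X i \<noteq> s" using X(1) by auto
      qed
      have "(\<lambda>i. \<integral>w. (g (X i) w - g s w) / (X i - s) \<partial>M) \<longlonglongrightarrow> (\<integral>w. deriv (\<lambda>s. g s w) s \<partial>M)"
      proof (rule integral_dominated_convergence[where w = "\<lambda>_. 2 * K / r"])
        have mq: "(\<lambda>w. (g (X i) w - g s w) / (X i - s)) \<in> borel_measurable M" for i
          using Xs(2)[of i] r S(2) meas by (intro borel_measurable_divide borel_measurable_diff meas) auto
        show "(\<lambda>w. (g (X i) w - g s w) / (X i - s)) \<in> borel_measurable M" for i
          by (rule mq)
        have lim: "(\<lambda>i. (g (X i) w - g s w) / (X i - s)) \<longlonglongrightarrow> deriv (\<lambda>s. g s w) s"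
          if "w \<in> space M" for w
        proof -
          have "((\<lambda>s. g s w) has_field_derivative deriv (\<lambda>s. g s w) s) (at s)"
            using hol[OF that] S by (meson holomorphic_derivI)
          then have "((\<lambda>y. (g y w - g s w) / (y - s)) \<longlongrightarrow> deriv (\<lambda>s. g s w) s) (at s)"
            by (simp add: has_field_derivative_iff)
          moreover have "filterlim X (at s) sequentially"
            using X Xs(3) by (intro filterlim_atI) auto
          ultimately show ?thesis by (rule filterlim_compose)
        qed
        show "(\<lambda>w. deriv (\<lambda>s. g s w) s) \<in> borel_measurable M"
          by (rule borel_measurable_LIMSEQ_metric[OF mq lim])
        show "AE w in M. (\<lambda>i. (g (X i) w - g s w) / (X i - s)) \<longlonglongrightarrow> deriv (\<lambda>s. g s w) s"
          using lim by (intro AE_I2)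
        show "AE w in M. norm ((g (X i) w - g s w) / (X i - s)) \<le> 2 * K / r" for i
        proof (intro AE_I2)
          fix w assume "w \<in> space M"
          then show "norm ((g (X i) w - g s w) / (X i - s)) \<le> 2 * K / r"
            using lip[OF _ Xs(1)[of i], of w] Xs(3)[of i] by (simp add: norm_divide divide_le_eq)
        qed
      qed auto
      moreover have "(\<integral>w. (g (X i) w - g s w) / (X i - s) \<partial>M)
          = ((\<integral>w. g (X i) w \<partial>M) - (\<integral>w. g s w \<partial>M)) / (X i - s)" for i
        using int[of "X i"] int[of s] Xs(2,3)[of i] r by simp
      ultimately show "(\<lambda>i. ((\<integral>w. g (X i) w \<partial>M) - (\<integral>w. g s w \<partial>M)) / (X i - s)) \<longlonglongrightarrow> (\<integral>w. deriv (\<lambda>s. g s w) s \<partial>M)"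
        by (simp only:)
    qed
  qed (use r in auto)
qed

lemma holomorphic_parametric_integral:
  fixes g :: "complex \<Rightarrow> 'a \<Rightarrow> complex"
  assumes M: "finite_measure M" and S: "open S"
    and hol: "\<And>w. w \<in> space M \<Longrightarrow> (\<lambda>s. g s w) holomorphic_on S"
    and meas: "\<And>s. s \<in> S \<Longrightarrow> g s \<in> borel_measurable M"
    and bdd: "\<And>s. s \<in> S \<Longrightarrow> \<exists>r>0. \<exists>K. cball s r \<subseteq> S \<and> (\<forall>s'\<in>cball s r. \<forall>w\<in>space M. norm (g s' w) \<le> K)"
  shows "(\<lambda>s. \<integral>w. g s w \<partial>M) holomorphic_on S"
  using has_field_derivative_parametric_integral[OF M S _ hol meas bdd] S
  by (auto simp: holomorphic_on_open)

text \<open>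
  The annulus is wide enough to contain a fundamental domain of \<open>z \<mapsto> q z\<close> in its interior. The
  maximum of \<open>norm (f z)\<close> over a closed fundamental domain is, by periodicity, a local maximum in the annulus, so the
  maximum principle applies. Periodicity on some open set is enough, by the identity theorem.
\<close>

lemma periodic_on_annulus_constant:
  fixes f :: "complex \<Rightarrow> complex" and r1 r2 :: real
  defines "U \<equiv> {z. r1 < norm z \<and> norm z < r2}"
  assumes q: "0 < norm q" "norm q < 1" and r: "0 \<le> r1" "r1 < norm q * r2"
    and hol: "f holomorphic_on U"
    and V: "open V" "V \<noteq> {}" "\<And>x. x \<in> V \<Longrightarrow> x \<in> U \<and> q * x \<in> U \<and> f (q * x) = f x"
    and z: "z \<in> U" and z': "z' \<in> U"
  shows "f z = f z'"
proof -
  have conn: "connected {z::complex. a < norm z \<and> norm z < b}" for a b :: real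
    using connected_annulus(1)[of a "0::complex" b] by simp
  have opn: "open {z::complex. a < norm z \<and> norm z < b}" for a b :: real
    by (intro open_Collect_conj open_Collect_less continuous_intros)
  define W where "W = {z::complex. r1 / norm q < norm z \<and> norm z < r2}"
  have WU: "x \<in> U \<and> q * x \<in> U" if "x \<in> W" for x
  proof -
    have x: "r1 < norm q * norm x" "norm x < r2" using that q by (auto simp: W_def field_simps)
    moreover have "norm q * norm x \<le> norm x" using q by (simp add: mult_left_le_one_le)
    ultimately show ?thesis by (auto simp: U_def norm_mult)
  qed
  have per: "f (q * x) = f x" if "x \<in> W" for x
  proof (rule analytic_continuation_open[of V W "\<lambda>x. f (q * x)" f])
    show "V \<subseteq> W" using V(3) q by (auto simp: W_def U_def norm_mult pos_divide_less_eq mult.commute)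
    show "open W" "connected W" unfolding W_def by (rule opn, rule conn)
    show "(\<lambda>x. f (q * x)) holomorphic_on W"
      by (rule holomorphic_on_compose_gen[of "\<lambda>x. q * x" W f U, unfolded o_def])
         (use WU hol in \<open>auto intro!: holomorphic_intros\<close>)
    show "f holomorphic_on W" using WU by (intro holomorphic_on_subset[OF hol]) auto
  qed (use V that in auto)
  have "r1 / norm q < r2" using q r by (simp add: field_simps)
  then obtain \<rho> where \<rho>1: "r1 / norm q < \<rho>" and \<rho>2: "\<rho> < r2" using dense by blast
  moreover have "0 \<le> r1 / norm q" using q r by simp
  ultimately have \<rho>3: "0 < \<rho>" by linarith
  have "r1 < norm q * \<rho>" using \<rho>1 q(1) by (simp only: pos_divide_less_eq mult.commute)
  note \<rho> = this \<rho>2 \<rho>3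
  define K where "K = cball 0 \<rho> - ball (0::complex) (norm q * \<rho>)"
  have KU: "K \<subseteq> U" unfolding K_def U_def using \<rho> by auto
  have "of_real \<rho> \<in> K" unfolding K_def using \<rho> q by (auto simp: mult_left_le_one_le)
  then have "K \<noteq> {}" by auto
  moreover have "compact K" unfolding K_def by (intro compact_diff) auto
  moreover have "continuous_on K (\<lambda>x. norm (f x))"
    by (intro continuous_intros holomorphic_on_imp_continuous_on holomorphic_on_subset[OF hol] KU)
  ultimately obtain x0 where x0: "x0 \<in> K" "\<And>x. x \<in> K \<Longrightarrow> norm (f x) \<le> norm (f x0)"
    using continuous_attains_sup[of K "\<lambda>x. norm (f x)"] by auto
  define P where "P = U \<inter> {z. norm q * norm q * \<rho> < norm z \<and> norm z < \<rho> / norm q}"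
  have "f constant_on U"
  proof (rule maximum_modulus_principle[OF hol, of P x0])
    show "open U" "connected U" unfolding U_def by (rule opn, rule conn)
    then show "open P" unfolding P_def by (intro open_Int opn)
    show "P \<subseteq> U" by (auto simp: P_def)
    have "norm q * \<rho> < \<rho>" using q \<rho> by simp
    then have "norm q * norm q * \<rho> < norm q * \<rho>" "\<rho> < \<rho> / norm q"
      using q mult_strict_left_mono[of "norm q * \<rho>" \<rho> "norm q"] by (simp_all add: pos_less_divide_eq mult.commute mult.left_commute)
    moreover have "x0 \<in> U" "norm x0 \<le> \<rho>" "norm q * \<rho> \<le> norm x0"
      using x0(1) KU by (auto simp: K_def)
    ultimately show "x0 \<in> P" unfolding P_def by auto
    fix x assume x: "x \<in> P"
    consider "x \<in> K" | "norm x < norm q * \<rho>" | "norm x > \<rho>" by (cases "norm x \<le> \<rho>"; cases "norm q * \<rho> \<le> norm x") (auto simp: K_def)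
    then show "norm (f x) \<le> norm (f x0)"
    proof cases
      case 2
      have "norm (x / q) \<le> \<rho>" "norm (x / q) \<ge> norm q * \<rho>"
        using x 2 q unfolding P_def by (auto simp: norm_divide pos_le_divide_eq pos_divide_le_eq mult_ac)
      then have "x / q \<in> K" by (auto simp: K_def)
      moreover have "x / q \<in> W"
        using x \<open>norm (x / q) \<le> \<rho>\<close> \<rho>2 q(1) divide_strict_right_mono[of r1 "norm x" "norm q"]
        unfolding P_def U_def W_def by (simp add: norm_divide)
      then have "f (x / q) = f x" using per[of "x / q"] q by simp
      ultimately show ?thesis using x0(2)[of "x / q"] by simp
    next
      case 3
      have "norm (q * x) \<le> \<rho>" "norm (q * x) \<ge> norm q * \<rho>"
        using x 3 q unfolding P_def by (auto simp: norm_mult pos_less_divide_eq mult.commute)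
      then have "q * x \<in> K" by (auto simp: K_def)
      moreover have "x \<in> W"
        using x 3 \<rho>1 unfolding P_def U_def W_def by simp
      then have "f (q * x) = f x" using per by simp
      ultimately show ?thesis using x0(2)[of "q * x"] by simp
    qed (use x0 in auto)
  qed
  then show ?thesis using z z' by (auto simp: constant_on_def)
qed

lemma factor_out_finite_zeros:
  fixes f :: "complex \<Rightarrow> complex"
  assumes "finite Y" "open U" "Y \<subseteq> U" "f holomorphic_on U" "\<And>y. y \<in> Y \<Longrightarrow> f y = 0"
  shows "\<exists>g. g holomorphic_on U \<and> (\<forall>z\<in>U. f z = (\<Prod>y\<in>Y. z - y) * g z)"
  using assms(1,3,5)
proof (induction Y)
  case empty
  then show ?case using assms(4) by auto
next
  case (insert a Y)
  then obtain g where g: "g holomorphic_on U" "\<And>z. z \<in> U \<Longrightarrow> f z = (\<Prod>y\<in>Y. z - y) * g z" by auto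
  have "(\<Prod>y\<in>Y. a - y) \<noteq> 0" using insert.hyps by auto
  then have ga: "g a = 0" using g(2)[of a] insert.prems by auto
  define h where "h = (\<lambda>z. if z = a then deriv g a else g z / (z - a))"
  have "h holomorphic_on U"
    by (rule pole_theorem_0[OF g(1), of a]) (use insert.prems assms(2) ga in \<open>auto simp: h_def interior_open\<close>)
  moreover have "f z = (\<Prod>y\<in>insert a Y. z - y) * h z" if "z \<in> U" for z
    using g(2)[OF that] insert.hyps ga by (auto simp: h_def)
  ultimately show ?case by blast
qed

section \<open>Integration over circles and tori\<close>

text \<open>
  The unit circle is treated as a measure space of its own, with total mass 1, so that the torus is a
  product of measure spaces indexed by any finite set of variables, and Fubini's theorem is available
  for splitting the set of variables.
\<close>

definition angle_measure :: "real measure" where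
  "angle_measure = density lborel (\<lambda>\<theta>. ennreal (indicator {0..2*pi} \<theta> / (2*pi)))"

definition circ :: "complex measure" where
  "circ = distr angle_measure (restrict_space borel (sphere 0 1)) cis"

lemma space_circ [simp]: "space circ = sphere 0 1"
  by (simp add: circ_def space_restrict_space)

lemma sets_circ [measurable_cong]: "sets circ = sets (restrict_space borel (sphere 0 1))"
  by (simp add: circ_def)

lemma sets_angle_measure [measurable_cong]: "sets angle_measure = sets borel"
  by (simp add: angle_measure_def)

lemma measurable_cis_circ [measurable]: "cis \<in> borel \<rightarrow>\<^sub>M circ"
proof -
  have "cis \<in> borel \<rightarrow>\<^sub>M restrict_space borel (sphere 0 1)"
    by (intro measurable_restrict_space2) (auto intro!: borel_measurable_continuous_onI continuous_intros)
  then show ?thesis by (subst measurable_cong_sets[OF refl sets_circ])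
qed

lemma measurable_cis_angle: "cis \<in> angle_measure \<rightarrow>\<^sub>M restrict_space borel (sphere 0 1)"
  using measurable_cis_circ
  by (subst measurable_cong_sets[OF sets_angle_measure refl]) (simp add: measurable_cong_sets[OF refl sets_circ])

lemma emeasure_angle_measure: "emeasure angle_measure UNIV = 1"
proof -
  have "emeasure angle_measure UNIV = (\<integral>\<^sup>+\<theta>. ennreal (1 / (2*pi)) * indicator {0..2*pi} \<theta> \<partial>lborel)"
    unfolding angle_measure_def
    by (subst emeasure_density) (auto intro!: nn_integral_cong simp: indicator_def)
  also have "\<dots> = ennreal (1 / (2*pi)) * ennreal (2*pi)"
    by (subst nn_integral_cmult_indicator) auto
  also have "\<dots> = 1" by (simp add: ennreal_mult[symmetric])
  finally show ?thesis .
qed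

lemma emeasure_circ_space: "emeasure circ (space circ) = 1"
proof -
  have "cis -` sphere 0 1 = UNIV" by auto
  moreover have "sphere 0 1 \<in> sets (restrict_space borel (sphere (0::complex) 1))"
    by (auto simp: sets_restrict_space intro!: image_eqI[where x = "sphere 0 1"])
  moreover note measurable_cis_angle
  moreover have "space angle_measure = UNIV" by (simp add: angle_measure_def)
  ultimately show ?thesis
    unfolding space_circ unfolding circ_def by (simp add: emeasure_distr emeasure_angle_measure)
qed

interpretation circ: finite_measure circ
  by standard (use emeasure_circ_space in simp)

lemma circ_ident_measurable [measurable]: "(\<lambda>x. x) \<in> circ \<rightarrow>\<^sub>M borel"
  by (subst measurable_cong_sets[OF sets_circ refl]) (auto intro: measurable_restrict_space1)

lemma integral_circ:
  fixes f :: "complex \<Rightarrow> complex"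
  assumes [measurable]: "f \<in> borel_measurable circ"
  shows "(\<integral>z. f z \<partial>circ) = (LINT \<theta>:{0..2*pi}|lborel. f (cis \<theta>)) / (2 * pi)"
proof -
  have "(\<integral>z. f z \<partial>circ) = (\<integral>\<theta>. f (cis \<theta>) \<partial>angle_measure)"
    unfolding circ_def
    by (intro integral_distr measurable_cis_angle) (use assms measurable_cong_sets[OF sets_circ refl] in auto)
  also have "\<dots> = (LINT \<theta>|lborel. (indicator {0..2*pi} \<theta> / (2*pi)) *\<^sub>R f (cis \<theta>))"
    unfolding angle_measure_def by (subst integral_density) auto
  also have "\<dots> = (LINT \<theta>|lborel. (indicator {0..2*pi} \<theta> *\<^sub>R f (cis \<theta>)) / (2*pi))"
    by (intro Bochner_Integration.integral_cong) (auto simp: scaleR_conv_of_real)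
  also have "\<dots> = (LINT \<theta>:{0..2*pi}|lborel. f (cis \<theta>)) / (2 * pi)"
    unfolding set_lebesgue_integral_def by simp
  finally show ?thesis .
qed

lemma integral_circ_inverse:
  fixes f :: "complex \<Rightarrow> complex"
  assumes "f \<in> borel_measurable circ"
  shows "(\<integral>z. f (1 / z) \<partial>circ) = (\<integral>z. f z \<partial>circ)"
proof -
  have [measurable]: "(\<lambda>z. 1 / z) \<in> circ \<rightarrow>\<^sub>M circ"
    by (subst measurable_cong_sets[OF refl sets_circ], rule measurable_restrict_space2)
       (auto simp: norm_divide)
  note [measurable] = assms
  have "(LINT \<theta>:{0..2*pi}|lborel. f (cis \<theta>))
      = \<bar>-1\<bar> *\<^sub>R (LINT \<theta>|lborel. indicator {0..2*pi} (2*pi + (-1) * \<theta>) *\<^sub>R f (cis (2*pi + (-1) * \<theta>)))"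
    unfolding set_lebesgue_integral_def by (rule lborel_integral_real_affine) simp
  also have "\<dots> = (LINT \<theta>:{0..2*pi}|lborel. f (1 / cis \<theta>))"
    using cis_divide[of "2*pi"]
    by (auto intro!: Bochner_Integration.integral_cong simp: indicator_def set_lebesgue_integral_def)
  finally show ?thesis
    by (subst (1 2) integral_circ) auto
qed

text \<open>
  Along the circle \<open>cis \<theta>\<close> the integrand is, up to the factor \<open>\<i>\<close>, the derivative of \<open>\<phi> (c * cis \<theta>)\<close>.
\<close>

lemma integral_circ_derivative:
  assumes "open S" "\<phi> holomorphic_on S" "\<And>z. norm z = 1 \<Longrightarrow> c * z \<in> S"
  shows "(\<integral>z. c * z * deriv \<phi> (c * z) \<partial>circ) = 0"
proof -
  have contd: "continuous_on S (deriv \<phi>)"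
    by (intro holomorphic_on_imp_continuous_on holomorphic_deriv assms)
  have cont: "continuous_on A (\<lambda>\<theta>. c * cis \<theta> * deriv \<phi> (c * cis \<theta>))" for A
    by (intro continuous_intros continuous_on_compose2[OF contd]) (use assms(3) in auto)
  have "continuous_on (sphere 0 1) (\<lambda>z. c * z * deriv \<phi> (c * z))"
    by (intro continuous_intros continuous_on_compose2[OF contd]) (use assms(3) in auto)
  then have meas: "(\<lambda>z. c * z * deriv \<phi> (c * z)) \<in> borel_measurable circ"
    by (subst measurable_cong_sets[OF sets_circ refl]) (rule borel_measurable_continuous_on_restrict)
  have "((\<lambda>\<theta>. \<i> * (c * cis \<theta> * deriv \<phi> (c * cis \<theta>))) has_integral (\<phi> (c * cis (2*pi)) - \<phi> (c * cis 0))) {0..2*pi}"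
  proof (rule fundamental_theorem_of_calculus)
    fix x
    have "(\<phi> has_field_derivative deriv \<phi> (c * cis x)) (at (c * cis x))"
      using assms by (intro holomorphic_derivI[of \<phi> S]) auto
    moreover have "(cis has_vector_derivative \<i> * cis x) (at x within {0..2*pi})"
      unfolding has_vector_derivative_def
      by (auto intro!: derivative_eq_intros simp: scaleR_conv_of_real)
    then have "((\<lambda>\<theta>. c * cis \<theta>) has_vector_derivative (c * (\<i> * cis x))) (at x within {0..2*pi})"
      by (rule has_vector_derivative_mult_right)
    ultimately have "((\<phi> \<circ> (\<lambda>\<theta>. c * cis \<theta>)) has_vector_derivative (c * (\<i> * cis x)) * deriv \<phi> (c * cis x)) (at x within {0..2*pi})"
      by (metis field_vector_diff_chain_within has_field_derivative_at_within)
    then show "((\<lambda>\<theta>. \<phi> (c * cis \<theta>)) has_vector_derivative \<i> * (c * cis x * deriv \<phi> (c * cis x))) (at x within {0..2*pi})"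
      by (simp only: o_def mult_ac)
  qed simp
  then have "((\<lambda>\<theta>. -\<i> * (\<i> * (c * cis \<theta> * deriv \<phi> (c * cis \<theta>)))) has_integral -\<i> * (\<phi> (c * cis (2*pi)) - \<phi> (c * cis 0))) {0..2*pi}"
    by (rule has_integral_mult_right)
  moreover have "-\<i> * (\<i> * x) = x" for x by (simp add: mult.assoc[symmetric])
  ultimately have "((\<lambda>\<theta>. c * cis \<theta> * deriv \<phi> (c * cis \<theta>)) has_integral 0) {0..2*pi}"
    by simp
  moreover have "set_integrable lborel {0..2*pi} (\<lambda>\<theta>. c * cis \<theta> * deriv \<phi> (c * cis \<theta>))"
    by (intro borel_integrable_atLeastAtMost' cont)
  ultimately have "(LINT \<theta>:{0..2*pi}|lborel. c * cis \<theta> * deriv \<phi> (c * cis \<theta>)) = 0"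
    by (simp add: set_borel_integral_eq_integral integral_unique)
  with meas show ?thesis by (simp add: integral_circ)
qed

text \<open>
  This is the shift of a circular contour. The derivative of the integral in \<open>c\<close> vanishes by the
  previous lemma.
\<close>

lemma integral_circ_scale:
  assumes S: "open S" "connected S" and hol: "\<phi> holomorphic_on S"
    and rot: "\<And>c z. c \<in> S \<Longrightarrow> norm z = 1 \<Longrightarrow> c * z \<in> S"
    and c: "c \<in> S" "c' \<in> S"
  shows "(\<integral>z. \<phi> (c * z) \<partial>circ) = (\<integral>z. \<phi> (c' * z) \<partial>circ)"
proof -
  have cont: "continuous_on S \<phi>" by (rule holomorphic_on_imp_continuous_on[OF hol])
  have der: "((\<lambda>s. \<phi> (s * z)) has_field_derivative z * deriv \<phi> (s * z)) (at s)" if "s \<in> S" "norm z = 1" for s z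
  proof -
    have "(\<phi> has_field_derivative deriv \<phi> (s * z)) (at (s * z))"
      using that S(1) hol rot by (intro holomorphic_derivI[of \<phi> S]) auto
    moreover have "((\<lambda>s. s * z) has_field_derivative z) (at s)"
      by (auto intro!: derivative_eq_intros)
    ultimately have "((\<lambda>s. \<phi> (s * z)) has_field_derivative deriv \<phi> (s * z) * z) (at s)"
      by (rule DERIV_chain2)
    then show ?thesis by (simp only: mult.commute)
  qed
  have "((\<lambda>s. \<integral>z. \<phi> (s * z) \<partial>circ) has_field_derivative 0) (at s)" if s: "s \<in> S" for s
  proof -
    have "((\<lambda>s. \<integral>z. \<phi> (s * z) \<partial>circ) has_field_derivative (\<integral>z. deriv (\<lambda>s. \<phi> (s * z)) s \<partial>circ)) (at s)"
    proof (rule has_field_derivative_parametric_integral[OF _ S(1) s])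
      show "(\<lambda>s. \<phi> (s * z)) holomorphic_on S" if "z \<in> space circ" for z
        using that der S(1) by (auto simp: holomorphic_on_open)
      show "(\<lambda>z. \<phi> (s * z)) \<in> borel_measurable circ" if "s \<in> S" for s
      proof -
        have "continuous_on (sphere 0 1) (\<lambda>z. \<phi> (s * z))"
          by (intro continuous_on_compose2[OF cont] continuous_intros) (use rot that in auto)
        then show ?thesis
          by (subst measurable_cong_sets[OF sets_circ refl]) (rule borel_measurable_continuous_on_restrict)
      qed
      fix s assume "s \<in> S"
      then obtain r where r: "r > 0" "cball s r \<subseteq> S" using S(1) open_contains_cball by blast
      have "compact ((\<lambda>(x, z). \<phi> (x * z)) ` (cball s r \<times> sphere 0 1))"
        unfolding split_def
        by (intro compact_continuous_image continuous_on_compose2[OF cont] continuous_intros compact_Times)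
           (use r rot in \<open>auto simp: subset_iff\<close>)
      then have "bounded ((\<lambda>(x, z). \<phi> (x * z)) ` (cball s r \<times> sphere 0 1))"
        by (rule compact_imp_bounded)
      then obtain K where K: "\<forall>y \<in> (\<lambda>(x, z). \<phi> (x * z)) ` (cball s r \<times> sphere 0 1). norm y \<le> K"
        unfolding bounded_iff by (elim exE)
      have "norm (\<phi> (s' * z)) \<le> K" if "s' \<in> cball s r" "z \<in> space circ" for s' z
      proof -
        have "\<phi> (s' * z) \<in> (\<lambda>(x, z). \<phi> (x * z)) ` (cball s r \<times> sphere 0 1)"
          using that by (intro image_eqI[of _ _ "(s', z)"]) auto
        with K show ?thesis by (rule bspec)
      qed
      with r show "\<exists>r>0. \<exists>K. cball s r \<subseteq> S \<and> (\<forall>s'\<in>cball s r. \<forall>z\<in>space circ. norm (\<phi> (s' * z)) \<le> K)"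
        by (intro exI[of _ r] conjI exI[of _ K] ballI)
    qed (rule circ.finite_measure_axioms)
    also have "(\<integral>z. deriv (\<lambda>s. \<phi> (s * z)) s \<partial>circ) = (\<integral>z. z * deriv \<phi> (s * z) \<partial>circ)"
      using der[OF s] by (intro Bochner_Integration.integral_cong refl DERIV_imp_deriv) auto
    also have "\<dots> = 0"
    proof (cases "s = 0")
      case True
      have "(\<integral>z. 1 * z * deriv (\<lambda>z. z) (1 * z) \<partial>circ) = 0"
        by (rule integral_circ_derivative[of UNIV]) auto
      then show ?thesis using True by simp
    next
      case False
      have "s * (\<integral>z. z * deriv \<phi> (s * z) \<partial>circ) = (\<integral>z. s * z * deriv \<phi> (s * z) \<partial>circ)"
        by (simp add: mult.assoc)
      also have "\<dots> = 0" using s rot by (intro integral_circ_derivative[OF S(1) hol]) auto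
      finally show ?thesis using False by simp
    qed
    finally show ?thesis .
  qed
  then have "(\<lambda>s. \<integral>z. \<phi> (s * z) \<partial>circ) constant_on S"
    by (intro has_field_derivative_0_imp_constant_on S)
  then show ?thesis using c by (auto simp: constant_on_def)
qed

interpretation circs: product_sigma_finite "\<lambda>_. circ"
  by standard

interpretation lborels: product_sigma_finite "\<lambda>_. lborel :: real measure"
  by standard

abbreviation torus :: "nat set \<Rightarrow> (nat \<Rightarrow> complex) measure" where
  "torus I \<equiv> PiM I (\<lambda>_. circ)"

lemma norm_torus: "z \<in> space (torus I) \<Longrightarrow> i \<in> I \<Longrightarrow> norm (z i) = 1"
  by (auto simp: space_PiM PiE_iff)

lemma finite_measure_torus: "finite I \<Longrightarrow> finite_measure (torus I)"
  using circs.emeasure_PiM[of I "\<lambda>_. space circ"] emeasure_circ_space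
  by (intro finite_measureI) (simp add: space_PiM sets.top[of circ, simplified])

lemma torus_component [measurable]: "i \<in> I \<Longrightarrow> (\<lambda>z. z i) \<in> torus I \<rightarrow>\<^sub>M borel"
  using measurable_compose[of "\<lambda>z. z i" "torus I" circ "\<lambda>x. x" borel] measurable_component_singleton[of i I "\<lambda>_. circ"]
  by simp

lemma measurable_cis_lborel: "cis \<in> lborel \<rightarrow>\<^sub>M circ"
  by simp

lemma torus_eq_distr:
  assumes "finite I"
  shows "torus I = distr (density (PiM I (\<lambda>_. lborel)) (\<lambda>\<theta>. ennreal (indicator (I \<rightarrow>\<^sub>E {0..2*pi}) \<theta> / (2*pi) ^ card I)))
            (torus I) (\<lambda>\<theta>. \<lambda>i\<in>I. cis (\<theta> i))" (is "_ = ?P")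
proof (rule circs.PiM_eqI[OF assms, symmetric])
  show "sets ?P = sets (torus I)" by simp
  fix A assume A: "\<And>i. i \<in> I \<Longrightarrow> A i \<in> sets circ"
  let ?d = "\<lambda>\<theta>::real. ennreal (indicator {0..2*pi} \<theta> / (2*pi))"
  have m: "(\<lambda>\<theta>. \<lambda>i\<in>I. cis (\<theta> i)) \<in> PiM I (\<lambda>_. lborel) \<rightarrow>\<^sub>M torus I"
    by (intro measurable_restrict measurable_compose[OF measurable_component_singleton] measurable_cis_lborel)
  have sA: "Pi\<^sub>E I A \<in> sets (torus I)" using A assms by (intro sets_PiM_I_finite) auto
  have d: "ennreal (indicator (I \<rightarrow>\<^sub>E {0..2*pi}) \<theta> / (2*pi) ^ card I) = (\<Prod>i\<in>I. ?d (\<theta> i))"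
    if "\<theta> \<in> space (PiM I (\<lambda>_. lborel))" for \<theta>
  proof -
    have "indicator (I \<rightarrow>\<^sub>E {0..2*pi}) \<theta> = (\<Prod>i\<in>I. indicator {0..2*pi} (\<theta> i) :: real)"
      using that assms by (auto simp: indicator_def space_PiM PiE_iff prod_zero_iff)
    then have "indicator (I \<rightarrow>\<^sub>E {0..2*pi}) \<theta> / (2*pi) ^ card I = (\<Prod>i\<in>I. indicator {0..2*pi} (\<theta> i) / (2*pi))"
      by (simp add: prod_dividef)
    then show ?thesis by (simp only: prod_ennreal[symmetric] indicator_pos_le divide_nonneg_nonneg pi_ge_zero mult_nonneg_nonneg zero_le_numeral)
  qed
  have box: "(I \<rightarrow>\<^sub>E {0..2*pi}) \<in> sets (PiM I (\<lambda>_. lborel :: real measure))"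
    using assms by (intro sets_PiM_I_finite) auto
  have "emeasure ?P (Pi\<^sub>E I A) = emeasure (density (PiM I (\<lambda>_. lborel)) (\<lambda>\<theta>. ennreal (indicator (I \<rightarrow>\<^sub>E {0..2*pi}) \<theta> / (2*pi) ^ card I)))
      ((\<lambda>\<theta>. \<lambda>i\<in>I. cis (\<theta> i)) -` Pi\<^sub>E I A \<inter> space (PiM I (\<lambda>_. lborel)))"
    using m sA by (subst emeasure_distr) auto
  also have "\<dots> = (\<integral>\<^sup>+\<theta>. ennreal (indicator (I \<rightarrow>\<^sub>E {0..2*pi}) \<theta> / (2*pi) ^ card I) *
      indicator ((\<lambda>\<theta>. \<lambda>i\<in>I. cis (\<theta> i)) -` Pi\<^sub>E I A \<inter> space (PiM I (\<lambda>_. lborel))) \<theta> \<partial>PiM I (\<lambda>_. lborel))"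
    using measurable_sets[OF m sA] box by (subst emeasure_density) auto
  also have "\<dots> = (\<integral>\<^sup>+\<theta>. (\<Prod>i\<in>I. ?d (\<theta> i) * indicator (A i) (cis (\<theta> i))) \<partial>PiM I (\<lambda>_. lborel))"
  proof (rule nn_integral_cong)
    fix \<theta> assume \<theta>: "\<theta> \<in> space (PiM I (\<lambda>_. lborel :: real measure))"
    have "indicator ((\<lambda>\<theta>. \<lambda>i\<in>I. cis (\<theta> i)) -` Pi\<^sub>E I A \<inter> space (PiM I (\<lambda>_. lborel))) \<theta>
       = (\<Prod>i\<in>I. indicator (A i) (cis (\<theta> i)) :: ennreal)"
      using \<theta> assms by (auto simp: indicator_def space_PiM PiE_iff prod_zero_iff)
    then show "ennreal (indicator (I \<rightarrow>\<^sub>E {0..2*pi}) \<theta> / (2*pi) ^ card I) *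
      indicator ((\<lambda>\<theta>. \<lambda>i\<in>I. cis (\<theta> i)) -` Pi\<^sub>E I A \<inter> space (PiM I (\<lambda>_. lborel))) \<theta> = (\<Prod>i\<in>I. ?d (\<theta> i) * indicator (A i) (cis (\<theta> i)))"
      by (simp only: d[OF \<theta>] prod.distrib)
  qed
  also have "\<dots> = (\<Prod>i\<in>I. \<integral>\<^sup>+\<theta>. ?d \<theta> * indicator (A i) (cis \<theta>) \<partial>lborel)"
    using assms A by (intro lborels.product_nn_integral_prod) auto
  also have "\<dots> = (\<Prod>i\<in>I. emeasure circ (A i))"
  proof (rule prod.cong[OF refl])
    fix i assume "i \<in> I"
    have Ai: "A i \<in> sets (restrict_space borel (sphere 0 1))" using A[OF \<open>i \<in> I\<close>] by (simp add: sets_circ)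
    have "emeasure circ (A i) = emeasure angle_measure (cis -` A i \<inter> space angle_measure)"
      unfolding circ_def using Ai measurable_cis_angle by (rule emeasure_distr[rotated])
    also have "\<dots> = (\<integral>\<^sup>+\<theta>. ?d \<theta> * indicator (A i) (cis \<theta>) \<partial>lborel)"
      using measurable_sets[OF measurable_cis_angle Ai] unfolding angle_measure_def
      by (subst emeasure_density) (auto intro!: nn_integral_cong simp: indicator_def)
    finally show "(\<integral>\<^sup>+\<theta>. ?d \<theta> * indicator (A i) (cis \<theta>) \<partial>lborel) = emeasure circ (A i)" ..
  qed
  finally show "emeasure ?P (Pi\<^sub>E I A) = (\<Prod>i\<in>I. emeasure circ (A i))" .
qed

text \<open>
  On the torus \<open>dz\<^sub>i / z\<^sub>i = \<i> d\<theta>\<^sub>i\<close>, and the measure \<open>circ\<close> is \<open>d\<theta> / (2 pi)\<close>. The hypothesis \<open>dep\<close> is present because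
  points of a product measure space are \<open>undefined\<close> outside the index set, unlike the arguments in
  \<open>torus_integral\<close>.
\<close>

lemma torus_integral_conv_torus:
  assumes meas: "F \<in> borel_measurable (torus {1..n})"
    and dep: "\<And>z. F z = F (restrict z {1..n})"
  shows "torus_integral n (\<lambda>z. F z / (\<Prod>i=1..n. z i)) = (2 * of_real pi * \<i>) ^ n * (\<integral>z. F z \<partial>torus {1..n})"
proof -
  let ?I = "{1..n}" and ?B = "{1..n} \<rightarrow>\<^sub>E {0..2*pi}"
  let ?L = "PiM {1..n} (\<lambda>_. lborel :: real measure)"
  have m: "(\<lambda>\<theta>. \<lambda>i\<in>?I. cis (\<theta> i)) \<in> ?L \<rightarrow>\<^sub>M torus ?I"
    by (intro measurable_restrict measurable_compose[OF measurable_component_singleton] measurable_cis_lborel)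
  have box: "?B \<in> sets ?L" by (intro sets_PiM_I_finite) auto
  have "torus_integral n (\<lambda>z. F z / (\<Prod>i=1..n. z i)) = (LINT \<theta>|?L. \<i> ^ n * (indicator ?B \<theta> *\<^sub>R F (\<lambda>i\<in>?I. cis (\<theta> i))))"
    unfolding torus_integral_def set_lebesgue_integral_def
  proof (intro Bochner_Integration.integral_cong refl)
    fix \<theta> :: "nat \<Rightarrow> real"
    have "F (\<lambda>i. cis (\<theta> i)) = F (\<lambda>i\<in>?I. cis (\<theta> i))" by (subst dep) simp
    then show "indicator ?B \<theta> *\<^sub>R (F (\<lambda>i. cis (\<theta> i)) / (\<Prod>i=1..n. cis (\<theta> i)) * (\<Prod>i=1..n. \<i> * cis (\<theta> i)))
        = \<i> ^ n * (indicator ?B \<theta> *\<^sub>R F (\<lambda>i\<in>?I. cis (\<theta> i)))"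
      by (simp add: prod.distrib)
  qed
  also have "\<dots> = \<i> ^ n * (LINT \<theta>|?L. indicator ?B \<theta> *\<^sub>R F (\<lambda>i\<in>?I. cis (\<theta> i)))"
    by (rule Bochner_Integration.integral_mult_right_zero)
  also have "(LINT \<theta>|?L. indicator ?B \<theta> *\<^sub>R F (\<lambda>i\<in>?I. cis (\<theta> i)))
      = (2 * of_real pi) ^ n * (LINT \<theta>|?L. (indicator ?B \<theta> / (2*pi) ^ n) *\<^sub>R F (\<lambda>i\<in>?I. cis (\<theta> i)))"
    by (subst Bochner_Integration.integral_mult_right_zero[symmetric], intro Bochner_Integration.integral_cong refl)
       (simp add: scaleR_conv_of_real)
  also have "(LINT \<theta>|?L. (indicator ?B \<theta> / (2*pi) ^ n) *\<^sub>R F (\<lambda>i\<in>?I. cis (\<theta> i)))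
      = (LINT \<theta>|density ?L (\<lambda>\<theta>. ennreal (indicator ?B \<theta> / (2*pi) ^ n)). F (\<lambda>i\<in>?I. cis (\<theta> i)))"
    using measurable_compose[OF m meas] box by (subst integral_density) auto
  also have "\<dots> = (LINT z|distr (density ?L (\<lambda>\<theta>. ennreal (indicator ?B \<theta> / (2*pi) ^ n))) (torus ?I) (\<lambda>\<theta>. \<lambda>i\<in>?I. cis (\<theta> i)). F z)"
    using m meas by (subst integral_distr) auto
  also have "\<dots> = (\<integral>z. F z \<partial>torus ?I)"
    by (subst (2) torus_eq_distr) simp_all
  finally show ?thesis by (simp add: power_mult_distrib mult_ac)
qed

section \<open>Interpolation by theta functions\<close>

lemma factor_out_indexed_zeros:
  fixes f :: "complex \<Rightarrow> complex"
  assumes "finite J" "inj_on y J" "open U" "\<And>j. j \<in> J \<Longrightarrow> y j \<in> U" "f holomorphic_on U" "\<And>j. j \<in> J \<Longrightarrow> f (y j) = 0"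
  obtains g where "g holomorphic_on U" "\<And>z. z \<in> U \<Longrightarrow> f z = (\<Prod>j\<in>J. z - y j) * g z"
proof -
  have "\<exists>g. g holomorphic_on U \<and> (\<forall>z\<in>U. f z = (\<Prod>v\<in>y ` J. z - v) * g z)"
    using assms by (intro factor_out_finite_zeros) auto
  then show ?thesis using that assms(2) by (auto simp: prod.reindex)
qed

lemma theta_double_factor:
  assumes "norm r < 1"
  shows "theta r u = (1 - u) * (1 - r * u) * (1 - r / u) * (qpoch (r * (r * u)) r * qpoch (r * (r / u)) r)"
  using theta_factor[OF assms, of u] qpoch_split[OF assms, of "r * u"] qpoch_split[OF assms, of "r / u"]
  by (simp add: mult_ac)

text \<open>
  The two functional equations of \<open>f\<close> force zeros at \<open>\<plusminus>1\<close> and at the square roots of \<open>p\<close>. Together with the given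
  zeros \<open>x\<^sub>i\<close>, and \<open>1 / x\<^sub>i\<close>, these are the zeros of
  \<open>theta p (z\<^sup>2) * (\<Prod>i\<in>I. theta_pm p z (x i))\<close>, which obeys the same functional equations. Hence the quotient is
  holomorphic and \<open>p\<close>-periodic, so constant, and it vanishes at the additional zero \<open>d\<close>.
\<close>

lemma theta_function_unique:
  fixes f :: "complex \<Rightarrow> complex" and x :: "'i \<Rightarrow> complex"
  assumes p: "p \<noteq> 0" "norm p < 1"
    and hol: "f holomorphic_on - {0}"
    and inv: "\<And>z. z \<noteq> 0 \<Longrightarrow> f (1 / z) = - f z / z\<^sup>2"
    and per: "\<And>z. z \<noteq> 0 \<Longrightarrow> f (p * z) = f z / ((p * z\<^sup>2) ^ n * (p * z ^ 4))"
    and I: "finite I" "card I = n"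
    and x: "\<And>i. i \<in> I \<Longrightarrow> norm (x i) = 1" "\<And>i. i \<in> I \<Longrightarrow> (x i)\<^sup>2 \<noteq> 1" "inj_on x I"
      "\<And>i j. i \<in> I \<Longrightarrow> j \<in> I \<Longrightarrow> i \<noteq> j \<Longrightarrow> x i * x j \<noteq> 1"
    and fx: "\<And>i. i \<in> I \<Longrightarrow> f (x i) = 0"
    and d: "norm p < norm d ^ 2" "norm d < 1" "f d = 0"
    and z: "z \<noteq> 0"
  shows "f z = 0"
proof -
  \<comment> \<open>The annulus \<open>\<sigma>\<^sup>3 < norm z < 1 / \<sigma>\<^sup>3\<close> has ratio of radii \<open>\<sigma>\<^sup>-\<^sup>6\<close>, more than the period \<open>\<sigma>\<^sup>-\<^sup>4\<close>.\<close>
  define \<sigma> where "\<sigma> = sqrt (sqrt (norm p))"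
  have sq: "\<sigma> ^ 2 = sqrt (norm p)" unfolding \<sigma>_def by simp
  have "\<sigma> ^ 4 = (\<sigma> ^ 2) ^ 2" by (simp flip: power_mult)
  also have "\<dots> = norm p" unfolding sq by simp
  finally have \<sigma>4: "\<sigma> ^ 4 = norm p" "\<sigma> ^ 2 = sqrt (norm p)" using sq by auto
  have \<sigma>: "0 < \<sigma>" "\<sigma> < 1" unfolding \<sigma>_def using p by auto
  have \<sigma>le: "\<sigma> ^ 3 < \<sigma>\<^sup>2" "\<sigma>\<^sup>2 < \<sigma>" "\<sigma> ^ 3 < 1" "\<sigma>\<^sup>2 < 1"
    using \<sigma> power_strict_decreasing[of 2 3 \<sigma>] power_strict_decreasing[of 1 2 \<sigma>] power_Suc_less_one[of \<sigma> 2] power_Suc_less_one[of \<sigma> 1]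
    by (auto simp: numeral_2_eq_2 numeral_3_eq_3)
  define U where "U = {z::complex. \<sigma> ^ 3 < norm z \<and> norm z < 1 / \<sigma> ^ 3}"
  have openU: "open U" unfolding U_def by (intro open_Collect_conj open_Collect_less continuous_intros)
  have U0: "z \<noteq> 0" if "z \<in> U" for z using that \<sigma> by (auto simp: U_def)
  define s where "s = csqrt p"
  have s: "s\<^sup>2 = p" "s \<noteq> 0" unfolding s_def using p by auto
  have norm_s: "norm s = \<sigma>\<^sup>2" unfolding s_def \<sigma>4 by (simp add: norm_csqrt)
  \<comment> \<open>the zeros of \<open>theta p (z\<^sup>2)\<close> in the annulus\<close>
  define Y where "Y = {1, -1, s, -s, 1/s, -1/s}"
  have zY: "f 1 = 0" "f (-1) = 0" using inv[of 1] inv[of "-1"] by (simp_all add: equation_minus_iff)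
  have zs: "f t = 0" if "t\<^sup>2 = p" for t
  proof -
    have t: "t \<noteq> 0" using that p by auto
    have "p * (1 / t) = t" using that t by (simp add: field_simps power2_eq_square)
    then have "f t = f (1 / t) / ((p * (1 / t)\<^sup>2) ^ n * (p * (1 / t) ^ 4))" using per[of "1 / t"] t by simp
    also have "p * (1 / t)\<^sup>2 = 1" using that t by (simp add: power_divide p(1))
    also have "p * (1 / t) ^ 4 = 1 / p"
    proof -
      have "t ^ 4 = p\<^sup>2" using that by (metis mult_2 numeral_Bit0 power_add power2_eq_square)
      then show ?thesis using p(1) by (simp add: power_divide power2_eq_square)
    qed
    finally have "f t = p * f (1 / t)" using p by simp
    also have "\<dots> = - f t" using inv[OF t] that p by simp
    finally show ?thesis by (simp add: equation_minus_iff)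
  qed
  have fY: "f y = 0" if "y \<in> Y" for y
  proof -
    have "f s = 0" "f (-s) = 0" using zs s by auto
    then have "f (1 / s) = 0" "f (1 / (-s)) = 0" using inv[of s] inv[of "-s"] s by auto
    then show ?thesis using that zY \<open>f s = 0\<close> \<open>f (-s) = 0\<close> unfolding Y_def by auto
  qed
  have YU: "Y \<subseteq> U"
  proof -
    have "1 < 1 / \<sigma> ^ 3" using \<sigma> \<sigma>le by simp
    moreover have "1 / \<sigma>\<^sup>2 < 1 / \<sigma> ^ 3" using \<sigma> \<sigma>le by (simp add: frac_less2)
    moreover have "1 < 1 / \<sigma>\<^sup>2" using \<sigma> \<sigma>le by simp
    ultimately have "\<sigma>\<^sup>2 < 1 / \<sigma> ^ 3" "\<sigma> ^ 3 < 1 / \<sigma>\<^sup>2" "1 / \<sigma>\<^sup>2 < 1 / \<sigma> ^ 3" "1 < 1 / \<sigma> ^ 3"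
      using \<sigma>le by linarith+
    then show ?thesis unfolding Y_def U_def using \<sigma>le norm_s by (auto simp: norm_divide)
  qed
  have prodY: "(\<Prod>y\<in>Y. z - y) = (z\<^sup>2 - 1) * (z\<^sup>2 - p) * (z\<^sup>2 - 1 / p)" for z
  proof -
    have ns: "norm s < 1" using norm_s \<sigma>le by simp
    have n1: "1 \<noteq> s" "-1 \<noteq> s" "1 \<noteq> -s" 
    proof -
      show "1 \<noteq> s" "-1 \<noteq> s" using ns by auto
      have "norm (-s) < 1" using ns by simp
      then show "1 \<noteq> -s" by (metis less_irrefl norm_one)
    qed
    moreover have "s * s \<noteq> 1" "s * s \<noteq> -1"
    proof -
      have "norm (s * s) < 1" using ns mult_strict_mono[of "norm s" 1 "norm s" 1] by (simp add: norm_mult)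
      then show "s * s \<noteq> 1" "s * s \<noteq> -1" by auto
    qed
    moreover from this have "s \<noteq> 1 / s" "s \<noteq> - (1 / s)" "1 \<noteq> - (1 / s)" "1 \<noteq> 1 / s" "-1 \<noteq> 1 / s"
      using s n1 by (auto simp: field_simps)
    ultimately have "(\<Prod>y\<in>Y. z - y) = (z - 1) * ((z + 1) * ((z - s) * ((z + s) * ((z - 1/s) * (z + 1/s)))))"
      unfolding Y_def using s by (subst prod.insert; simp add: eq_divide_eq divide_eq_eq minus_equation_iff eq_commute[of "-1 :: complex"])+
    also have "(z - 1/s) * (z + 1/s) = z\<^sup>2 - 1 / s\<^sup>2"
      by (simp add: algebra_simps power2_eq_square)
    also have "(z - 1) * ((z + 1) * ((z - s) * ((z + s) * c))) = (z\<^sup>2 - 1) * (z\<^sup>2 - s\<^sup>2) * c" for c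
      by (simp add: algebra_simps power2_eq_square)
    finally show ?thesis by (simp add: s)
  qed
  have "f holomorphic_on U" using U0 by (intro holomorphic_on_subset[OF hol]) auto
  then obtain g0 where g0: "g0 holomorphic_on U" "\<And>z. z \<in> U \<Longrightarrow> f z = (\<Prod>y\<in>Y. z - y) * g0 z"
    using factor_out_indexed_zeros[of Y "\<lambda>y. y" U f] openU YU fY by (auto simp: Y_def)
  define J where "J = I \<times> (UNIV :: bool set)"
  define y where "y = (\<lambda>(i, b). if b then x i else 1 / x i)"
  have ny: "norm (y j) = 1" if "j \<in> J" for j
    using that x(1) by (auto simp: J_def y_def norm_divide)
  have y2: "(y j)\<^sup>2 \<noteq> 1" if "j \<in> J" for j
    using that x(1,2) by (auto simp: J_def y_def power_divide divide_eq_eq split: if_splits)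
  have U1: "w \<in> U" if "norm w = 1" for w
    using that \<sigma>le \<sigma> by (auto simp: U_def)
  have x0: "x i \<noteq> 0" if "i \<in> I" for i using x(1)[OF that] by auto
  have inj: "inj_on y J"
  proof (rule inj_onI)
    fix j k assume jk: "j \<in> J" "k \<in> J" "y j = y k"
    obtain a b a' b' where ab: "j = (a, b)" "k = (a', b')" by (cases j, cases k) auto
    have aI: "a \<in> I" "a' \<in> I" using jk ab by (auto simp: J_def)
    show "j = k"
    proof (cases "b = b'")
      case True
      then have "x a = x a'" using jk(3) ab x0 aI by (auto simp: y_def split: if_splits)
      then show ?thesis using x(3) aI ab True by (auto dest: inj_onD)
    next
      case False
      then have "x a * x a' = 1" using jk(3) ab x0 aI by (auto simp: y_def field_simps split: if_splits)
      then have "a = a'" using x(4) aI by blast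
      then show ?thesis using \<open>x a * x a' = 1\<close> x(2) aI by (auto simp: power2_eq_square)
    qed
  qed
  have fy: "f (y j) = 0" if "j \<in> J" for j
    using that fx inv x0 by (auto simp: J_def y_def)
  have PY: "(\<Prod>v\<in>Y. w - v) \<noteq> 0" if "norm w = 1" "w\<^sup>2 \<noteq> 1" for w
  proof -
    have "norm (w\<^sup>2) = 1" using that by (simp add: norm_power)
    moreover have "norm (1 / p) > 1" using p by (simp add: norm_divide)
    ultimately have "w\<^sup>2 \<noteq> p" "w\<^sup>2 \<noteq> 1 / p" using p by auto
    with that show ?thesis unfolding prodY by auto
  qed
  have "g0 (y j) = 0" if "j \<in> J" for j
    using g0(2)[OF U1[OF ny[OF that]]] fy[OF that] PY[OF ny[OF that] y2[OF that]] by auto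
  then obtain g where g: "g holomorphic_on U" "\<And>z. z \<in> U \<Longrightarrow> g0 z = (\<Prod>j\<in>J. z - y j) * g z"
    using factor_out_indexed_zeros[of J y U g0] I inj openU U1 ny g0(1) by (auto simp: J_def)
  \<comment> \<open>The factors of the denominator without the zeros in the annulus; their product \<open>k\<close> has none there.\<close>
  define \<theta>0 where "\<theta>0 u = qpoch (p * u) p * qpoch (p / u) p" for u
  define \<theta>1 where "\<theta>1 u = qpoch (p * (p * u)) p * qpoch (p * (p / u)) p" for u
  define k where "k z = p / z\<^sup>2 * \<theta>1 (z\<^sup>2) * (\<Prod>i\<in>I. \<theta>0 (z * x i) * \<theta>0 (z / x i) / z)" for z
  define Den where "Den z = theta p (z\<^sup>2) * (\<Prod>i\<in>I. theta_pm p z (x i))" for z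
  have Den: "Den z = (\<Prod>v\<in>Y. z - v) * (\<Prod>j\<in>J. z - y j) * k z" if z: "z \<noteq> 0" for z
  proof -
    have "(\<Prod>j\<in>J. z - y j) = (\<Prod>i\<in>I. \<Prod>b\<in>UNIV. z - y (i, b))"
      unfolding J_def using I by (subst prod.cartesian_product) (auto simp: split_def)
    also have "\<dots> = (\<Prod>i\<in>I. (z - x i) * (z - 1 / x i))"
      by (simp add: UNIV_bool y_def mult.commute)
    finally have 1: "(\<Prod>j\<in>J. z - y j) = (\<Prod>i\<in>I. (z - x i) * (z - 1 / x i))" .
    have "theta_pm p z (x i) = ((z - x i) * (z - 1 / x i)) * (\<theta>0 (z * x i) * \<theta>0 (z / x i) / z)" if "i \<in> I" for i
      unfolding theta_pm_def theta_factor[OF p(2)] \<theta>0_def using x0[OF that] z by (simp add: field_simps)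
    then have 2: "(\<Prod>i\<in>I. theta_pm p z (x i)) = (\<Prod>i\<in>I. (z - x i) * (z - 1 / x i)) * (\<Prod>i\<in>I. \<theta>0 (z * x i) * \<theta>0 (z / x i) / z)"
      by (simp flip: prod.distrib)
    have 3: "theta p (z\<^sup>2) = ((z\<^sup>2 - 1) * (z\<^sup>2 - p) * (z\<^sup>2 - 1 / p)) * (p / z\<^sup>2 * \<theta>1 (z\<^sup>2))"
      unfolding theta_double_factor[OF p(2)] \<theta>1_def using z p(1) by (simp add: field_simps)
    show ?thesis unfolding Den_def k_def 1 2 3 prodY by (simp only: mult_ac)
  qed
  have \<theta>nz: "\<theta>0 (z * w) \<noteq> 0" if "z \<in> U" "norm w = 1" for z w
  proof -
    have nz: "norm p * norm z < 1" "norm p < norm z"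
    proof -
      have "norm p < \<sigma> ^ 3" unfolding \<sigma>4(1)[symmetric] using \<sigma> by (intro power_strict_decreasing) auto
      then show "norm p < norm z" using that by (auto simp: U_def)
      have "norm z * \<sigma> ^ 3 < 1" using that \<sigma> by (auto simp: U_def field_simps)
      moreover have "norm z * norm p \<le> norm z * \<sigma> ^ 3" using \<open>norm p < \<sigma> ^ 3\<close> by (intro mult_left_mono) auto
      ultimately show "norm p * norm z < 1" by (simp add: mult.commute)
    qed
    then show ?thesis unfolding \<theta>0_def using p that U0[OF that(1)]
      by (simp add: qpoch_nonzero norm_mult norm_divide divide_less_eq)
  qed
  have \<theta>1nz: "\<theta>1 (z\<^sup>2) \<noteq> 0" if "z \<in> U" for z
  proof -
    have nz: "norm p * norm p * norm z ^ 2 < 1" "norm p * norm p < norm z ^ 2"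
    proof -
      have "norm p * norm p = \<sigma> ^ 8" unfolding \<sigma>4(1)[symmetric] by (simp flip: power_add)
      also have "\<sigma> ^ 8 < (\<sigma> ^ 3) ^ 2" unfolding power_mult[symmetric] using \<sigma> by (intro power_strict_decreasing) auto
      finally have *: "norm p * norm p < (\<sigma> ^ 3) ^ 2" .
      also have "(\<sigma> ^ 3) ^ 2 \<le> norm z ^ 2" using that \<sigma> by (intro power_mono) (auto simp: U_def)
      finally show "norm p * norm p < norm z ^ 2" .
      have "norm z * \<sigma> ^ 3 \<le> 1" using that \<sigma> by (auto simp: U_def field_simps)
      then have "(norm z * \<sigma> ^ 3) ^ 2 \<le> 1" using \<sigma> by (intro power_le_one) auto
      moreover have "norm z ^ 2 * (norm p * norm p) < norm z ^ 2 * (\<sigma> ^ 3) ^ 2" using * U0[OF that] by (intro mult_strict_left_mono) auto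
      ultimately show "norm p * norm p * norm z ^ 2 < 1" by (simp add: mult.commute power_mult_distrib)
    qed
    then show ?thesis unfolding \<theta>1_def using p U0[OF that]
      by (simp add: qpoch_nonzero norm_mult norm_divide norm_power divide_less_eq mult.assoc)
  qed
  have knz: "k z \<noteq> 0" if "z \<in> U" for z
  proof -
    have "\<theta>0 (z / x i) \<noteq> 0" if "i \<in> I" for i
      using \<theta>nz[OF \<open>z \<in> U\<close>, of "1 / x i"] x(1)[OF that] by (simp add: norm_divide)
    then show ?thesis using that U0[OF that] p \<theta>nz[OF that] \<theta>1nz[OF that] x(1) I by (auto simp: k_def)
  qed
  have kh: "k holomorphic_on U"
    unfolding k_def \<theta>0_def \<theta>1_def using U0 x0 p by (intro holomorphic_intros) auto
  define Q where "Q z = g z / k z" for z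
  have Qh: "Q holomorphic_on U" unfolding Q_def using g(1) kh knz by (intro holomorphic_intros) auto
  have fQ: "f z = Q z * Den z" if "z \<in> U" for z
    using g0(2)[OF that] g(2)[OF that] Den[OF U0[OF that]] knz[OF that] by (simp add: Q_def)
  have Denper: "Den (p * z) = Den z / ((p * z\<^sup>2) ^ n * (p * z ^ 4))" if z: "z \<noteq> 0" for z
  proof -
    have "theta p ((p * z)\<^sup>2) = theta p (p * (p * z\<^sup>2))" by (simp add: power_mult_distrib power2_eq_square mult_ac)
    also have "\<dots> = theta p (z\<^sup>2) / (p * z ^ 4)"
      using z p by (simp add: theta_shift power2_eq_square power4_eq_xxxx)
    finally have "theta p ((p * z)\<^sup>2) = theta p (z\<^sup>2) / (p * z ^ 4)" .
    moreover have "(\<Prod>i\<in>I. theta_pm p (p * z) (x i)) = (\<Prod>i\<in>I. theta_pm p z (x i)) / (p * z\<^sup>2) ^ n"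
      using p z x0 I by (simp add: theta_pm_shift prod_dividef)
    ultimately show ?thesis by (simp add: Den_def)
  qed
  define V where "V = {z::complex. 1 / \<sigma> < norm z \<and> norm z < 1 / \<sigma>\<^sup>2}"
  have Dnz: "Den z \<noteq> 0" if "z \<in> U" "norm z \<noteq> 1" "norm z \<noteq> \<sigma>\<^sup>2" "norm z \<noteq> 1 / \<sigma>\<^sup>2" for z
  proof -
    have "z \<notin> Y" using that(2-4) norm_s unfolding Y_def by (auto simp: norm_divide)
    moreover have "z \<noteq> y j" if "j \<in> J" for j using ny[OF that] \<open>norm z \<noteq> 1\<close> by auto
    moreover have "finite Y" "finite J" using I by (auto simp: Y_def J_def)
    ultimately show ?thesis using Den[OF U0[OF that(1)]] knz[OF that(1)] by auto
  qed
  have const: "Q z = Q d" if "z \<in> U" "d \<in> U" for z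
  proof (rule periodic_on_annulus_constant[of p "\<sigma> ^ 3" "1 / \<sigma> ^ 3" Q V])
    show "Q holomorphic_on {z. \<sigma> ^ 3 < norm z \<and> norm z < 1 / \<sigma> ^ 3}" using Qh by (simp add: U_def)
    show "\<sigma> ^ 3 < norm p * (1 / \<sigma> ^ 3)"
    proof -
      have "\<sigma> ^ 3 * \<sigma> ^ 3 < \<sigma> ^ 4" unfolding power_add[symmetric] using \<sigma> by (intro power_strict_decreasing) auto
      then show ?thesis using \<sigma> by (simp add: pos_less_divide_eq \<sigma>4(1))
    qed
    show "open V" unfolding V_def by (intro open_Collect_conj open_Collect_less continuous_intros)
    have "1 / \<sigma> < 1 / \<sigma>\<^sup>2" using \<sigma> \<sigma>le by (simp add: frac_less2)
    then obtain v where "1 / \<sigma> < v" "v < 1 / \<sigma>\<^sup>2" using dense by blast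
    moreover from this have "0 < v" using \<sigma> by (meson less_trans zero_less_divide_1_iff)
    ultimately have "of_real v \<in> V" by (simp add: V_def)
    then show "V \<noteq> {}" by auto
    fix w assume w: "w \<in> V"
    have w1: "1 < norm w * \<sigma>" "norm w * \<sigma>\<^sup>2 < 1" using w \<sigma> by (auto simp: V_def field_simps)
    have "norm w * \<sigma> ^ 3 < 1 * \<sigma>" using w1(2) \<sigma> mult_strict_right_mono[of "norm w * \<sigma>\<^sup>2" 1 \<sigma>] by (simp add: power2_eq_square power3_eq_cube mult_ac)
    then have w2: "norm w * \<sigma> ^ 3 < 1" using \<sigma> by linarith
    have "1 < norm w"
    proof (rule ccontr)
      assume "\<not> 1 < norm w"
      then have "norm w * \<sigma> \<le> 1 * \<sigma>" using \<sigma> by (intro mult_right_mono) auto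
      then show False using w1 \<sigma> by linarith
    qed
    then have wU: "w \<in> U" using w2 \<sigma> \<sigma>le by (auto simp: U_def field_simps)
    have npw: "norm (p * w) = norm w * \<sigma> ^ 4" by (simp add: norm_mult \<sigma>4(1))
    have "norm w * \<sigma> ^ 4 > \<sigma> ^ 3"
      using mult_strict_right_mono[OF w1(1), of "\<sigma> ^ 3"] \<sigma> by (simp add: power4_eq_xxxx power3_eq_cube mult_ac)
    moreover have lt: "norm w * \<sigma> ^ 4 < \<sigma>\<^sup>2"
      using mult_strict_right_mono[OF w1(2), of "\<sigma>\<^sup>2"] \<sigma> by (simp add: power4_eq_xxxx power2_eq_square mult_ac)
    moreover have "\<sigma>\<^sup>2 < 1 / \<sigma> ^ 3" 
    proof -
      have "1 < 1 / \<sigma> ^ 3" using \<sigma> \<sigma>le by simp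
      with \<sigma>le show ?thesis by linarith
    qed
    ultimately have pwU: "p * w \<in> U" unfolding U_def mem_Collect_eq npw by linarith
    have "Den w \<noteq> 0" using wU \<open>1 < norm w\<close> \<sigma>le(4) w1(2) \<sigma> by (intro Dnz) auto
    then have "Q (p * w) = Q w"
      using per[of w] Denper[of w] fQ[OF wU] fQ[OF pwU] U0[OF wU] p by simp
    with wU pwU show "w \<in> {z. \<sigma> ^ 3 < norm z \<and> norm z < 1 / \<sigma> ^ 3} \<and> p * w \<in> {z. \<sigma> ^ 3 < norm z \<and> norm z < 1 / \<sigma> ^ 3} \<and> Q (p * w) = Q w"
      by (auto simp: U_def)
  qed (use p \<sigma> that in \<open>auto simp: U_def\<close>)
  have "(\<sigma>\<^sup>2)\<^sup>2 < norm d ^ 2" using d(1) unfolding \<sigma>4(1)[symmetric] by (simp flip: power_mult)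
  then have d2: "\<sigma>\<^sup>2 < norm d" using power2_less_imp_less by fastforce
  moreover have "1 / \<sigma> ^ 3 > 1" "1 / \<sigma>\<^sup>2 > 1" using \<sigma> \<sigma>le by auto
  ultimately have dU: "d \<in> U" "norm d \<noteq> 1 / \<sigma>\<^sup>2" using d(2) \<sigma>le unfolding U_def by auto
  have "Q d = 0" using fQ[OF dU(1)] Dnz[OF dU(1)] d dU(2) d2 by auto
  then have "f w = 0" if "w \<in> U" for w using fQ[OF that] const[OF that dU(1)] by simp
  moreover have "U \<noteq> {}" using dU by auto
  moreover have "connected (- {0::complex})" by (rule connected_punctured_universe) simp
  ultimately show ?thesis
    using analytic_continuation_open[of U "- {0}" f "\<lambda>_. 0" z] openU hol z U0 by (auto simp: open_delete)
qed

section \<open>Integrands depending on a parameter\<close>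

text \<open>
  The integrands below are products of many factors. This property of a factor is kept by products and
  implies that the integral exists and depends holomorphically on the parameter \<open>s\<close>; a function without
  parameter is treated as a constant family.
\<close>

definition tame_family :: "complex set \<Rightarrow> 'a measure \<Rightarrow> (complex \<Rightarrow> 'a \<Rightarrow> complex) \<Rightarrow> bool" where
  "tame_family S M F \<longleftrightarrow> (\<forall>w\<in>space M. (\<lambda>s. F s w) holomorphic_on S) \<and> (\<forall>s\<in>S. F s \<in> borel_measurable M) \<and>
     (\<forall>s\<in>S. \<exists>r>0. \<exists>K. cball s r \<subseteq> S \<and> (\<forall>s'\<in>cball s r. \<forall>w\<in>space M. norm (F s' w) \<le> K))"

abbreviation tame :: "'a measure \<Rightarrow> ('a \<Rightarrow> complex) \<Rightarrow> bool" where
  "tame M F \<equiv> tame_family UNIV M (\<lambda>_. F)"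

lemma tame_family_holomorphic_integral:
  assumes "finite_measure M" "open S" "tame_family S M F"
  shows "(\<lambda>s. \<integral>w. F s w \<partial>M) holomorphic_on S"
  by (rule holomorphic_parametric_integral[OF assms(1,2)]) (use assms(3) in \<open>simp_all add: tame_family_def\<close>)

lemma tame_family_integrable:
  assumes "finite_measure M" "tame_family S M F" "s \<in> S"
  shows "integrable M (F s)"
proof -
  interpret finite_measure M by fact
  obtain r K where "r > 0" "\<And>s' w. s' \<in> cball s r \<Longrightarrow> w \<in> space M \<Longrightarrow> norm (F s' w) \<le> K"
    using assms(2,3) unfolding tame_family_def by blast
  then show ?thesis
    using assms(2,3) by (intro integrable_const_bound[where B = K]) (auto simp: tame_family_def intro!: AE_I2)
qed

lemma tame_family_measurable: "tame_family S M F \<Longrightarrow> s \<in> S \<Longrightarrow> F s \<in> borel_measurable M"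
  by (auto simp: tame_family_def)

lemma tame_integrable: "finite_measure M \<Longrightarrow> tame M F \<Longrightarrow> integrable M F"
  using tame_family_integrable[of M UNIV "\<lambda>_. F"] by auto

lemma tame_measurable: "tame M F \<Longrightarrow> F \<in> borel_measurable M"
  by (auto simp: tame_family_def)

lemma locally_boundedI:
  assumes "0 < r" "cball s r \<subseteq> S" "\<And>s' w. s' \<in> cball s r \<Longrightarrow> w \<in> space M \<Longrightarrow> norm (F s' w :: complex) \<le> K"
  shows "\<exists>r>0. \<exists>K. cball s r \<subseteq> S \<and> (\<forall>s'\<in>cball s r. \<forall>w\<in>space M. norm (F s' w) \<le> K)"
proof -
  have "0 < r \<and> (\<exists>K. cball s r \<subseteq> S \<and> (\<forall>s'\<in>cball s r. \<forall>w\<in>space M. norm (F s' w) \<le> K))"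
    by (intro conjI exI[of _ K] ballI assms)
  then show ?thesis by (rule exI)
qed

named_theorems tame_intros

lemma tame_family_mult [tame_intros]:
  assumes F: "tame_family S M F" and G: "tame_family S M G"
  shows "tame_family S M (\<lambda>s w. F s w * G s w)"
  unfolding tame_family_def
proof (intro conjI ballI)
  fix s assume s: "s \<in> S"
  show "(\<lambda>w. F s w * G s w) \<in> borel_measurable M"
    using tame_family_measurable[OF F s] tame_family_measurable[OF G s] by (rule borel_measurable_times)
  obtain r K where r: "r > 0" "cball s r \<subseteq> S" and K: "\<And>s' w. s' \<in> cball s r \<Longrightarrow> w \<in> space M \<Longrightarrow> norm (F s' w) \<le> K"
    using F s unfolding tame_family_def by metis
  obtain r' K' where r': "r' > 0" and K': "\<And>s' w. s' \<in> cball s r' \<Longrightarrow> w \<in> space M \<Longrightarrow> norm (G s' w) \<le> K'"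
    using G s unfolding tame_family_def by metis
  show "\<exists>r>0. \<exists>K. cball s r \<subseteq> S \<and> (\<forall>s'\<in>cball s r. \<forall>w\<in>space M. norm (F s' w * G s' w) \<le> K)"
  proof (rule locally_boundedI[of "min r r'" _ _ _ _ "\<bar>K\<bar> * \<bar>K'\<bar>"])
    show "cball s (min r r') \<subseteq> S" using r by auto
    fix s' w assume "s' \<in> cball s (min r r')" "w \<in> space M"
    then have "norm (F s' w) \<le> \<bar>K\<bar>" "norm (G s' w) \<le> \<bar>K'\<bar>" using K[of s' w] K'[of s' w] by auto
    then show "norm (F s' w * G s' w) \<le> \<bar>K\<bar> * \<bar>K'\<bar>" unfolding norm_mult by (intro mult_mono) auto
  qed (use r r' in auto)
qed (use F G in \<open>auto simp: tame_family_def intro!: holomorphic_intros\<close>)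

lemma tame_family_scalar [tame_intros]:
  assumes "open S" "h holomorphic_on S"
  shows "tame_family S M (\<lambda>s w. h s)"
  unfolding tame_family_def
proof (intro conjI ballI)
  fix s assume "s \<in> S"
  then obtain r where r: "r > 0" "cball s r \<subseteq> S" using assms(1) open_contains_cball by blast
  have "compact (h ` cball s r)"
    using continuous_on_subset[OF holomorphic_on_imp_continuous_on[OF assms(2)] r(2)]
    by (rule compact_continuous_image) auto
  then have "bounded (h ` cball s r)" by (rule compact_imp_bounded)
  then obtain K where "\<forall>y\<in>h ` cball s r. norm y \<le> K" unfolding bounded_iff by (elim exE)
  with r show "\<exists>r>0. \<exists>K. cball s r \<subseteq> S \<and> (\<forall>s'\<in>cball s r. \<forall>w\<in>space M. norm (h s') \<le> K)"
    by (intro locally_boundedI[of r _ _ _ _ K]) auto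
qed (use assms in auto)

lemma tame_family_prod [tame_intros]:
  assumes "open S" "\<And>i. i \<in> A \<Longrightarrow> tame_family S M (F i)"
  shows "tame_family S M (\<lambda>s w. \<Prod>i\<in>A. F i s w)"
  using assms(2)
proof (induction A rule: infinite_finite_induct)
  case (insert x A)
  then show ?case by (simp add: tame_family_mult)
qed (use assms(1) in \<open>auto intro!: tame_family_scalar\<close>)

lemma tame_family_power [tame_intros]:
  assumes "open S" "tame_family S M F"
  shows "tame_family S M (\<lambda>s w. F s w ^ n)"
  using tame_family_prod[OF assms(1), of "{..<n}" M "\<lambda>_. F"] assms(2) by simp

text \<open>
  For \<open>s\<close> in a compact disc and \<open>norm v = 1\<close> the points \<open>b s * v\<close> range over a compact subset of \<open>D\<close>.
\<close>

lemma tame_family_compose: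
  fixes f :: "complex \<Rightarrow> complex" and u :: "'a \<Rightarrow> complex"
  assumes S: "open S" and f: "f holomorphic_on D" and b: "b holomorphic_on S" "\<And>s v. s \<in> S \<Longrightarrow> norm v = 1 \<Longrightarrow> b s * v \<in> D"
    and u: "u \<in> borel_measurable M" "\<And>w. w \<in> space M \<Longrightarrow> norm (u w) = 1"
  shows "tame_family S M (\<lambda>s w. f (b s * u w))"
  unfolding tame_family_def
proof (intro conjI ballI)
  fix w assume "w \<in> space M"
  then have "(f \<circ> (\<lambda>s. b s * u w)) holomorphic_on S"
    using b u(2) by (intro holomorphic_on_compose_gen[OF _ f] holomorphic_intros) auto
  then show "(\<lambda>s. f (b s * u w)) holomorphic_on S" by (simp add: o_def)
next
  fix s assume s: "s \<in> S"
  have contf: "continuous_on D f" by (rule holomorphic_on_imp_continuous_on[OF f])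
  have "u \<in> M \<rightarrow>\<^sub>M restrict_space borel (sphere 0 1)"
    using u by (intro measurable_restrict_space2) auto
  moreover have "continuous_on (sphere 0 1) (\<lambda>v. f (b s * v))"
    using b(2)[OF s] by (intro continuous_on_compose2[OF contf] continuous_intros) auto
  ultimately show "(\<lambda>w. f (b s * u w)) \<in> borel_measurable M"
    using measurable_compose borel_measurable_continuous_on_restrict by blast
  obtain r where r: "r > 0" "cball s r \<subseteq> S" using s S open_contains_cball by blast
  have "continuous_on (cball s r \<times> sphere 0 1) (\<lambda>x. b (fst x))"
    using r by (intro continuous_on_compose2[OF holomorphic_on_imp_continuous_on[OF b(1)]] continuous_intros) auto
  then have "continuous_on (cball s r \<times> sphere 0 1) (\<lambda>x. f (b (fst x) * snd x))"
    using r b(2) by (intro continuous_on_compose2[OF contf] continuous_intros) auto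
  then have "compact ((\<lambda>x. f (b (fst x) * snd x)) ` (cball s r \<times> sphere 0 1))"
    by (intro compact_continuous_image compact_Times) auto
  then have "bounded ((\<lambda>x. f (b (fst x) * snd x)) ` (cball s r \<times> sphere 0 1))" by (rule compact_imp_bounded)
  then obtain K where K: "\<forall>y\<in>(\<lambda>x. f (b (fst x) * snd x)) ` (cball s r \<times> sphere 0 1). norm y \<le> K"
    unfolding bounded_iff by (elim exE)
  show "\<exists>r>0. \<exists>K. cball s r \<subseteq> S \<and> (\<forall>s'\<in>cball s r. \<forall>w\<in>space M. norm (f (b s' * u w)) \<le> K)"
  proof (rule locally_boundedI[OF r])
    fix s' w assume "s' \<in> cball s r" "w \<in> space M"
    then have "f (b s' * u w) \<in> (\<lambda>x. f (b (fst x) * snd x)) ` (cball s r \<times> sphere 0 1)"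
      using u(2) by (intro image_eqI[of _ _ "(s', u w)"]) auto
    with K show "norm (f (b s' * u w)) \<le> K" by (rule bspec)
  qed
qed

lemma tame_family_unit_circle:
  assumes "open S" "f holomorphic_on D" "sphere 0 1 \<subseteq> D"
    and "u \<in> borel_measurable M" "\<And>w. w \<in> space M \<Longrightarrow> norm (u w) = 1"
  shows "tame_family S M (\<lambda>s w. f (u w))"
  using tame_family_compose[OF assms(1,2), of "\<lambda>_. 1" u M] assms(3-5)
  by (auto simp: subset_iff)

lemma (in elliptic_bases) tame_family_Gamma:
  assumes S: "open S" and b: "b holomorphic_on S" "\<And>s. s \<in> S \<Longrightarrow> b s \<noteq> 0" "\<And>s. s \<in> S \<Longrightarrow> norm (b s) < 1"
    and u: "u \<in> borel_measurable M" "\<And>w. w \<in> space M \<Longrightarrow> norm (u w) = 1"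
  shows "tame_family S M (\<lambda>s w. \<Gamma> (b s * u w))"
proof (rule tame_family_compose[OF S _ b(1) _ u])
  show "\<Gamma> holomorphic_on {v. v \<noteq> 0 \<and> norm v < 1}" by (rule holomorphic_Gamma) auto
  show "b s * v \<in> {v. v \<noteq> 0 \<and> norm v < 1}" if "s \<in> S" "norm v = 1" for s v
    using b(2,3)[OF that(1)] that(2) by (auto simp: norm_mult)
qed

section \<open>Products over unordered pairs\<close>

text \<open>
  Ordered pairs \<open>j < k\<close> stand for unordered ones; every \<open>f\<close> that occurs is symmetric at the points in question.
\<close>

definition pair_prod :: "(nat \<Rightarrow> nat \<Rightarrow> complex) \<Rightarrow> nat set \<Rightarrow> complex" where
  "pair_prod f A = (\<Prod>j\<in>A. \<Prod>k\<in>{k\<in>A. j < k}. f j k)"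

lemma pair_prod_empty [simp]: "pair_prod f {} = 1"
  by (simp add: pair_prod_def)

lemma pair_prod_singleton [simp]: "pair_prod f {i} = 1"
  by (auto simp: pair_prod_def intro!: prod.neutral)

lemma pair_prod_cong:
  "(\<And>j k. j \<in> A \<Longrightarrow> k \<in> A \<Longrightarrow> j < k \<Longrightarrow> f j k = g j k) \<Longrightarrow> pair_prod f A = pair_prod g A"
  unfolding pair_prod_def by (intro prod.cong) auto

lemma pair_prod_insert:
  assumes A: "finite A" "i \<notin> A" and sym: "\<And>j. j \<in> A \<Longrightarrow> f j i = f i j"
  shows "pair_prod f (insert i A) = (\<Prod>k\<in>A. f i k) * pair_prod f A"
proof -
  have 1: "(\<Prod>k\<in>{k\<in>insert i A. j < k}. f j k) = (if j < i then f i j else 1) * (\<Prod>k\<in>{k\<in>A. j < k}. f j k)"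
    if "j \<in> A" for j
  proof (cases "j < i")
    case True
    then have "{k\<in>insert i A. j < k} = insert i {k\<in>A. j < k}" by auto
    with True A sym that show ?thesis by simp
  next
    case False
    then have "{k\<in>insert i A. j < k} = {k\<in>A. j < k}" by auto
    with False show ?thesis by simp
  qed
  have "{k\<in>insert i A. i < k} = {k\<in>A. i < k}" by auto
  then have "pair_prod f (insert i A) = (\<Prod>k\<in>{k\<in>A. i < k}. f i k) * (\<Prod>j\<in>A. (if j < i then f i j else 1) * (\<Prod>k\<in>{k\<in>A. j < k}. f j k))"
    unfolding pair_prod_def using A 1 by simp
  also have "\<dots> = (\<Prod>k\<in>{k\<in>A. i < k}. f i k) * (\<Prod>j\<in>A. if j < i then f i j else 1) * pair_prod f A"
    by (simp add: prod.distrib pair_prod_def)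
  also have "(\<Prod>j\<in>A. if j < i then f i j else 1) = (\<Prod>j\<in>{j\<in>A. j < i}. f i j)"
    using A by (simp add: prod.inter_filter)
  also have "(\<Prod>k\<in>{k\<in>A. i < k}. f i k) * (\<Prod>j\<in>{j\<in>A. j < i}. f i j) = (\<Prod>k\<in>A. f i k)"
  proof -
    have "A = {k\<in>A. i < k} \<union> {j\<in>A. j < i}"
    proof (rule set_eqI)
      fix k show "k \<in> A \<longleftrightarrow> k \<in> {k\<in>A. i < k} \<union> {j\<in>A. j < i}"
        using A(2) by (cases "k < i"; cases "k = i") auto
    qed
    then have "(\<Prod>k\<in>A. f i k) = (\<Prod>k\<in>{k\<in>A. i < k} \<union> {j\<in>A. j < i}. f i k)" by (rule arg_cong)
    also have "\<dots> = (\<Prod>k\<in>{k\<in>A. i < k}. f i k) * (\<Prod>j\<in>{j\<in>A. j < i}. f i j)"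
      using A by (intro prod.union_disjoint) auto
    finally show ?thesis ..
  qed
  finally show ?thesis .
qed

lemma pair_prod_remove:
  assumes "finite A" "i \<in> A" "\<And>j. j \<in> A \<Longrightarrow> f j i = f i j"
  shows "pair_prod f A = (\<Prod>k\<in>A - {i}. f i k) * pair_prod f (A - {i})"
  using pair_prod_insert[of "A - {i}" i f] assms by (simp add: insert_absorb)

lemma pair_prod_mult: "pair_prod (\<lambda>j k. f j k * g j k) A = pair_prod f A * pair_prod g A"
  by (simp add: pair_prod_def prod.distrib)

lemma pair_prod_zero:
  assumes "finite A" "j \<in> A" "k \<in> A" "j < k" "f j k = 0"
  shows "pair_prod f A = 0"
  unfolding pair_prod_def using assms by (auto simp: prod_zero_iff)

lemma pair_prod_nonzero: 
  "finite A \<Longrightarrow> (\<And>j k. j \<in> A \<Longrightarrow> k \<in> A \<Longrightarrow> j < k \<Longrightarrow> f j k \<noteq> 0) \<Longrightarrow> pair_prod f A \<noteq> 0"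
  by (auto simp: pair_prod_def)

lemma tame_family_pair_prod [tame_intros]:
  assumes "open S" "\<And>j k. j \<in> A \<Longrightarrow> k \<in> A \<Longrightarrow> j < k \<Longrightarrow> tame_family S M (F j k)"
  shows "tame_family S M (\<lambda>s w. pair_prod (\<lambda>j k. F j k s w) A)"
  unfolding pair_prod_def using assms by (intro tame_intros) auto

lemma holomorphic_on_pair_prod:
  assumes "\<And>j k. j \<in> A \<Longrightarrow> k \<in> A \<Longrightarrow> j < k \<Longrightarrow> f j k holomorphic_on S"
  shows "(\<lambda>s. pair_prod (\<lambda>j k. f j k s) A) holomorphic_on S"
  unfolding pair_prod_def using assms by (intro holomorphic_intros) auto

lemma finite_norm_bound:
  assumes "finite B" "\<And>m. m \<in> B \<Longrightarrow> norm (b m :: complex) < 1"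
  obtains \<rho> where "0 < \<rho>" "\<rho> < 1" "\<And>m. m \<in> B \<Longrightarrow> norm (b m) \<le> \<rho>"
proof -
  have "\<exists>\<rho>>0. \<rho> < 1 \<and> (\<forall>m\<in>B. norm (b m) \<le> \<rho>)"
    using assms
  proof (induction B rule: finite_induct)
    case empty
    then show ?case by (intro exI[of _ "1/2"]) auto
  next
    case (insert x B)
    then obtain \<rho> where "\<rho> > 0" "\<rho> < 1" "\<forall>m\<in>B. norm (b m) \<le> \<rho>" by auto
    then show ?case using insert.prems by (intro exI[of _ "max \<rho> (norm (b x))"]) auto
  qed
  then show ?thesis using that by blast
qed

section \<open>Integrals of type I\<close>

context elliptic_bases
begin

definition params :: "nat set \<Rightarrow> (nat \<Rightarrow> complex) \<Rightarrow> complex \<Rightarrow> complex" where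
  "params B b y = (\<Prod>m\<in>B. \<Gamma> (b m * y) * \<Gamma> (b m / y))"

definition typeI_weight :: "nat set \<Rightarrow> nat set \<Rightarrow> (nat \<Rightarrow> complex) \<Rightarrow> (nat \<Rightarrow> complex) \<Rightarrow> complex" where
  "typeI_weight I B b z = (\<Prod>i\<in>I. params B b (z i) * \<omega> (z i)) * pair_prod (\<lambda>j k. \<kappa> (z j) (z k)) I"

definition typeI_integral :: "nat set \<Rightarrow> nat set \<Rightarrow> (nat \<Rightarrow> complex) \<Rightarrow> complex" where
  "typeI_integral I B b = (\<integral>z. typeI_weight I B b z \<partial>torus I)"

definition typeI_value :: "nat set \<Rightarrow> (nat \<Rightarrow> complex) \<Rightarrow> complex" where
  "typeI_value B b = pair_prod (\<lambda>m k. \<Gamma> (b m * b k)) B"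

lemma tame_family_theta [tame_intros]:
  assumes "open S" "norm r < 1" "u \<in> borel_measurable M" "\<And>w. w \<in> space M \<Longrightarrow> norm (u w) = 1"
  shows "tame_family S M (\<lambda>s w. theta r (u w))"
  by (rule tame_family_unit_circle[of S "theta r" "- {0}"]) (use assms in \<open>auto intro!: holomorphic_intros\<close>)

lemma tame_family_unit:
  assumes "open S" "u \<in> borel_measurable M" "\<And>w. w \<in> space M \<Longrightarrow> norm (u w :: complex) = 1"
  shows "tame_family S M (\<lambda>s w. u w)"
  using tame_family_unit_circle[OF assms(1) holomorphic_on_ident _ assms(2,3)] by auto

lemma tame_family_theta_pm:
  assumes "open S" "norm r < 1"
    and u: "u \<in> borel_measurable M" "\<And>w. w \<in> space M \<Longrightarrow> norm (u w) = 1"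
    and v: "v \<in> borel_measurable M" "\<And>w. w \<in> space M \<Longrightarrow> norm (v w) = 1"
  shows "tame_family S M (\<lambda>s w. theta_pm r (u w) (v w))"
proof -
  note [measurable] = u(1) v(1)
  have "tame_family S M (\<lambda>s w. theta r (u w * v w) * theta r (u w / v w) * (1 / u w))"
    using assms by (intro tame_intros tame_family_unit borel_measurable_times borel_measurable_divide) (auto simp: norm_mult norm_divide)
  then show ?thesis by (simp add: theta_pm_def)
qed

lemma tame_family_\<kappa> [tame_intros]:
  assumes "open S"
    and u: "u \<in> borel_measurable M" "\<And>w. w \<in> space M \<Longrightarrow> norm (u w) = 1"
    and v: "v \<in> borel_measurable M" "\<And>w. w \<in> space M \<Longrightarrow> norm (v w) = 1"
  shows "tame_family S M (\<lambda>s w. \<kappa> (u w) (v w))"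
  unfolding \<kappa>_def using assms norm_p norm_q by (intro tame_intros tame_family_theta_pm) auto

lemma tame_family_\<omega> [tame_intros]:
  assumes "open S" and u: "u \<in> borel_measurable M" "\<And>w. w \<in> space M \<Longrightarrow> norm (u w) = 1"
  shows "tame_family S M (\<lambda>s w. \<omega> (u w))"
  unfolding \<omega>_def using assms norm_p norm_q
  by (intro tame_intros borel_measurable_power borel_measurable_divide) (auto simp: norm_power norm_divide)

lemma tame_family_params:
  assumes S: "open S" and b: "\<And>m. m \<in> B \<Longrightarrow> (\<lambda>s. b s m) holomorphic_on S"
    "\<And>s m. s \<in> S \<Longrightarrow> m \<in> B \<Longrightarrow> b s m \<noteq> 0" "\<And>s m. s \<in> S \<Longrightarrow> m \<in> B \<Longrightarrow> norm (b s m) < 1"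
    and u: "u \<in> borel_measurable M" "\<And>w. w \<in> space M \<Longrightarrow> norm (u w) = 1"
  shows "tame_family S M (\<lambda>s w. params B (b s) (u w))"
proof -
  have "tame_family S M (\<lambda>s w. \<Prod>m\<in>B. \<Gamma> (b s m * u w) * \<Gamma> (b s m * (1 / u w)))"
    using assms by (intro tame_intros tame_family_Gamma borel_measurable_divide) (auto simp: norm_divide)
  then show ?thesis by (simp add: params_def)
qed

lemma tame_family_typeI_weight:
  assumes S: "open S" and b: "\<And>m. m \<in> B \<Longrightarrow> (\<lambda>s. b s m) holomorphic_on S"
    "\<And>s m. s \<in> S \<Longrightarrow> m \<in> B \<Longrightarrow> b s m \<noteq> 0" "\<And>s m. s \<in> S \<Longrightarrow> m \<in> B \<Longrightarrow> norm (b s m) < 1"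
  shows "tame_family S (torus I) (\<lambda>s. typeI_weight I B (b s))"
  unfolding typeI_weight_def
  using assms by (intro tame_intros tame_family_params torus_component) (auto intro: norm_torus)

lemma theta_square_nonzero:
  assumes d: "norm p < norm d ^ 2" "norm d < 1"
  shows "theta p (d\<^sup>2) \<noteq> 0"
proof (rule theta_nonzero[OF norm_p])
  have "norm (d\<^sup>2) < 1" using d(2) by (simp add: norm_power power_less_one_iff abs_square_less_1)
  then show "d\<^sup>2 \<noteq> 1" by auto
  show "norm (p * d\<^sup>2) < 1"
    using \<open>norm (d\<^sup>2) < 1\<close> norm_p by (metis norm_mult mult_strict_mono' norm_ge_zero mult_1)
qed (use d in \<open>simp add: norm_power\<close>)

lemma theta_unit_square_nonzero:
  assumes "norm x = 1" "x\<^sup>2 \<noteq> 1"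
  shows "theta p (x\<^sup>2) \<noteq> 0"
  using assms norm_p by (intro theta_nonzero) (auto simp: norm_power norm_mult)

lemma theta_pm_unit_nonzero:
  assumes d: "norm p < norm d ^ 2" "norm d < 1" and x: "norm x = 1"
  shows "theta_pm p d x \<noteq> 0" "theta_pm p x d \<noteq> 0"
proof -
  have d0: "d \<noteq> 0" using d(1) p_nz by (metis norm_zero norm_ge_zero not_less power_zero_numeral zero_less_norm_iff less_trans less_irrefl)
  have x0: "x \<noteq> 0" using x by auto
  have nd: "norm p < norm d"
  proof -
    have "norm d * norm d \<le> norm d" using d(2) by (simp add: mult_left_le_one_le)
    then show ?thesis using d(1) by (simp add: power2_eq_square)
  qed
  have th1: "theta p u \<noteq> 0" if "norm u = norm d \<or> norm u = 1 / norm d" for u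
  proof (rule theta_nonzero[OF norm_p])
    have "1 / norm d > 1" using d(2) d0 by simp
    then show "u \<noteq> 1" using that d(2) by auto
    show "norm p < norm u" using that nd \<open>1 / norm d > 1\<close> norm_p by auto
    have "norm p * norm d < 1" using norm_p d(2) by (metis mult_strict_mono' norm_ge_zero mult_1)
    moreover have "norm p * (1 / norm d) < 1" using nd d0 by simp
    ultimately show "norm (p * u) < 1" using that by (auto simp: norm_mult)
  qed
  show "theta_pm p d x \<noteq> 0"
    unfolding theta_pm_def using th1[of "d * x"] th1[of "d / x"] x d0
    by (simp add: norm_mult norm_divide)
  then show "theta_pm p x d \<noteq> 0"
    using theta_pm_swap[OF norm_p d0 x0] by simp
qed

lemma theta_pm_units_nonzero:
  assumes "norm x = 1" "norm y = 1" "x \<noteq> y" "x * y \<noteq> 1"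
  shows "theta_pm p x y \<noteq> 0"
proof -
  have nz: "x \<noteq> 0" "y \<noteq> 0" using assms by auto
  have "theta p (x / y) \<noteq> 0"
    using assms nz norm_p by (intro theta_nonzero) (simp_all add: norm_mult norm_divide)
  moreover have "theta p (x * y) \<noteq> 0"
    using assms norm_p by (intro theta_nonzero) (simp_all add: norm_mult)
  ultimately show ?thesis using nz by (simp add: theta_pm_def)
qed

text \<open>
  The numerator of \<open>h(z) = T(z) + T(1/z)\<close>, \<open>T(z) = \<Prod>\<^sub>m \<theta>(b\<^sub>m z; p) / (z\<^sup>n \<theta>(z\<^sup>2; p))\<close>, over the
  denominator \<open>\<theta>(z\<^sup>2; p)\<close>.
\<close>

definition sym_numerator :: "nat \<Rightarrow> nat set \<Rightarrow> (nat \<Rightarrow> complex) \<Rightarrow> complex \<Rightarrow> complex" where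
  "sym_numerator n B b z = (\<Prod>m\<in>B. theta p (b m * z)) / z ^ n - z ^ (n + 2) * (\<Prod>m\<in>B. theta p (b m / z))"

context
  fixes n :: nat and B :: "nat set" and b :: "nat \<Rightarrow> complex"
  assumes B: "finite B" "card B = 2 * n + 4"
    and b: "\<And>m. m \<in> B \<Longrightarrow> b m \<noteq> 0" "\<And>m. m \<in> B \<Longrightarrow> norm (b m) < 1"
    and bal: "(\<Prod>m\<in>B. b m) = p"
begin

lemma sym_numerator_inverse: "z \<noteq> 0 \<Longrightarrow> sym_numerator n B b (1 / z) = - sym_numerator n B b z / z\<^sup>2"
  by (simp add: sym_numerator_def field_simps power2_eq_square power_add)

lemma sym_numerator_shift:
  assumes z: "z \<noteq> 0"
  shows "sym_numerator n B b (p * z) = sym_numerator n B b z / ((p * z\<^sup>2) ^ n * (p * z ^ 4))"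
proof -
  have ev: "(-1) ^ (2 * n + 4) = (1::complex)" by simp
  have 1: "(\<Prod>m\<in>B. theta p (b m * (p * z))) = (\<Prod>m\<in>B. theta p (b m * z)) / (p * z ^ (2 * n + 4))"
  proof -
    have "(\<Prod>m\<in>B. theta p (b m * (p * z))) = (\<Prod>m\<in>B. theta p (b m * z) * (-1) / (b m * z))"
      using theta_shift[OF norm_p p_nz] b(1) z by (intro prod.cong refl) (simp add: mult.left_commute)
    also have "\<dots> = (\<Prod>m\<in>B. theta p (b m * z)) * (\<Prod>m\<in>B. -1) / ((\<Prod>m\<in>B. b m) * (\<Prod>m\<in>B. z))"
      by (simp only: prod.distrib prod_dividef)
    also have "\<dots> = (\<Prod>m\<in>B. theta p (b m * z)) * (-1) ^ card B / (p * z ^ card B)"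
      by (simp only: bal prod_constant)
    finally show ?thesis unfolding B(2) ev by simp
  qed
  have 2: "(\<Prod>m\<in>B. theta p (b m / (p * z))) = (\<Prod>m\<in>B. theta p (b m / z)) * p / (p * z) ^ (2 * n + 4)"
  proof -
    have "(\<Prod>m\<in>B. theta p (b m / (p * z))) = (\<Prod>m\<in>B. theta p (b m / z) * (-1) * b m / (p * z))"
      using theta_shift[OF norm_p p_nz, of "b m / (p * z)" for m] b(1) z p_nz
      by (intro prod.cong refl) (simp add: divide_simps)
    also have "\<dots> = (\<Prod>m\<in>B. theta p (b m / z)) * (\<Prod>m\<in>B. -1) * (\<Prod>m\<in>B. b m) / (\<Prod>m\<in>B. p * z)"
      by (simp only: prod.distrib prod_dividef)
    also have "\<dots> = (\<Prod>m\<in>B. theta p (b m / z)) * (-1) ^ card B * p / (p * z) ^ card B"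
      by (simp only: bal prod_constant)
    finally show ?thesis unfolding B(2) ev by simp
  qed
  show ?thesis
    unfolding sym_numerator_def 1 2 using z p_nz
    by (simp add: diff_divide_distrib power_add power_mult_distrib power_mult power2_eq_square power4_eq_xxxx mult_ac)
qed

lemma holomorphic_sym_numerator: "sym_numerator n B b holomorphic_on - {0}"
  unfolding sym_numerator_def using b norm_p by (intro holomorphic_intros) auto

lemma sym_numerator_at_param:
  assumes "c \<in> B"
  shows "sym_numerator n B b (b c) = theta p ((b c)\<^sup>2) * (\<Prod>m\<in>B - {c}. theta p (b m * b c)) / b c ^ n"
proof -
  have "(\<Prod>m\<in>B. theta p (b m / b c)) = 0"
    using B assms b norm_p by (auto intro!: bexI[of _ c])
  then show ?thesis
    using B assms by (simp add: sym_numerator_def prod.remove[of B c] power2_eq_square)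
qed

text \<open>
  Lagrange interpolation at the \<open>n + 1\<close> nodes \<open>d\<close> and \<open>x\<^sub>i\<close>, in the \<open>n + 1\<close>-dimensional space of functions
  \<open>h\<close> with \<open>h (1 / z) = h z\<close> and \<open>h (p * z) = h z / (p * z\<^sup>2) ^ n\<close>. The difference of both sides vanishes at all nodes.
\<close>

lemma theta_interpolation:
  fixes x :: "nat \<Rightarrow> complex"
  assumes I: "finite I" "card I = n"
    and x: "\<And>i. i \<in> I \<Longrightarrow> norm (x i) = 1" "\<And>i. i \<in> I \<Longrightarrow> (x i)\<^sup>2 \<noteq> 1" "inj_on x I"
      "\<And>i j. i \<in> I \<Longrightarrow> j \<in> I \<Longrightarrow> i \<noteq> j \<Longrightarrow> x i * x j \<noteq> 1"
    and d: "norm p < norm d ^ 2" "norm d < 1"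
    and z: "z \<noteq> 0"
  shows "sym_numerator n B b z = theta p (z\<^sup>2) *
    (sym_numerator n B b d / theta p (d\<^sup>2) * (\<Prod>j\<in>I. theta_pm p z (x j) / theta_pm p d (x j)) +
     (\<Sum>i\<in>I. sym_numerator n B b (x i) / theta p ((x i)\<^sup>2) * (theta_pm p z d / theta_pm p (x i) d) *
        (\<Prod>j\<in>I - {i}. theta_pm p z (x j) / theta_pm p (x i) (x j))))"
proof -
  define N where "N = sym_numerator n B b"
  define H0 where "H0 z = (\<Prod>j\<in>I. theta_pm p z (x j) / theta_pm p d (x j))" for z
  define H where "H i z = (theta_pm p z d / theta_pm p (x i) d) *
        (\<Prod>j\<in>I - {i}. theta_pm p z (x j) / theta_pm p (x i) (x j))" for i z
  define f where "f z = N z - theta p (z\<^sup>2) * (N d / theta p (d\<^sup>2) * H0 z + (\<Sum>i\<in>I. N (x i) / theta p ((x i)\<^sup>2) * H i z))" for z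
  have d0: "d \<noteq> 0" using d(1) p_nz by (metis norm_zero norm_ge_zero not_less power_zero_numeral zero_less_norm_iff less_trans less_irrefl)
  have x0: "x i \<noteq> 0" if "i \<in> I" for i using x(1)[OF that] by auto
  have thd: "theta p (d\<^sup>2) \<noteq> 0" by (rule theta_square_nonzero[OF d])
  have thx: "theta p ((x i)\<^sup>2) \<noteq> 0" if "i \<in> I" for i
    using x(1,2)[OF that] by (rule theta_unit_square_nonzero)
  have pmd: "theta_pm p d (x i) \<noteq> 0" "theta_pm p (x i) d \<noteq> 0" if "i \<in> I" for i
    using theta_pm_unit_nonzero[OF d x(1)[OF that]] by auto
  have pmx: "theta_pm p (x i) (x j) \<noteq> 0" if "i \<in> I" "j \<in> I" "i \<noteq> j" for i j
    using x(1) x(3) x(4)[OF that] that by (intro theta_pm_units_nonzero) (auto dest: inj_onD)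
  have "f z = 0"
  proof (rule theta_function_unique[OF p_nz norm_p _ _ _ I x(1-4), of f d])
    show "f holomorphic_on - {0}"
      unfolding f_def N_def H0_def H_def using d0 x0 norm_p thd thx pmd pmx
      by (intro holomorphic_intros holomorphic_sym_numerator) auto
    fix z :: complex assume z: "z \<noteq> 0"
    have th: "theta p ((1 / z)\<^sup>2) = - theta p (z\<^sup>2) / z\<^sup>2" "theta p ((p * z)\<^sup>2) = theta p (z\<^sup>2) / (p * z ^ 4)"
    proof -
      show "theta p ((1 / z)\<^sup>2) = - theta p (z\<^sup>2) / z\<^sup>2"
        using theta_inverse[OF norm_p, of "z\<^sup>2"] z by (simp add: power_divide)
      have "theta p ((p * z)\<^sup>2) = theta p (p * (p * z\<^sup>2))" by (simp add: power_mult_distrib power2_eq_square mult_ac)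
      also have "\<dots> = theta p (z\<^sup>2) / (p * z ^ 4)"
        using z p_nz norm_p by (simp add: theta_shift power2_eq_square power4_eq_xxxx)
      finally show "theta p ((p * z)\<^sup>2) = theta p (z\<^sup>2) / (p * z ^ 4)" .
    qed
    have H0: "H0 (1 / z) = H0 z" "H0 (p * z) = H0 z / (p * z\<^sup>2) ^ n"
    proof -
      show "H0 (1 / z) = H0 z" unfolding H0_def using z x0 norm_p by (simp add: theta_pm_inverse)
      have "H0 (p * z) = (\<Prod>j\<in>I. theta_pm p z (x j) / theta_pm p d (x j) / (p * z\<^sup>2))"
        unfolding H0_def using z x0 norm_p p_nz by (intro prod.cong refl) (simp add: theta_pm_shift)
      then show "H0 (p * z) = H0 z / (p * z\<^sup>2) ^ n"
        unfolding H0_def by (subst (asm) prod_dividef) (simp add: I)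
    qed
    have H: "H i (1 / z) = H i z" "H i (p * z) = H i z / (p * z\<^sup>2) ^ n" if i: "i \<in> I" for i
    proof -
      show "H i (1 / z) = H i z" unfolding H_def using z x0 d0 norm_p by (simp add: theta_pm_inverse)
      have c: "n = Suc (card (I - {i}))" using I i by (metis card_Suc_Diff1)
      have "H i (p * z) = (theta_pm p z d / theta_pm p (x i) d / (p * z\<^sup>2)) *
         (\<Prod>j\<in>I - {i}. theta_pm p z (x j) / theta_pm p (x i) (x j) / (p * z\<^sup>2))"
        unfolding H_def using z x0 d0 norm_p p_nz by (intro arg_cong2[of _ _ _ _ "(*)"] prod.cong refl) (simp_all add: theta_pm_shift)
      then show "H i (p * z) = H i z / (p * z\<^sup>2) ^ n"
        unfolding H_def by (subst (asm) prod_dividef) (simp add: c)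
    qed
    have S1: "(\<Sum>i\<in>I. N (x i) / theta p ((x i)\<^sup>2) * H i (1 / z)) = (\<Sum>i\<in>I. N (x i) / theta p ((x i)\<^sup>2) * H i z)"
      using H(1) by (intro sum.cong) auto
    have S2: "(\<Sum>i\<in>I. N (x i) / theta p ((x i)\<^sup>2) * H i (p * z)) = (\<Sum>i\<in>I. N (x i) / theta p ((x i)\<^sup>2) * H i z) / (p * z\<^sup>2) ^ n"
      unfolding sum_divide_distrib using H(2) by (intro sum.cong) auto
    have N: "N (1 / z) = - N z / z\<^sup>2" "N (p * z) = N z / ((p * z\<^sup>2) ^ n * (p * z ^ 4))"
      unfolding N_def by (rule sym_numerator_inverse[OF z], rule sym_numerator_shift[OF z])
    show "f (1 / z) = - f z / z\<^sup>2"
      unfolding f_def S1 th(1) H0(1) N(1) by (simp add: diff_divide_distrib)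
    have alg: "A / (D * E) - t / E * (X * (Y / D) + Z / D) = (A - t * (X * Y + Z)) / (D * E)" for A D E t X Y Z :: complex
      by (simp add: diff_divide_distrib add_divide_distrib distrib_left mult.commute)
    show "f (p * z) = f z / ((p * z\<^sup>2) ^ n * (p * z ^ 4))"
      unfolding f_def S2 th(2) H0(2) N(2) by (rule alg)
  next
    fix i assume i: "i \<in> I"
    have "H0 (x i) = 0" unfolding H0_def using I i x0[OF i] norm_p by (auto intro!: bexI[of _ i])
    moreover have "H j (x i) = 0" if "j \<in> I" "j \<noteq> i" for j
      unfolding H_def using I i that x0[OF i] norm_p by (auto intro!: bexI[of _ i])
    moreover have "H i (x i) = 1"
      unfolding H_def using pmd(2)[OF i] pmx[OF i] by simp
    ultimately have "(\<Sum>j\<in>I. N (x j) / theta p ((x j)\<^sup>2) * H j (x i)) = N (x i) / theta p ((x i)\<^sup>2)"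
      using I i by (subst sum.remove[of I i]) auto
    then show "f (x i) = 0" using \<open>H0 (x i) = 0\<close> thx[OF i] by (simp add: f_def)
  next
    have "H0 d = 1" unfolding H0_def using pmd(1) by simp
    moreover have "H i d = 0" for i unfolding H_def using d0 norm_p by simp
    ultimately show "f d = 0" using thd by (simp add: f_def)
  qed (use d z in auto)
  then show ?thesis unfolding f_def N_def H0_def H_def by (simp only: right_minus_eq mult.assoc)
qed

text \<open>
  The integrand is \<open>\<phi> y + \<phi> (1 / y)\<close> for a function \<open>\<phi>\<close> with \<open>\<phi> (1 / (q * y)) = - \<phi> y\<close>. The circle of
  radius \<open>1 / sqrt (norm q)\<close> is invariant under \<open>y \<mapsto> 1 / (q * y)\<close>, so the integral of \<open>\<phi>\<close> over it is 0, and
  there are no poles between this circle and the unit circle.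
\<close>

lemma integral_sym_numerator_eq_0:
  assumes g: "g holomorphic_on - {0}" "\<And>y. y \<noteq> 0 \<Longrightarrow> g (1 / y) = g y"
    "\<And>y. y \<noteq> 0 \<Longrightarrow> g (q * y) = g y / (q * y\<^sup>2) ^ (n - 1)" and n: "n \<ge> 1"
  shows "(\<integral>y. params B b y * sym_numerator n B b y * theta q (1 / y\<^sup>2) * g y \<partial>circ) = 0"
proof -
  define \<phi> where "\<phi> y = (\<Prod>m\<in>B. \<Gamma> (q * b m * y) * \<Gamma> (b m / y)) * theta q (1 / y\<^sup>2) * g y / y ^ n" for y
  obtain \<rho> where \<rho>: "0 < \<rho>" "\<rho> < 1" "\<And>m. m \<in> B \<Longrightarrow> norm (b m) \<le> \<rho>"
    using finite_norm_bound[of B b] B b by metis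
  define S where "S = {y::complex. \<rho> < norm y \<and> norm y < 1 / (norm q * \<rho>)}"
  have S0: "y \<noteq> 0" if "y \<in> S" for y using that \<rho> by (auto simp: S_def)
  have openS: "open S" unfolding S_def by (intro open_Collect_conj open_Collect_less continuous_intros)
  have connS: "connected S" unfolding S_def using connected_annulus(1)[of \<rho> "0::complex"] by simp
  have hol: "\<phi> holomorphic_on S"
  proof -
    have "norm (q * b m * y) < 1" "norm (b m / y) < 1" if "m \<in> B" "y \<in> S" for m y
    proof -
      have "norm y * (norm q * \<rho>) < 1" using that(2) \<rho> q_nz by (auto simp: S_def pos_less_divide_eq)
      moreover have "norm q * norm (b m) * norm y \<le> norm q * \<rho> * norm y"
        using \<rho>(3)[OF that(1)] by (intro mult_right_mono mult_left_mono) auto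
      ultimately show "norm (q * b m * y) < 1" by (simp add: norm_mult mult.commute)
      show "norm (b m / y) < 1" using that(2) \<rho>(1) \<rho>(3)[OF that(1)] by (auto simp: S_def norm_divide divide_less_eq)
    qed
    then show ?thesis
      unfolding \<phi>_def using S0 S0[of 0] b q_nz norm_q
      by (intro holomorphic_intros holomorphic_Gamma holomorphic_on_subset[OF g(1)]) auto
  qed
  have anti: "\<phi> (1 / (q * y)) = - \<phi> y" if y: "y \<noteq> 0" for y
  proof -
    have "(\<Prod>m\<in>B. \<Gamma> (q * b m * (1 / (q * y))) * \<Gamma> (b m / (1 / (q * y)))) = (\<Prod>m\<in>B. \<Gamma> (q * b m * y) * \<Gamma> (b m / y))"
      using q_nz y by (intro prod.cong refl) (simp add: field_simps)
    note f1 = this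
    have f2: "theta q (1 / (1 / (q * y))\<^sup>2) = - theta q (1 / y\<^sup>2) / (q * y\<^sup>2)"
    proof -
      have "theta q (1 / (1 / (q * y))\<^sup>2) = theta q (1 / (1 / (q * (q * y\<^sup>2))))" by (simp add: power2_eq_square mult_ac)
      also have "\<dots> = theta q (1 / y\<^sup>2) * (-1) / (q * y\<^sup>2)"
        using theta_inverse[OF norm_q, of "y\<^sup>2"] theta_shift[OF norm_q q_nz, of "q * y\<^sup>2"] theta_shift[OF norm_q q_nz, of "y\<^sup>2"] y q_nz by simp
      finally show ?thesis by simp
    qed
    have f3: "g (1 / (q * y)) = g y / (q * y\<^sup>2) ^ (n - 1)" using g y q_nz by simp
    have "(q * y\<^sup>2) ^ n = (q * y\<^sup>2) * (q * y\<^sup>2) ^ (n - 1)" using n by (metis Suc_diff_1 less_eq_Suc_le power_Suc One_nat_def)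
    then have f4: "(1 / (q * y)) ^ n = y ^ n / ((q * y\<^sup>2) * (q * y\<^sup>2) ^ (n - 1))"
      using y q_nz by (simp add: power_divide power_mult_distrib field_simps flip: power_mult power_add mult_2)
    have "(q * y\<^sup>2) ^ (n - 1) \<noteq> 0" "q * y\<^sup>2 \<noteq> 0" using y q_nz by auto
    then show ?thesis unfolding \<phi>_def f1 f2 f3 f4 by simp
  qed
  have one: "1 \<in> S"
  proof -
    have "norm q * \<rho> < 1" using \<rho> norm_q by (metis mult_strict_mono' norm_ge_zero mult_1 less_imp_le)
    then show ?thesis using \<rho> q_nz by (simp add: S_def)
  qed
  \<comment> \<open>a fixed point of \<open>y \<mapsto> 1 / (q * y)\<close>\<close>
  define c where "c = 1 / csqrt q"
  have c: "q * c\<^sup>2 = 1" "c \<noteq> 0" unfolding c_def using q_nz by (auto simp: power_divide)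
  have cS: "c \<in> S"
  proof -
    have nc: "norm c ^ 2 * norm q = 1" using c(1) by (metis mult.commute norm_mult norm_one norm_power)
    have "norm c > 1"
    proof (rule ccontr)
      assume "\<not> norm c > 1"
      then have "norm c ^ 2 \<le> 1" by (intro power_le_one) auto
      then have "norm c ^ 2 * norm q \<le> norm q" by (simp add: mult_left_le_one_le)
      with nc norm_q show False by simp
    qed
    moreover have "norm c * (norm q * \<rho>) < 1"
    proof -
      have "norm c * (norm q * \<rho>) * 1 \<le> norm c * (norm q * \<rho>) * norm c" using \<open>norm c > 1\<close> \<rho> by (intro mult_left_mono) auto
      also have "\<dots> = \<rho>" using nc by (simp add: power2_eq_square mult_ac)
      finally show ?thesis using \<rho>(2) by linarith
    qed
    ultimately show ?thesis using \<rho> q_nz by (simp add: S_def pos_less_divide_eq)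
  qed
  have rot: "c * z \<in> S" if "c \<in> S" "norm z = 1" for c z using that by (auto simp: S_def norm_mult)
  have meas: "(\<lambda>y. \<phi> (c * y)) \<in> borel_measurable circ" if "c \<in> S" for c
  proof -
    have "continuous_on (sphere 0 1) (\<lambda>y. \<phi> (c * y))"
      by (rule continuous_on_compose2[OF holomorphic_on_imp_continuous_on[OF hol]]) (use rot that in \<open>auto intro!: continuous_intros\<close>)
    then show ?thesis
      by (subst measurable_cong_sets[OF sets_circ refl]) (rule borel_measurable_continuous_on_restrict)
  qed
  have "(\<integral>y. \<phi> (c * y) \<partial>circ) = (\<integral>y. \<phi> (c * (1 / y)) \<partial>circ)"
    by (rule integral_circ_inverse[OF meas[OF cS], symmetric])
  also have "\<dots> = (\<integral>y. - \<phi> (c * y) \<partial>circ)"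
  proof (intro Bochner_Integration.integral_cong refl)
    fix y assume "y \<in> space circ"
    then have "y \<noteq> 0" by auto
    then have "c * (1 / y) * (q * (c * y)) = 1" using c by (simp add: power2_eq_square mult_ac)
    then have "c * (1 / y) = 1 / (q * (c * y))" using c \<open>y \<noteq> 0\<close> q_nz by (simp only: eq_divide_eq) simp
    then show "\<phi> (c * (1 / y)) = - \<phi> (c * y)" using anti[of "c * y"] c \<open>y \<noteq> 0\<close> by simp
  qed
  finally have "(\<integral>y. \<phi> (c * y) \<partial>circ) = 0" by (simp add: equation_minus_iff)
  then have int0: "(\<integral>y. \<phi> y \<partial>circ) = 0"
    using integral_circ_scale[OF openS connS hol rot cS one] by simp
  have "(\<integral>y. params B b y * sym_numerator n B b y * theta q (1 / y\<^sup>2) * g y \<partial>circ) = (\<integral>y. \<phi> y + \<phi> (1 / y) \<partial>circ)"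
  proof (intro Bochner_Integration.integral_cong refl)
    fix y assume "y \<in> space circ"
    then have y: "y \<noteq> 0" "norm y = 1" by auto
    have sh: "\<Gamma> (q * b m * v) = theta p (b m * v) * \<Gamma> (b m * v)" if "m \<in> B" "norm v = 1" for m v
      using Gamma_mult_q[of "b m * v"] b that by (force simp: norm_mult mult.assoc)
    have 1: "(\<Prod>m\<in>B. \<Gamma> (q * b m * y) * \<Gamma> (b m / y)) = (\<Prod>m\<in>B. theta p (b m * y)) * params B b y"
      using sh y by (simp add: params_def prod.distrib)
    have 2: "(\<Prod>m\<in>B. \<Gamma> (q * b m * (1 / y)) * \<Gamma> (b m / (1 / y))) = (\<Prod>m\<in>B. theta p (b m / y)) * params B b y"
      using sh[of _ "1 / y"] y by (simp add: params_def prod.distrib norm_divide)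
    have 3: "theta q (1 / (1 / y)\<^sup>2) = - theta q (1 / y\<^sup>2) * y\<^sup>2"
      using theta_inverse[OF norm_q, of "1 / y\<^sup>2"] y by (simp add: power_divide)
    show "params B b y * sym_numerator n B b y * theta q (1 / y\<^sup>2) * g y = \<phi> y + \<phi> (1 / y)"
      unfolding \<phi>_def 1 2 3 sym_numerator_def g(2)[OF y(1)] using y(1)
      by (simp add: field_simps power2_eq_square power_add)
  qed
  also have "\<dots> = (\<integral>y. \<phi> y \<partial>circ) + (\<integral>y. \<phi> (1 / y) \<partial>circ)"
  proof (rule Bochner_Integration.integral_add)
    have "sphere 0 1 \<subseteq> S" using rot[OF one] by auto
    then have "tame circ (\<lambda>y. \<phi> y)" "tame circ (\<lambda>y. \<phi> (1 / y))"
      by (auto intro!: tame_family_unit_circle[OF _ hol] borel_measurable_divide simp: norm_divide)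
    then show "integrable circ \<phi>" "integrable circ (\<lambda>y. \<phi> (1 / y))"
      by (auto intro!: tame_integrable circ.finite_measure_axioms)
  qed
  also have "\<dots> = 0"
    using integral_circ_inverse[OF meas[OF one]] int0 by simp
  finally show ?thesis .
qed

end

section \<open>A difference equation in the parameters\<close>

lemma params_shift:
  assumes B: "finite B" "d \<in> B" and b: "b d \<noteq> 0" "norm (b d) < 1" and y: "norm y = 1"
  shows "params B (b(d := q * b d)) y = b d * theta_pm p (b d) y * params B b y"
proof -
  have y0: "y \<noteq> 0" using y by auto
  have "\<Gamma> (q * (b d * y)) = theta p (b d * y) * \<Gamma> (b d * y)" "\<Gamma> (q * (b d / y)) = theta p (b d / y) * \<Gamma> (b d / y)"
    using b y y0 by (intro Gamma_mult_q; simp add: norm_mult norm_divide)+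
  then have *: "\<Gamma> (q * b d * y) * \<Gamma> (q * b d / y) = b d * theta_pm p (b d) y * (\<Gamma> (b d * y) * \<Gamma> (b d / y))"
    using theta_mult_theta[OF y0 b(1), of p] by (simp add: mult_ac)
  have "params B (b(d := q * b d)) y = \<Gamma> (q * b d * y) * \<Gamma> (q * b d / y) * (\<Prod>m\<in>B - {d}. \<Gamma> (b m * y) * \<Gamma> (b m / y))"
    unfolding params_def using B by (simp add: prod.remove)
  also have "\<dots> = b d * theta_pm p (b d) y * params B b y"
    unfolding params_def * using B by (simp add: prod.remove[of B d])
  finally show ?thesis .
qed

lemma typeI_weight_shift:
  assumes B: "finite B" "d \<in> B" and b: "b d \<noteq> 0" "norm (b d) < 1" and z: "z \<in> space (torus I)"
  shows "typeI_weight I B (b(d := q * b d)) z = b d ^ card I * (\<Prod>j\<in>I. theta_pm p (b d) (z j)) * typeI_weight I B b z"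
proof -
  have "(\<Prod>i\<in>I. params B (b(d := q * b d)) (z i) * \<omega> (z i)) = (\<Prod>i\<in>I. b d * theta_pm p (b d) (z i) * (params B b (z i) * \<omega> (z i)))"
    using params_shift[where b = b, OF B b] norm_torus[OF z] by (intro prod.cong refl) (simp add: mult.assoc)
  also have "\<dots> = b d ^ card I * (\<Prod>j\<in>I. theta_pm p (b d) (z j)) * (\<Prod>i\<in>I. params B b (z i) * \<omega> (z i))"
    by (simp only: prod.distrib prod_constant mult.assoc)
  finally show ?thesis by (simp only: typeI_weight_def mult.assoc)
qed

lemma typeI_value_shift:
  assumes B: "finite B" "d \<in> B" and b: "\<And>m. m \<in> B \<Longrightarrow> b m \<noteq> 0" "\<And>m. m \<in> B \<Longrightarrow> norm (b m) < 1"
  shows "typeI_value B (b(d := q * b d)) = (\<Prod>m\<in>B - {d}. theta p (b m * b d)) * typeI_value B b"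
proof -
  have lt: "norm (b m * b d) < 1" if "m \<in> B" for m
    using b(2)[OF that] b(2)[OF B(2)] by (metis mult_strict_mono' norm_ge_zero norm_mult mult_1)
  have "typeI_value B (b(d := q * b d)) = (\<Prod>k\<in>B - {d}. \<Gamma> (q * b d * b k)) * pair_prod (\<lambda>m k. \<Gamma> ((b(d := q * b d)) m * (b(d := q * b d)) k)) (B - {d})"
    unfolding typeI_value_def using B by (subst pair_prod_remove[of B d]) (auto simp: mult.commute)
  also have "pair_prod (\<lambda>m k. \<Gamma> ((b(d := q * b d)) m * (b(d := q * b d)) k)) (B - {d}) = pair_prod (\<lambda>m k. \<Gamma> (b m * b k)) (B - {d})"
    by (intro pair_prod_cong) auto
  also have "(\<Prod>k\<in>B - {d}. \<Gamma> (q * b d * b k)) = (\<Prod>k\<in>B - {d}. theta p (b k * b d) * \<Gamma> (b d * b k))"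
  proof (intro prod.cong refl)
    fix k assume "k \<in> B - {d}"
    then show "\<Gamma> (q * b d * b k) = theta p (b k * b d) * \<Gamma> (b d * b k)"
      using Gamma_mult_q[of "b k * b d"] b(1) B lt[of k] by (simp add: mult_ac)
  qed
  also have "(\<Prod>k\<in>B - {d}. theta p (b k * b d) * \<Gamma> (b d * b k)) * pair_prod (\<lambda>m k. \<Gamma> (b m * b k)) (B - {d})
      = (\<Prod>m\<in>B - {d}. theta p (b m * b d)) * typeI_value B b"
    unfolding typeI_value_def using B by (subst pair_prod_remove[of B d]) (auto simp: mult.commute prod.distrib)
  finally show ?thesis .
qed

context
  fixes n :: nat and B :: "nat set" and b :: "nat \<Rightarrow> complex" and c d :: nat and I :: "nat set"
  assumes B: "finite B" "card B = 2 * n + 4"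
    and b: "\<And>m. m \<in> B \<Longrightarrow> b m \<noteq> 0" "\<And>m. m \<in> B \<Longrightarrow> norm (b m) < 1"
    and bal: "(\<Prod>m\<in>B. b m) = p"
    and cd: "c \<in> B" "d \<in> B" "norm p < norm (b d) ^ 2" "theta p ((b c)\<^sup>2) \<noteq> 0"
    and I: "finite I" "card I = n"
begin

text \<open>
  As a function of \<open>z\<^sub>i\<close>, this is an integrand of the kind whose integral vanishes by
  \<open>integral_sym_numerator_eq_0\<close>.
\<close>

definition exact_term :: "nat \<Rightarrow> (nat \<Rightarrow> complex) \<Rightarrow> complex" where
  "exact_term i z = (params B b (z i) * sym_numerator n B b (z i) * theta q (1 / (z i)\<^sup>2) * (\<Prod>j\<in>I - {i}. theta_pm q (z i) (z j))) *
     ((\<Prod>j\<in>I - {i}. theta_pm p (b d) (z j) * theta_pm p (b c) (z j) * (params B b (z j) * \<omega> (z j))) *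
      pair_prod (\<lambda>j k. \<kappa> (z j) (z k)) (I - {i}))"

lemma typeI_weight_remove:
  assumes z: "z \<in> space (torus I)" and i: "i \<in> I"
  shows "typeI_weight I B b z = params B b (z i) * (theta p ((z i)\<^sup>2) * theta q (1 / (z i)\<^sup>2)) *
    ((\<Prod>j\<in>I - {i}. theta_pm p (z i) (z j)) * (\<Prod>j\<in>I - {i}. theta_pm q (z i) (z j))) *
    ((\<Prod>j\<in>I - {i}. params B b (z j) * \<omega> (z j)) * pair_prod (\<lambda>j k. \<kappa> (z j) (z k)) (I - {i}))"
proof -
  have nz: "z j \<noteq> 0" if "j \<in> I" for j using norm_torus[OF z that] by auto
  have "pair_prod (\<lambda>j k. \<kappa> (z j) (z k)) I = (\<Prod>k\<in>I - {i}. \<kappa> (z i) (z k)) * pair_prod (\<lambda>j k. \<kappa> (z j) (z k)) (I - {i})"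
    using I i nz \<kappa>_sym by (intro pair_prod_remove) auto
  moreover have "(\<Prod>k\<in>I - {i}. \<kappa> (z i) (z k)) = (\<Prod>j\<in>I - {i}. theta_pm p (z i) (z j)) * (\<Prod>j\<in>I - {i}. theta_pm q (z i) (z j))"
    by (simp add: \<kappa>_def prod.distrib)
  moreover have "(\<Prod>i\<in>I. params B b (z i) * \<omega> (z i)) = (params B b (z i) * (theta p ((z i)\<^sup>2) * theta q (1 / (z i)\<^sup>2))) * (\<Prod>j\<in>I - {i}. params B b (z j) * \<omega> (z j))"
    using I i by (simp add: prod.remove \<omega>_def)
  ultimately show ?thesis unfolding typeI_weight_def by (simp only: mult_ac)
qed

text \<open>
  The interpolation formula, with the variables \<open>z\<^sub>i\<close> and \<open>b d\<close> as nodes, is evaluated at \<open>b c\<close> and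
  multiplied by the weight. The theta functions in \<open>\<kappa>\<close> and \<open>\<omega>\<close> with base \<open>p\<close> cancel the denominators of the
  formula. If nodes coincide or some \<open>z\<^sub>i\<close> is \<open>\<plusminus>1\<close>, then the formula is not available, but both sides are 0.
\<close>

lemma shift_difference_exact:
  assumes z: "z \<in> space (torus I)"
  shows "(\<Prod>m\<in>B - {c}. theta p (b m * b c)) / b c ^ n * (\<Prod>j\<in>I. theta_pm p (b d) (z j)) * typeI_weight I B b z
     - (\<Prod>m\<in>B - {d}. theta p (b m * b d)) / b d ^ n * (\<Prod>j\<in>I. theta_pm p (b c) (z j)) * typeI_weight I B b z
     = (\<Sum>i\<in>I. - theta_pm p (b c) (b d) * exact_term i z)"
proof -
  have nz: "z j \<noteq> 0" "norm (z j) = 1" if "j \<in> I" for j using norm_torus[OF z that] by auto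
  define W where "W = typeI_weight I B b z"
  show ?thesis
  proof (cases "(\<exists>i\<in>I. (z i)\<^sup>2 = 1) \<or> (\<exists>i\<in>I. \<exists>j\<in>I. i \<noteq> j \<and> (z i = z j \<or> z i * z j = 1))")
    case True
    have "W = 0 \<and> (\<forall>k\<in>I. exact_term k z = 0)"
    proof (cases "\<exists>i\<in>I. (z i)\<^sup>2 = 1")
      case True
      then obtain i where i: "i \<in> I" "(z i)\<^sup>2 = 1" by blast
      then have "\<omega> (z i) = 0" "theta q (1 / (z i)\<^sup>2) = 0" using norm_p norm_q by (simp_all add: \<omega>_def)
      then have "exact_term k z = 0" if "k \<in> I" for k
        using I i that unfolding exact_term_def by (cases "k = i") auto
      moreover have "W = 0" using I i \<open>\<omega> (z i) = 0\<close> unfolding W_def typeI_weight_def by auto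
      ultimately show ?thesis by blast
    next
      case False
      with True obtain i j where "i \<in> I" "j \<in> I" "i \<noteq> j" "z i = z j \<or> z i * z j = 1" by blast
      then obtain i j where ij: "i \<in> I" "j \<in> I" "i < j" "z i = z j \<or> z i * z j = 1"
        by (metis linorder_neqE_nat mult.commute)
      have pm: "theta_pm r (z i) (z j) = 0" "theta_pm r (z j) (z i) = 0" if "norm r < 1" for r
      proof -
        show "theta_pm r (z i) (z j) = 0" unfolding theta_pm_def using ij nz that by auto
        then show "theta_pm r (z j) (z i) = 0" using theta_pm_swap[OF that, of "z i" "z j"] nz ij by simp
      qed
      then have k0: "\<kappa> (z i) (z j) = 0" by (simp add: \<kappa>_def norm_p)
      then have "W = 0" unfolding W_def typeI_weight_def
        using pair_prod_zero[OF I(1) ij(1,2,3), of "\<lambda>j k. \<kappa> (z j) (z k)"] by simp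
      moreover have "exact_term k z = 0" if "k \<in> I" for k
      proof -
        consider "k = i" | "k = j" | "k \<noteq> i \<and> k \<noteq> j" by blast
        then show ?thesis
        proof cases
          case 1
          then have "(\<Prod>j\<in>I - {k}. theta_pm q (z k) (z j)) = 0" using I ij pm[OF norm_q] by (intro prod_zero) auto
          then show ?thesis by (simp add: exact_term_def)
        next
          case 2
          then have "(\<Prod>j\<in>I - {k}. theta_pm q (z k) (z j)) = 0" using I ij pm[OF norm_q] by (intro prod_zero) auto
          then show ?thesis by (simp add: exact_term_def)
        next
          case 3
          then have "pair_prod (\<lambda>j k. \<kappa> (z j) (z k)) (I - {k}) = 0" using I ij k0 by (intro pair_prod_zero[of _ i j]) auto
          then show ?thesis by (simp add: exact_term_def)
        qed
      qed
      ultimately show ?thesis by blast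
    qed
    then show ?thesis by (simp add: W_def)
  next
    case False
    have inj: "inj_on z I" using False by (auto simp: inj_on_def)
    have ne: "(z i)\<^sup>2 \<noteq> 1" if "i \<in> I" for i using False that by blast
    have ne2: "z i * z j \<noteq> 1" if "i \<in> I" "j \<in> I" "i \<noteq> j" for i j using False that by blast
    have ne3: "z i \<noteq> z j" if "i \<in> I" "j \<in> I" "i \<noteq> j" for i j using False that by blast
    define hc where "hc = (\<Prod>m\<in>B - {c}. theta p (b m * b c)) / b c ^ n"
    define hd where "hd = (\<Prod>m\<in>B - {d}. theta p (b m * b d)) / b d ^ n"
    define P where "P = (\<Prod>j\<in>I. theta_pm p (b d) (z j))"
    have d: "norm p < norm (b d) ^ 2" "norm (b d) < 1" using cd b by auto
    have Nc: "sym_numerator n B b (b c) = theta p ((b c)\<^sup>2) * hc"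
      unfolding hc_def using sym_numerator_at_param[OF B b bal cd(1)] by simp
    have Nd: "sym_numerator n B b (b d) / theta p ((b d)\<^sup>2) = hd"
      unfolding hd_def using sym_numerator_at_param[OF B b bal cd(2)] theta_square_nonzero[OF d] by simp
    have pmd: "theta_pm p (b d) (z j) \<noteq> 0" "theta_pm p (z j) (b d) \<noteq> 0" if "j \<in> I" for j
      using theta_pm_unit_nonzero[OF d nz(2)[OF that]] by auto
    have pmz: "theta_pm p (z i) (z j) \<noteq> 0" if "i \<in> I" "j \<in> I" "i \<noteq> j" for i j
      using nz that ne2[OF that] ne3[OF that] by (intro theta_pm_units_nonzero) auto
    define T where "T i = sym_numerator n B b (z i) / theta p ((z i)\<^sup>2) * (theta_pm p (b c) (b d) / theta_pm p (z i) (b d)) *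
        (\<Prod>j\<in>I - {i}. theta_pm p (b c) (z j) / theta_pm p (z i) (z j))" for i
    have "theta p ((b c)\<^sup>2) * hc = theta p ((b c)\<^sup>2) * (hd * (\<Prod>j\<in>I. theta_pm p (b c) (z j) / theta_pm p (b d) (z j)) + (\<Sum>i\<in>I. T i))"
      unfolding T_def Nd[symmetric] Nc[symmetric]
      using b(1)[OF cd(1)] by (intro theta_interpolation[OF B b bal I nz(2) ne inj ne2 d])
    then have hc: "hc = hd * (\<Prod>j\<in>I. theta_pm p (b c) (z j) / theta_pm p (b d) (z j)) + (\<Sum>i\<in>I. T i)"
      using cd(4) by simp
    have "hc * P * W = hd * ((\<Prod>j\<in>I. theta_pm p (b c) (z j) / theta_pm p (b d) (z j)) * P) * W + (\<Sum>i\<in>I. T i * P * W)"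
      by (subst hc) (simp add: algebra_simps sum_distrib_right sum_distrib_left)
    also have "(\<Prod>j\<in>I. theta_pm p (b c) (z j) / theta_pm p (b d) (z j)) * P = (\<Prod>j\<in>I. theta_pm p (b c) (z j))"
      unfolding P_def prod.distrib[symmetric] using pmd by (intro prod.cong) auto
    also have "(\<Sum>i\<in>I. T i * P * W) = (\<Sum>i\<in>I. - theta_pm p (b c) (b d) * exact_term i z)"
    proof (rule sum.cong[OF refl])
      fix i assume i: "i \<in> I"
      have P: "P = - theta_pm p (z i) (b d) * (\<Prod>j\<in>I - {i}. theta_pm p (b d) (z j))"
        unfolding P_def using I i theta_pm_swap[OF norm_p nz(1)[OF i] b(1)[OF cd(2)]] by (simp add: prod.remove)
      have th: "theta p ((z i)\<^sup>2) \<noteq> 0" using nz i ne by (intro theta_unit_square_nonzero) auto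
      have pr: "(\<Prod>j\<in>I - {i}. theta_pm p (b c) (z j) / theta_pm p (z i) (z j)) * (\<Prod>j\<in>I - {i}. theta_pm p (z i) (z j)) = (\<Prod>j\<in>I - {i}. theta_pm p (b c) (z j))"
        unfolding prod.distrib[symmetric] using pmz i by (intro prod.cong) auto
      have split: "(\<Prod>j\<in>I - {i}. theta_pm p (b d) (z j) * theta_pm p (b c) (z j) * (params B b (z j) * \<omega> (z j)))
         = (\<Prod>j\<in>I - {i}. theta_pm p (b d) (z j)) * (\<Prod>j\<in>I - {i}. theta_pm p (b c) (z j)) * (\<Prod>j\<in>I - {i}. params B b (z j) * \<omega> (z j))"
        by (simp only: prod.distrib)
      show "T i * P * W = - theta_pm p (b c) (b d) * exact_term i z"
        unfolding T_def P W_def typeI_weight_remove[OF z i] exact_term_def split pr[symmetric]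
        using th pmd[OF i] by simp
    qed
    finally show ?thesis by (simp add: hc_def hd_def P_def W_def)
  qed
qed

lemma tame_exact_term:
  assumes i: "i \<in> I"
  shows "tame (torus I) (exact_term i)"
proof -
  have pm: "theta_pm p (b e) holomorphic_on - {0}" if "e \<in> B" for e
    using norm_p b(1)[OF that] by (intro holomorphic_intros) auto
  have comp: "(\<lambda>z. z j) \<in> borel_measurable (torus I)" "\<And>w. w \<in> space (torus I) \<Longrightarrow> norm (w j) = 1" if "j \<in> I" for j
    using that norm_torus by auto
  have par: "tame (torus I) (\<lambda>z. params B b (z j))" if "j \<in> I" for j
    by (rule tame_family_params) (use b comp[OF that] in auto)
  have "tame (torus I) (\<lambda>z. (params B b (z i) * sym_numerator n B b (z i) * theta q (1 / (z i)\<^sup>2) * (\<Prod>j\<in>I - {i}. theta_pm q (z i) (z j))) *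
     ((\<Prod>j\<in>I - {i}. theta_pm p (b d) (z j) * theta_pm p (b c) (z j) * (params B b (z j) * \<omega> (z j))) *
      pair_prod (\<lambda>j k. \<kappa> (z j) (z k)) (I - {i})))"
  proof (intro tame_intros)
    show "tame (torus I) (\<lambda>z. params B b (z i))" by (rule par[OF i])
    show "tame (torus I) (\<lambda>z. params B b (z j))" if "j \<in> I - {i}" for j using par that by auto
    show "tame (torus I) (\<lambda>z. sym_numerator n B b (z i))" by (rule tame_family_unit_circle[OF _ holomorphic_sym_numerator[OF B b bal]]) (use comp[OF i] in auto)
    show "tame (torus I) (\<lambda>z. theta_pm q (z i) (z j))" if "j \<in> I - {i}" for j
      by (rule tame_family_theta_pm[OF _ norm_q]) (use comp[OF i] comp[of j] that in auto)
    show "tame (torus I) (\<lambda>z. theta_pm p (b d) (z j))" if "j \<in> I - {i}" for j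
      by (rule tame_family_unit_circle[OF _ pm[OF cd(2)]]) (use comp[of j] that in auto)
    show "tame (torus I) (\<lambda>z. theta_pm p (b c) (z j))" if "j \<in> I - {i}" for j
      by (rule tame_family_unit_circle[OF _ pm[OF cd(1)]]) (use comp[of j] that in auto)
  qed (use norm_q comp i in \<open>auto simp: norm_divide norm_power\<close>)
  then show ?thesis by (simp add: exact_term_def[abs_def])
qed

lemma integral_exact_term:
  assumes i: "i \<in> I"
  shows "(\<integral>z. exact_term i z \<partial>torus I) = 0"
proof -
  have int: "integrable (torus (insert i (I - {i}))) (exact_term i)"
    using tame_integrable[OF finite_measure_torus[OF I(1)] tame_exact_term[OF i]] i by (simp add: insert_absorb)
  have "(\<integral>z. exact_term i z \<partial>torus (insert i (I - {i}))) = (\<integral>x. (\<integral>y. exact_term i (x(i := y)) \<partial>circ) \<partial>torus (I - {i}))"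
    using I by (intro circs.product_integral_insert int) auto
  also have "\<dots> = (\<integral>x. 0 \<partial>torus (I - {i}))"
  proof (intro Bochner_Integration.integral_cong refl)
    fix x assume x: "x \<in> space (torus (I - {i}))"
    have x0: "x j \<noteq> 0" if "j \<in> I - {i}" for j using norm_torus[OF x that] by auto
    define g where "g y = (\<Prod>j\<in>I - {i}. theta_pm q y (x j))" for y
    define R where "R = (\<Prod>j\<in>I - {i}. theta_pm p (b d) (x j) * theta_pm p (b c) (x j) * (params B b (x j) * \<omega> (x j))) *
      pair_prod (\<lambda>j k. \<kappa> (x j) (x k)) (I - {i})"
    have "exact_term i (x(i := y)) = (params B b y * sym_numerator n B b y * theta q (1 / y\<^sup>2) * g y) * R" for y
    proof -
      have "(\<Prod>j\<in>I - {i}. theta_pm q ((x(i := y)) i) ((x(i := y)) j)) = g y"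
        unfolding g_def by (intro prod.cong) auto
      moreover have "(\<Prod>j\<in>I - {i}. theta_pm p (b d) ((x(i := y)) j) * theta_pm p (b c) ((x(i := y)) j) * (params B b ((x(i := y)) j) * \<omega> ((x(i := y)) j)))
        = (\<Prod>j\<in>I - {i}. theta_pm p (b d) (x j) * theta_pm p (b c) (x j) * (params B b (x j) * \<omega> (x j)))"
        by (intro prod.cong) auto
      moreover have "pair_prod (\<lambda>j k. \<kappa> ((x(i := y)) j) ((x(i := y)) k)) (I - {i}) = pair_prod (\<lambda>j k. \<kappa> (x j) (x k)) (I - {i})"
        by (intro pair_prod_cong) auto
      ultimately show ?thesis unfolding exact_term_def R_def by (simp only: fun_upd_same)
    qed
    then have "(\<integral>y. exact_term i (x(i := y)) \<partial>circ) = (\<integral>y. params B b y * sym_numerator n B b y * theta q (1 / y\<^sup>2) * g y \<partial>circ) * R"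
      by simp
    also have "(\<integral>y. params B b y * sym_numerator n B b y * theta q (1 / y\<^sup>2) * g y \<partial>circ) = 0"
    proof (rule integral_sym_numerator_eq_0[OF B b bal])
      show "g holomorphic_on - {0}" unfolding g_def using x0 norm_q by (intro holomorphic_intros) auto
      show "g (1 / y) = g y" if "y \<noteq> 0" for y
        unfolding g_def using x0 norm_q that by (intro prod.cong) (auto simp: theta_pm_inverse)
      show "g (q * y) = g y / (q * y\<^sup>2) ^ (n - 1)" if "y \<noteq> 0" for y
      proof -
        have "g (q * y) = (\<Prod>j\<in>I - {i}. theta_pm q y (x j) / (q * y\<^sup>2))"
          unfolding g_def using x0 norm_q q_nz that by (intro prod.cong) (auto simp: theta_pm_shift)
        then show ?thesis unfolding g_def using I i by (simp add: prod_dividef card_Diff_singleton)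
      qed
      show "n \<ge> 1" using I i by (metis One_nat_def Suc_leI card_gt_0_iff empty_iff)
    qed
    finally show "(\<integral>y. exact_term i (x(i := y)) \<partial>circ) = 0" by (simp only: mult_zero_left)
  qed
  also have "\<dots> = 0" by simp
  finally show ?thesis using i by (simp add: insert_absorb)
qed

text \<open>
  The parameters have the product \<open>p\<close>, so after multiplying one of them by \<open>q\<close> they are balanced. The relation
  says that both balanced systems have the same quotient of integral and value.
\<close>

lemma typeI_shift_relation:
  "typeI_integral I B (b(d := q * b d)) * typeI_value B (b(c := q * b c)) =
   typeI_integral I B (b(c := q * b c)) * typeI_value B (b(d := q * b d))"
proof -
  define W where "W e z = (\<Prod>j\<in>I. theta_pm p (b e) (z j)) * typeI_weight I B b z" for e z
  define h where "h e = (\<Prod>m\<in>B - {e}. theta p (b m * b e)) / b e ^ n" for e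
  have fm: "finite_measure (torus I)" by (rule finite_measure_torus[OF I(1)])
  have Wint: "typeI_integral I B (b(e := q * b e)) = b e ^ n * (\<integral>z. W e z \<partial>torus I)" "integrable (torus I) (W e)" if e: "e \<in> B" for e
  proof -
    have w: "typeI_weight I B (b(e := q * b e)) z = b e ^ n * W e z" if "z \<in> space (torus I)" for z
      using typeI_weight_shift[where b = b, OF B(1) e b(1)[OF e] b(2)[OF e] that] I by (simp add: W_def mult.assoc)
    then show "typeI_integral I B (b(e := q * b e)) = b e ^ n * (\<integral>z. W e z \<partial>torus I)"
      unfolding typeI_integral_def by (simp cong: Bochner_Integration.integral_cong)
    have pm: "theta_pm p (b e) holomorphic_on - {0}"
      using norm_p b(1)[OF e] by (intro holomorphic_intros) auto
    have "tame (torus I) (\<lambda>z. W e z)"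
      unfolding W_def
      by (intro tame_intros tame_family_typeI_weight tame_family_unit_circle[OF _ pm] torus_component) (use b norm_torus in auto)
    then show "integrable (torus I) (W e)" by (rule tame_integrable[OF fm])
  qed
  have "h c * (\<integral>z. W d z \<partial>torus I) - h d * (\<integral>z. W c z \<partial>torus I) = (\<integral>z. h c * W d z - h d * W c z \<partial>torus I)"
    using Wint(2)[OF cd(1)] Wint(2)[OF cd(2)] by simp
  also have "\<dots> = (\<integral>z. (\<Sum>i\<in>I. - theta_pm p (b c) (b d) * exact_term i z) \<partial>torus I)"
    using shift_difference_exact unfolding W_def h_def
    by (intro Bochner_Integration.integral_cong refl) (simp add: mult.assoc)
  also have "\<dots> = (\<Sum>i\<in>I. - theta_pm p (b c) (b d) * (\<integral>z. exact_term i z \<partial>torus I))"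
    using tame_integrable[OF fm tame_exact_term] by (subst Bochner_Integration.integral_sum) auto
  also have "\<dots> = 0" using integral_exact_term by simp
  finally have eq: "h c * (\<integral>z. W d z \<partial>torus I) = h d * (\<integral>z. W c z \<partial>torus I)" by simp
  have val: "typeI_value B (b(e := q * b e)) = h e * b e ^ n * typeI_value B b" if "e \<in> B" for e
    using typeI_value_shift[OF B(1) that b] b(1)[OF that] by (simp add: h_def)
  have "typeI_integral I B (b(d := q * b d)) * typeI_value B (b(c := q * b c))
     = b d ^ n * b c ^ n * typeI_value B b * (h c * (\<integral>z. W d z \<partial>torus I))"
    unfolding Wint(1)[OF cd(2)] val[OF cd(1)] by (simp only: mult_ac)
  also have "\<dots> = typeI_integral I B (b(c := q * b c)) * typeI_value B (b(d := q * b d))"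
    unfolding Wint(1)[OF cd(1)] val[OF cd(2)] eq by (simp only: mult_ac)
  finally show ?thesis .
qed

end

section \<open>Independence of the parameters\<close>

lemma theta_nonzero_wide:
  assumes "norm p ^ 2 < norm u" "norm u < 1" "norm u \<noteq> norm p"
  shows "theta p u \<noteq> 0"
proof -
  have u0: "u \<noteq> 0" using assms(1) by (metis norm_zero not_less zero_le_power2)
  have "norm (p * u) < 1" using norm_p assms(2) by (metis mult_strict_mono' norm_ge_zero norm_mult mult_1)
  moreover from this have "norm (p * (p * u)) < 1" using norm_p by (metis mult_strict_mono' norm_ge_zero norm_mult mult_1)
  moreover have "norm (p / u) \<noteq> 1" using assms(3) u0 by (auto simp: norm_divide)
  moreover have "norm (p * (p / u)) < 1" using assms(1) u0 by (simp add: norm_mult norm_divide power2_eq_square)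
  ultimately show ?thesis
    unfolding theta_double_factor[OF norm_p] using norm_p assms(2) by (auto simp: qpoch_nonzero)
qed

definition balanced :: "nat set \<Rightarrow> (nat \<Rightarrow> complex) \<Rightarrow> bool" where
  "balanced B b \<longleftrightarrow> (\<forall>m\<in>B. b m \<noteq> 0 \<and> norm (b m) < 1) \<and> (\<Prod>m\<in>B. b m) = p * q"

lemma balancedD:
  "balanced B b \<Longrightarrow> m \<in> B \<Longrightarrow> b m \<noteq> 0" "balanced B b \<Longrightarrow> m \<in> B \<Longrightarrow> norm (b m) < 1"
  "balanced B b \<Longrightarrow> (\<Prod>m\<in>B. b m) = p * q"
  by (auto simp: balanced_def)

lemma balanced_pair:
  assumes "finite B" "card B > 2" "balanced B b" "i \<in> B" "j \<in> B" "i \<noteq> j"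
  shows "norm (p * q) < norm (b i * b j)" "norm (b i * b j) < 1"
proof -
  have "B - {i, j} \<noteq> {}"
  proof
    assume "B - {i, j} = {}"
    then have "card B \<le> card {i, j}" by (intro card_mono) auto
    then show False using assms(2,6) by auto
  qed
  then obtain k where k: "k \<in> B - {i, j}" by auto
  have "(\<Prod>m\<in>B - {i, j}. norm (b m)) = norm (b k) * (\<Prod>m\<in>B - {i, j} - {k}. norm (b m))"
    using k assms(1) by (intro prod.remove) auto
  also have "\<dots> \<le> norm (b k) * 1"
    using balancedD[OF assms(3)] by (intro mult_left_mono prod_le_1) (auto simp: less_imp_le)
  also have "\<dots> < 1" using k balancedD[OF assms(3)] by auto
  finally have lt: "(\<Prod>m\<in>B - {i, j}. norm (b m)) < 1" .
  have "p * q = b i * b j * (\<Prod>m\<in>B - {i, j}. b m)"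
  proof -
    have "p * q = b i * (\<Prod>m\<in>B - {i}. b m)" using balancedD(3)[OF assms(3)] assms by (simp add: prod.remove)
    also have "(\<Prod>m\<in>B - {i}. b m) = b j * (\<Prod>m\<in>B - {i} - {j}. b m)" using assms by (intro prod.remove) auto
    also have "B - {i} - {j} = B - {i, j}" by auto
    finally show ?thesis by simp
  qed
  then have "norm (p * q) = norm (b i * b j) * (\<Prod>m\<in>B - {i, j}. norm (b m))" by (simp add: norm_mult prod_norm)
  also have "\<dots> < norm (b i * b j) * 1"
    using lt balancedD(1)[OF assms(3,4)] balancedD(1)[OF assms(3,5)] by (intro mult_strict_left_mono) auto
  finally show "norm (p * q) < norm (b i * b j)" by simp
  show "norm (b i * b j) < 1"
    using balancedD(2)[OF assms(3,4)] balancedD(2)[OF assms(3,5)] by (metis mult_strict_mono' norm_ge_zero norm_mult mult_1)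
qed

lemma typeI_value_nonzero:
  assumes "finite B" "card B > 2" "balanced B b"
  shows "typeI_value B b \<noteq> 0"
  unfolding typeI_value_def
  using assms balanced_pair[OF assms] by (intro pair_prod_nonzero Gamma_nonzero) auto

lemma typeI_cong:
  assumes "\<And>m. m \<in> B \<Longrightarrow> b m = b' m"
  shows "typeI_integral I B b = typeI_integral I B b'" "typeI_value B b = typeI_value B b'"
proof -
  have "params B b = params B b'" unfolding params_def using assms by (intro ext prod.cong) auto
  then show "typeI_integral I B b = typeI_integral I B b'" by (simp add: typeI_integral_def typeI_weight_def)
  show "typeI_value B b = typeI_value B b'" unfolding typeI_value_def using assms by (intro pair_prod_cong) auto
qed

definition typeI_ratio :: "nat set \<Rightarrow> nat set \<Rightarrow> (nat \<Rightarrow> complex) \<Rightarrow> complex" where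
  "typeI_ratio I B b = typeI_integral I B b / typeI_value B b"

lemma holomorphic_typeI_ratio:
  assumes I: "finite I" and B: "finite B" "card B > 2" and S: "open S"
    and hol: "\<And>m. m \<in> B \<Longrightarrow> (\<lambda>s. b s m) holomorphic_on S" and bal: "\<And>s. s \<in> S \<Longrightarrow> balanced B (b s)"
  shows "(\<lambda>s. typeI_ratio I B (b s)) holomorphic_on S"
proof -
  have "tame_family S (torus I) (\<lambda>s. typeI_weight I B (b s))"
    using hol balancedD[OF bal] by (intro tame_family_typeI_weight S)
  then have "(\<lambda>s. typeI_integral I B (b s)) holomorphic_on S"
    unfolding typeI_integral_def by (intro tame_family_holomorphic_integral finite_measure_torus I S)
  moreover have "(\<lambda>s. typeI_value B (b s)) holomorphic_on S"
    unfolding typeI_value_def using hol balancedD(1)[OF bal] balanced_pair(2)[OF B bal]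
    by (intro holomorphic_on_pair_prod holomorphic_Gamma holomorphic_intros) auto
  ultimately show ?thesis
    unfolding typeI_ratio_def using typeI_value_nonzero[OF B bal] by (intro holomorphic_intros) auto
qed

lemma prod_upd2:
  assumes "finite B" "i \<in> B" "j \<in> B" "i \<noteq> j"
  shows "(\<Prod>m\<in>B. (b(i := u, j := v)) m) = u * v * (\<Prod>m\<in>B - {i, j}. b m :: complex)"
proof -
  have "(\<Prod>m\<in>B. (b(i := u, j := v)) m) = u * (\<Prod>m\<in>B - {i}. (b(i := u, j := v)) m)"
    using assms by (subst prod.remove[of B i]) auto
  also have "(\<Prod>m\<in>B - {i}. (b(i := u, j := v)) m) = v * (\<Prod>m\<in>B - {i} - {j}. (b(i := u, j := v)) m)"
    using assms by (subst prod.remove[of "B - {i}" j]) auto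
  also have "(\<Prod>m\<in>B - {i} - {j}. (b(i := u, j := v)) m) = (\<Prod>m\<in>B - {i, j}. b m)"
    by (intro prod.cong) auto
  finally show ?thesis by (simp only: mult.assoc)
qed

lemma balanced_move:
  assumes B: "finite B" "i \<in> B" "j \<in> B" "i \<noteq> j" and b: "balanced B b" and x: "norm (b j) < norm x" "norm (b i * x) < 1"
  shows "balanced B (b(i := b i * x, j := b j / x))"
proof -
  have x0: "x \<noteq> 0" using x(1) by (metis norm_ge_zero norm_zero not_less)
  have "(\<Prod>m\<in>B. (b(i := b i * x, j := b j / x)) m) = b i * b j * (\<Prod>m\<in>B - {i, j}. b m)"
    using prod_upd2[OF B, of b "b i * x" "b j / x"] x0 by simp
  also have "\<dots> = (\<Prod>m\<in>B. (b(i := b i, j := b j)) m)" by (rule prod_upd2[OF B, symmetric])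
  also have "\<dots> = p * q" using balancedD(3)[OF b] by simp
  finally show ?thesis using b x x0 B by (auto simp: balanced_def norm_divide divide_less_eq)
qed

text \<open>
  As a function of \<open>x\<close>, the quotient is holomorphic in the annulus \<open>norm (b j) < norm x < 1 / norm (b i)\<close> and
  invariant under \<open>x \<mapsto> q x\<close> by \<open>typeI_shift_relation\<close>. The hypothesis \<open>small\<close> makes the annulus wider than a
  period, so that \<open>periodic_on_annulus_constant\<close> applies.
\<close>

lemma typeI_ratio_move_small:
  assumes I: "finite I" and B: "finite B" "card B = 2 * card I + 4" "i \<in> B" "j \<in> B" "i \<noteq> j"
    and b: "balanced B b" and small: "norm (b i * b j) < norm q"
    and x: "norm (b j) < norm x" "norm (b i * x) < 1"
  shows "typeI_ratio I B (b(i := b i * x, j := b j / x)) = typeI_ratio I B b"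
proof -
  define f where "f x = typeI_ratio I B (b(i := b i * x, j := b j / x))" for x
  have bi: "b i \<noteq> 0" "norm (b i) < 1" and bj: "b j \<noteq> 0" "norm (b j) < 1"
    using balancedD[OF b] B by auto
  define U where "U = {x::complex. norm (b j) < norm x \<and> norm x < 1 / norm (b i)}"
  have U: "norm (b j) < norm x" "norm (b i * x) < 1" "x \<noteq> 0" if "x \<in> U" for x
    using that bi bj by (auto simp: U_def norm_mult pos_less_divide_eq mult.commute)
  have openU: "open U" unfolding U_def by (intro open_Collect_conj open_Collect_less continuous_intros)
  have card2: "card B > 2" using B by simp
  have hol: "f holomorphic_on U"
    unfolding f_def
  proof (rule holomorphic_typeI_ratio[OF I B(1) card2 openU])
    show "(\<lambda>s. (b(i := b i * s, j := b j / s)) m) holomorphic_on U" for m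
    proof -
      have "(\<lambda>s. if m = j then b j / s else if m = i then b i * s else b m) holomorphic_on U"
        using U(3) by (cases "m = j"; cases "m = i") (auto intro!: holomorphic_intros)
      then show ?thesis by (simp add: fun_upd_def)
    qed
    show "balanced B (b(i := b i * s, j := b j / s))" if "s \<in> U" for s
      by (rule balanced_move[OF B(1,3-5) b U(1,2)[OF that]])
  qed
  define V where "V = {x. norm (b j / (q * x)) < 1 \<and> norm (b i * x) < 1 \<and> norm p < norm (b j / (q * x)) ^ 2} \<inter> - {0}"
  \<comment> \<open>The hypotheses of the shift relation hold for \<open>x\<close> in \<open>V'\<close>.\<close>
  define V' where "V' = {x \<in> V. theta p ((b i * x)\<^sup>2) \<noteq> 0}"
  have "open V"
  proof -
    have "V = {x. norm (b j) < norm (q * x) \<and> norm (b i * x) < 1 \<and> norm p * norm (q * x) ^ 2 < norm (b j) ^ 2} \<inter> - {0}"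
      unfolding V_def using q_nz by (auto simp: norm_divide power_divide divide_less_eq less_divide_eq)
    moreover have "open \<dots>"
      by (intro open_Int open_Collect_conj open_Collect_less continuous_intros)
    ultimately show ?thesis by simp
  qed
  moreover have "continuous_on V (\<lambda>x. theta p ((b i * x)\<^sup>2))"
    using norm_p bi by (intro holomorphic_on_imp_continuous_on holomorphic_intros) (auto simp: V_def)
  moreover have "V' = V \<inter> (\<lambda>x. theta p ((b i * x)\<^sup>2)) -` (- {0})" by (auto simp: V'_def)
  ultimately have openV': "open V'"
    using continuous_open_preimage[of V "\<lambda>x. theta p ((b i * x)\<^sup>2)" "- {0}"] by (simp add: open_Compl)
  have per: "x \<in> U \<and> q * x \<in> U \<and> f (q * x) = f x" if "x \<in> V'" for x
  proof -
    have x: "x \<noteq> 0" "norm (b j / (q * x)) < 1" "norm (b i * x) < 1" "norm p < norm (b j / (q * x)) ^ 2" "theta p ((b i * x)\<^sup>2) \<noteq> 0"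
      using that by (auto simp: V'_def V_def)
    have qx: "norm (b j) < norm (q * x)" using x(1,2) q_nz by (simp add: norm_divide divide_less_eq)
    have "norm (q * x) \<le> norm x" using norm_q by (simp add: norm_mult mult_left_le_one_le)
    moreover have "norm x * norm (b i) < 1" using x(3) by (simp add: norm_mult mult.commute)
    moreover from calculation have "norm (q * x) * norm (b i) < 1"
      using mult_right_mono[of "norm (q * x)" "norm x" "norm (b i)"] norm_ge_zero[of "b i"] by linarith
    ultimately have xU: "x \<in> U" "q * x \<in> U"
      using qx bi by (simp_all add: U_def pos_less_divide_eq del: norm_mult)
    define \<beta> where "\<beta> = b(i := b i * x, j := b j / (q * x))"
    have prod\<beta>: "(\<Prod>m\<in>B. \<beta> m) = p"
    proof -
      have "(\<Prod>m\<in>B. \<beta> m) = b i * b j * (\<Prod>m\<in>B - {i, j}. b m) / q"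
        unfolding \<beta>_def prod_upd2[OF B(1,3-5)] using x by simp
      also have "b i * b j * (\<Prod>m\<in>B - {i, j}. b m) = p * q"
        using prod_upd2[OF B(1,3-5), of b "b i" "b j"] balancedD(3)[OF b] by simp
      finally show ?thesis using q_nz by simp
    qed
    have \<beta>: "\<beta> m \<noteq> 0" "norm (\<beta> m) < 1" if "m \<in> B" for m
      using balancedD(1,2)[OF b that] x q_nz bi bj unfolding \<beta>_def by auto
    have eq1: "\<beta>(i := q * \<beta> i) = b(i := b i * (q * x), j := b j / (q * x))"
      unfolding \<beta>_def using B(5) by (auto simp: fun_upd_def)
    have eq2: "\<beta>(j := q * \<beta> j) = b(i := b i * x, j := b j / x)"
      unfolding \<beta>_def using B(5) q_nz by (auto simp: fun_upd_def)
    have rel: "typeI_integral I B (\<beta>(j := q * \<beta> j)) * typeI_value B (\<beta>(i := q * \<beta> i)) =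
      typeI_integral I B (\<beta>(i := q * \<beta> i)) * typeI_value B (\<beta>(j := q * \<beta> j))"
      by (rule typeI_shift_relation[OF B(1,2) \<beta> prod\<beta> B(3,4) _ _ I refl]) (use x B(5) in \<open>auto simp: \<beta>_def\<close>)
    have "balanced B (b(i := b i * (q * x), j := b j / (q * x)))" "balanced B (b(i := b i * x, j := b j / x))"
      using xU U by (intro balanced_move[OF B(1,3-5) b]; blast)+
    then have "typeI_value B (\<beta>(i := q * \<beta> i)) \<noteq> 0" "typeI_value B (\<beta>(j := q * \<beta> j)) \<noteq> 0"
      unfolding eq1 eq2 using typeI_value_nonzero[OF B(1) card2] by blast+
    then have "f (q * x) = f x"
      using rel unfolding f_def typeI_ratio_def eq1[symmetric] eq2[symmetric] by (simp add: frac_eq_eq)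
    with xU show ?thesis by auto
  qed
  have ne: "V' \<noteq> {}"
  proof -
    define L where "L = norm (b i * b j) / norm q"
    have Lp: "norm p < L"
      using balanced_pair(1)[OF B(1) card2 b B(3-5)] q_nz by (simp add: L_def norm_mult pos_less_divide_eq)
    have L1: "L < 1" using small q_nz by (simp add: L_def)
    define M where "M = min 1 (L / sqrt (norm p))"
    have sq: "0 < sqrt (norm p)" "sqrt (norm p) < 1" using norm_p p_nz by auto
    have L0: "0 < L" using Lp norm_ge_zero[of p] by linarith
    have "L < L / sqrt (norm p)" using sq L0 by (simp add: pos_less_divide_eq)
    then have "L < M" using L1 by (simp add: M_def)
    then obtain t1 where t1: "L < t1" "t1 < M" using dense by blast
    obtain t2 where t2: "L < t2" "t2 < t1" using t1 dense by blast
    obtain t where t: "L < t" "t < M" "t ^ 2 \<noteq> norm p"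
    proof (cases "t1 ^ 2 = norm p")
      case True
      have "t2 ^ 2 < t1 ^ 2" using t2 L0 by (intro power_strict_mono) auto
      then show ?thesis using that[of t2] t1 t2 True by auto
    qed (use that[of t1] t1 in auto)
    define x where "x = complex_of_real (t / norm (b i))"
    have t0: "0 < t" using t L0 by linarith
    have nx: "norm x = t / norm (b i)" unfolding x_def norm_of_real using t0 by simp
    have bx: "norm (b i * x) = t" using nx bi by (simp add: norm_mult)
    have bq: "norm (b j / (q * x)) = L / t" using nx by (simp add: norm_divide norm_mult L_def)
    have "t * sqrt (norm p) < L" using t(2) sq by (simp add: M_def pos_less_divide_eq)
    then have "sqrt (norm p) < L / t" using t0 by (simp add: pos_less_divide_eq mult.commute)
    then have "sqrt (norm p) ^ 2 < (L / t) ^ 2" using sq by (intro power_strict_mono) auto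
    then have 1: "norm p < (L / t) ^ 2" by simp
    have 2: "L / t < 1" using t t0 by simp
    have t1': "t < 1" using t(2) by (simp add: M_def)
    have "theta p ((b i * x)\<^sup>2) \<noteq> 0"
    proof (rule theta_nonzero_wide)
      have "norm p < t" using Lp t by linarith
      then show "norm p ^ 2 < norm ((b i * x)\<^sup>2)" unfolding norm_power bx by (intro power_strict_mono) auto
      show "norm ((b i * x)\<^sup>2) < 1" unfolding norm_power bx using t0 t1' by (simp add: power_less_one_iff abs_square_less_1)
      show "norm ((b i * x)\<^sup>2) \<noteq> norm p" unfolding norm_power bx by (rule t(3))
    qed
    then have "x \<in> V'" unfolding V'_def V_def using bx bq 1 2 t1' t0 nx bi by auto
    then show ?thesis by auto
  qed
  have "f x = f 1"
  proof (rule periodic_on_annulus_constant[of q "norm (b j)" "1 / norm (b i)" f V'])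
    show "norm (b j) < norm q * (1 / norm (b i))" using small bi by (simp add: norm_mult pos_less_divide_eq mult.commute)
    show "f holomorphic_on {z. norm (b j) < norm z \<and> norm z < 1 / norm (b i)}" using hol by (simp add: U_def)
    show "x \<in> {z. norm (b j) < norm z \<and> norm z < 1 / norm (b i)}" using x bi by (simp add: norm_mult pos_less_divide_eq mult.commute)
  qed (use q_nz norm_q openV' ne per bi bj in \<open>auto simp: U_def\<close>)
  then show ?thesis by (simp add: f_def)
qed

text \<open>
  The remaining parameters can be deformed to modulus close to 1, at the expense of \<open>b i\<close>, keeping the system
  balanced. Then \<open>norm (b i * b j)\<close> is close to \<open>norm (p * q)\<close>, which is less than \<open>norm q\<close>, and the previous
  lemma applies. The identity theorem carries the equation back along the deformation.
\<close>

lemma typeI_ratio_move: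
  assumes I: "finite I" and B: "finite B" "card B = 2 * card I + 4" "i \<in> B" "j \<in> B" "i \<noteq> j"
    and b: "balanced B b" and x: "norm (b j) < norm x" "norm (b i * x) < 1"
  shows "typeI_ratio I B (b(i := b i * x, j := b j / x)) = typeI_ratio I B b"
proof -
  define l where "l = (\<lambda>k. ln (norm (b k)))"
  define \<Lambda> where "\<Lambda> = (\<Sum>k\<in>B - {i, j}. l k)"
  have l: "exp (l k) = norm (b k)" "l k \<le> 0" if "k \<in> B" for k
    using balancedD(1,2)[OF b that] by (auto simp: l_def)
  have \<Lambda>0: "\<Lambda> \<le> 0" unfolding \<Lambda>_def using l by (intro sum_nonpos) auto
  have x0: "x \<noteq> 0" using x(1) by (metis norm_ge_zero norm_zero not_less)
  define c where "c s = (\<lambda>k. if k = i then b i * exp (s * of_real \<Lambda>) else if k = j then b j else b k * exp (- (s * of_real (l k))))" for s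
  define S where "S = {s::complex. Re s < 1 \<and> norm (b i) * exp (Re s * \<Lambda>) < 1 \<and> norm (b i * x) * exp (Re s * \<Lambda>) < 1}"
  have bi: "b i \<noteq> 0" "norm (b i) < 1" and bj: "b j \<noteq> 0" "norm (b j) < 1"
    using balancedD[OF b] B by auto
  have openS: "open S" unfolding S_def by (intro open_Collect_conj open_Collect_less continuous_intros)
  have S_eq: "S = {s. Re s < 1} \<inter> {s. \<Lambda> * Re s < - ln (norm (b i))} \<inter> {s. \<Lambda> * Re s < - ln (norm (b i * x))}"
  proof -
    have "a * exp t < 1 \<longleftrightarrow> t < - ln a" if "a > 0" for a t :: real
    proof -
      have "a * exp t < 1 \<longleftrightarrow> exp (ln a + t) < exp 0" using that by (simp add: exp_add)
      also have "\<dots> \<longleftrightarrow> t < - ln a" unfolding exp_less_cancel_iff by linarith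
      finally show ?thesis .
    qed
    then show ?thesis using bi x0 by (auto simp: S_def mult.commute)
  qed
  have "convex S"
  proof -
    have "convex {s::complex. a * Re s < t}" for a t
    proof -
      have "{s::complex. a * Re s < t} = {s. inner (of_real a) s < t}" by (simp add: inner_complex_def)
      then show ?thesis using convex_halfspace_lt[of "complex_of_real a" t] by simp
    qed
    from this[of 1 1] this show ?thesis unfolding S_eq by (intro convex_Int) auto
  qed
  then have connS: "connected S" by (rule convex_connected)
  have bal: "balanced B (c s)" if s: "s \<in> S" for s
  proof -
    have "c s k \<noteq> 0 \<and> norm (c s k) < 1" if k: "k \<in> B" for k
    proof (cases "k = i \<or> k = j")
      case True
      then show ?thesis using s bi bj by (auto simp: c_def S_def norm_mult)
    next
      case False
      have "norm (c s k) = exp (l k) * exp (- (Re s * l k))" using False l[OF k] by (simp add: c_def norm_mult)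
      also have "\<dots> = exp ((1 - Re s) * l k)" by (simp add: exp_add[symmetric] algebra_simps)
      finally have "norm (c s k) = exp ((1 - Re s) * l k)" .
      moreover have "l k < 0" using balancedD(1,2)[OF b k] by (simp add: l_def)
      then have "(1 - Re s) * l k < 0" using s by (intro mult_pos_neg) (auto simp: S_def)
      ultimately show ?thesis using False balancedD(1)[OF b k] by (auto simp: c_def)
    qed
    moreover have "(\<Prod>k\<in>B. c s k) = p * q"
    proof -
      have "(\<Prod>k\<in>B. c s k) = (\<Prod>k\<in>B. ((\<lambda>k. b k * exp (- (s * of_real (l k))))(i := b i * exp (s * of_real \<Lambda>), j := b j)) k)"
        using B(5) by (intro prod.cong) (auto simp: c_def)
      also have "\<dots> = b i * exp (s * of_real \<Lambda>) * b j * (\<Prod>k\<in>B - {i, j}. b k * exp (- (s * of_real (l k))))"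
        by (rule prod_upd2[OF B(1,3-5)])
      also have "(\<Prod>k\<in>B - {i, j}. b k * exp (- (s * of_real (l k)))) = (\<Prod>k\<in>B - {i, j}. b k) * exp (- (s * of_real \<Lambda>))"
        using B(1) by (simp add: prod.distrib exp_sum[symmetric] \<Lambda>_def sum_negf sum_distrib_left)
      also have "b i * exp (s * of_real \<Lambda>) * b j * ((\<Prod>k\<in>B - {i, j}. b k) * exp (- (s * of_real \<Lambda>))) = b i * b j * (\<Prod>k\<in>B - {i, j}. b k) * (exp (s * of_real \<Lambda>) * exp (- (s * of_real \<Lambda>)))"
        by (simp only: mult_ac)
      also have "exp (s * of_real \<Lambda>) * exp (- (s * of_real \<Lambda>)) = 1" by (simp add: exp_minus_inverse)
      also have "b i * b j * (\<Prod>m\<in>B - {i, j}. b m) * 1 = p * q"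
        using prod_upd2[OF B(1,3-5), of b "b i" "b j"] balancedD(3)[OF b] by simp
      finally show ?thesis .
    qed
    ultimately show ?thesis by (simp add: balanced_def)
  qed
  have cx: "norm (c s j) < norm x" "norm (c s i * x) < 1" if "s \<in> S" for s
    using that x B(5) by (auto simp: c_def S_def norm_mult mult_ac)
  have card2: "card B > 2" using B by simp
  have chol: "(\<lambda>s. c s m) holomorphic_on S" for m
  proof (cases "m = i \<or> m = j")
    case True
    then show ?thesis using B(5) by (auto simp: c_def intro!: holomorphic_intros)
  qed (auto simp: c_def intro!: holomorphic_intros)
  define s' where "s' = {s \<in> S. norm (b i * b j) * exp (Re s * \<Lambda>) < norm q}"
  have S0: "0 \<in> S" using bi x by (simp add: S_def)
  have "typeI_ratio I B ((c 0)(i := c 0 i * x, j := c 0 j / x)) = typeI_ratio I B (c 0)"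
  proof (rule analytic_continuation_open[of s' S "\<lambda>s. typeI_ratio I B ((c s)(i := c s i * x, j := c s j / x))" "\<lambda>s. typeI_ratio I B (c s)"])
    have "s' = S \<inter> {s. norm (b i * b j) * exp (Re s * \<Lambda>) < norm q}" by (auto simp: s'_def)
    then show "open s'" using openS by (auto intro!: open_Int open_Collect_less continuous_intros)
    show "s' \<subseteq> S" by (auto simp: s'_def)
    show "(\<lambda>s. typeI_ratio I B (c s)) holomorphic_on S"
      by (rule holomorphic_typeI_ratio[OF I B(1) card2 openS chol bal])
    show "(\<lambda>s. typeI_ratio I B ((c s)(i := c s i * x, j := c s j / x))) holomorphic_on S"
    proof (rule holomorphic_typeI_ratio[OF I B(1) card2 openS])
      show "balanced B ((c s)(i := c s i * x, j := c s j / x))" if "s \<in> S" for s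
        by (rule balanced_move[OF B(1,3-5) bal[OF that] cx[OF that]])
      show "(\<lambda>s. ((c s)(i := c s i * x, j := c s j / x)) m) holomorphic_on S" for m
        using chol[of m] chol[of i] chol[of j] x0 by (cases "m = j"; cases "m = i") (auto intro!: holomorphic_intros)
    qed
    show "typeI_ratio I B ((c s)(i := c s i * x, j := c s j / x)) = typeI_ratio I B (c s)" if "s \<in> s'" for s
    proof (rule typeI_ratio_move_small[OF I B])
      have "s \<in> S" using that by (simp add: s'_def)
      then show "balanced B (c s)" "norm (c s j) < norm x" "norm (c s i * x) < 1" using bal cx by auto
      show "norm (c s i * c s j) < norm q" using that B(5) by (simp add: s'_def c_def norm_mult mult_ac)
    qed
    show "s' \<noteq> {}"
    proof -
      have "norm (b i * b j) * exp \<Lambda> = norm (p * q)"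
      proof -
        have "exp \<Lambda> = (\<Prod>k\<in>B - {i, j}. norm (b k))"
          unfolding \<Lambda>_def using B(1) l by (subst exp_sum) (auto intro!: prod.cong)
        then have "norm (b i * b j) * exp \<Lambda> = norm (b i * b j * (\<Prod>m\<in>B - {i, j}. b m))"
          by (simp add: norm_mult prod_norm)
        also have "b i * b j * (\<Prod>m\<in>B - {i, j}. b m) = p * q"
          using prod_upd2[OF B(1,3-5), of b "b i" "b j"] balancedD(3)[OF b] by simp
        finally show ?thesis .
      qed
      also have "\<dots> < norm q" using norm_p q_nz by (simp add: norm_mult)
      finally have lt: "norm (b i * b j) * exp (1 * \<Lambda>) < norm q" by simp
      have "((\<lambda>t. norm (b i * b j) * exp (t * \<Lambda>)) \<longlongrightarrow> norm (b i * b j) * exp (1 * \<Lambda>)) (at_left 1)"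
        by (intro tendsto_intros)
      then have "\<forall>\<^sub>F t in at_left 1. norm (b i * b j) * exp (t * \<Lambda>) < norm q"
        using lt by (rule order_tendstoD(2))
      moreover have "\<forall>\<^sub>F t in at_left (1::real). 0 < t \<and> t < 1"
        using eventually_at_left_real[of 0 "1::real"] by (simp add: greaterThanLessThan_iff)
      ultimately have "\<forall>\<^sub>F t in at_left 1. norm (b i * b j) * exp (t * \<Lambda>) < norm q \<and> 0 < t \<and> t < 1"
        by (rule eventually_conj)
      then obtain t where t: "norm (b i * b j) * exp (t * \<Lambda>) < norm q" "0 < t" "t < 1"
        using eventually_happens'[OF trivial_limit_at_left_real] by blast
      have "exp (t * \<Lambda>) \<le> 1" using t \<Lambda>0 by (simp add: mult_nonneg_nonpos)
      then have "norm (b i) * exp (t * \<Lambda>) \<le> norm (b i)" "norm (b i * x) * exp (t * \<Lambda>) \<le> norm (b i * x)"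
        by (intro mult_left_le norm_ge_zero; simp)+
      then have "norm (b i) * exp (t * \<Lambda>) < 1" "norm (b i * x) * exp (t * \<Lambda>) < 1" using bi x by linarith+
      then have "of_real t \<in> s'" using t by (simp add: s'_def S_def)
      then show ?thesis by auto
    qed
  qed (use openS connS S0 in auto)
  moreover have "c 0 = b" by (auto simp: c_def)
  ultimately show ?thesis by simp
qed

text \<open>
  The parameters with index different from \<open>j\<close> are changed one after the other, and \<open>b j\<close>, which only becomes
  smaller, compensates for the product.
\<close>

lemma typeI_ratio_eq_larger:
  assumes I: "finite I" and B: "finite B" "card B = 2 * card I + 4" "j \<in> B"
    and b: "balanced B b" and c: "balanced B c" and le: "\<And>k. k \<in> B - {j} \<Longrightarrow> norm (b k) \<le> norm (c k)"
  shows "typeI_ratio I B b = typeI_ratio I B c"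
proof -
  define e where "e K = (\<lambda>k. if k \<in> K then c k else if k = j then b j * (\<Prod>k\<in>K. b k / c k) else b k)" for K
  have step: "balanced B (e K) \<and> norm (e K j) \<le> norm (b j) \<and> typeI_ratio I B (e K) = typeI_ratio I B b" if "K \<subseteq> B - {j}" for K
    using finite_subset[OF that finite_Diff[OF B(1)]] that
  proof (induction K rule: finite_induct)
    case empty
    have "e {} = b" by (auto simp: e_def)
    then show ?case using b by simp
  next
    case (insert i K)
    define x where "x = c i / b i"
    have i: "i \<in> B" "i \<noteq> j" "i \<notin> K" using insert by auto
    have IH: "balanced B (e K)" "norm (e K j) \<le> norm (b j)" "typeI_ratio I B (e K) = typeI_ratio I B b" using insert by auto
    have ei: "e K i = b i" using i by (simp add: e_def)
    have jK: "j \<notin> K" using insert by auto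
    have nz: "b i \<noteq> 0" "c i \<noteq> 0" using balancedD b c i by auto
    have x1: "norm x \<ge> 1" using le[of i] i nz by (simp add: x_def norm_divide)
    have eq: "(e K)(i := e K i * x, j := e K j / x) = e (insert i K)"
      using i jK nz insert.hyps by (auto simp: e_def x_def fun_upd_def)
    have x2: "norm (e K j) < norm x" using x1 IH(2) balancedD(2)[OF b B(3)] by linarith
    have x3: "norm (e K i * x) < 1" unfolding ei x_def using nz balancedD(2)[OF c i(1)] by simp
    have "typeI_ratio I B (e (insert i K)) = typeI_ratio I B (e K)"
      unfolding eq[symmetric] by (rule typeI_ratio_move[OF I B(1,2) i(1) B(3) i(2) IH(1) x2 x3])
    moreover have "balanced B (e (insert i K))"
      unfolding eq[symmetric] by (rule balanced_move[OF B(1) i(1) B(3) i(2) IH(1) x2 x3])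
    moreover have "norm (e (insert i K) j) \<le> norm (b j)"
    proof -
      have "norm (e (insert i K) j) = norm (e K j) / norm x" unfolding eq[symmetric] by (simp add: norm_divide)
      also have "\<dots> \<le> norm (e K j) / 1" using x1 by (intro divide_left_mono) auto
      finally show ?thesis using IH(2) by simp
    qed
    ultimately show ?case using IH by simp
  qed
  have "e (B - {j}) k = c k" if k: "k \<in> B" for k
  proof (cases "k = j")
    case True
    have "e (B - {j}) j * (\<Prod>k\<in>B - {j}. e (B - {j}) k) = p * q"
      using balancedD(3)[of B "e (B - {j})"] step[of "B - {j}"] prod.remove[OF B(1) B(3), of "e (B - {j})"] by simp
    moreover have "(\<Prod>k\<in>B - {j}. e (B - {j}) k) = (\<Prod>k\<in>B - {j}. c k)" by (intro prod.cong) (auto simp: e_def)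
    moreover have "c j * (\<Prod>k\<in>B - {j}. c k) = p * q" using balancedD(3)[OF c] B by (simp add: prod.remove[of B j])
    moreover have "(\<Prod>k\<in>B - {j}. c k) \<noteq> 0" using balancedD(1)[OF c] B by auto
    ultimately show ?thesis using True by (metis mult_right_cancel)
  qed (use k in \<open>auto simp: e_def\<close>)
  then have "typeI_ratio I B (e (B - {j})) = typeI_ratio I B c"
    unfolding typeI_ratio_def using typeI_cong[of B "e (B - {j})" c] by metis
  with step[of "B - {j}"] show ?thesis by simp
qed

text \<open>
  Two systems are compared with a third one which, apart from one index, has moduli at least as large as
  both.
\<close>

theorem typeI_ratio_const:
  assumes I: "finite I" and B: "finite B" "card B = 2 * card I + 4" and b: "balanced B b" and b': "balanced B b'"
  shows "typeI_ratio I B b = typeI_ratio I B b'"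
proof -
  have "B \<noteq> {}" using B by auto
  then obtain j where j: "j \<in> B" by auto
  define m where "m k = (if norm (b k) \<ge> norm (b' k) then b k else b' k)" for k
  define c where "c = m(j := p * q / (\<Prod>k\<in>B - {j}. m k))"
  have m: "m k \<noteq> 0" "norm (m k) < 1" "norm (b k) \<le> norm (m k)" "norm (b' k) \<le> norm (m k)" if "k \<in> B" for k
    using balancedD(1,2)[OF b that] balancedD(1,2)[OF b' that] by (auto simp: m_def)
  have mz: "(\<Prod>k\<in>B - {j}. m k) \<noteq> 0" using m B by auto
  have c: "balanced B c"
  proof -
    have "norm (p * q) = norm (b j) * (\<Prod>k\<in>B - {j}. norm (b k))"
      using balancedD(3)[OF b] prod.remove[OF B(1) j, of b] by (metis norm_mult prod_norm)
    also have "\<dots> \<le> norm (b j) * (\<Prod>k\<in>B - {j}. norm (m k))"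
      using m by (intro mult_left_mono prod_mono) auto
    also have "\<dots> < 1 * (\<Prod>k\<in>B - {j}. norm (m k))"
      using balancedD(2)[OF b j] m by (intro mult_strict_right_mono prod_pos) auto
    finally have "norm (p * q) < norm (\<Prod>k\<in>B - {j}. m k)" by (simp add: prod_norm)
    then have "norm (c j) < 1" using mz by (simp add: c_def norm_divide)
    moreover have "c j \<noteq> 0" using mz p_nz q_nz by (simp add: c_def)
    moreover have "(\<Prod>k\<in>B. c k) = p * q"
    proof -
      have "(\<Prod>k\<in>B - {j}. c k) = (\<Prod>k\<in>B - {j}. m k)" by (intro prod.cong) (auto simp: c_def)
      then show ?thesis using B j mz by (simp add: prod.remove[of B j] c_def)
    qed
    ultimately show ?thesis using m unfolding balanced_def by (metis c_def fun_upd_other)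
  qed
  have "typeI_ratio I B b = typeI_ratio I B c"
    using m by (intro typeI_ratio_eq_larger[OF I B j b c]) (auto simp: c_def)
  also have "\<dots> = typeI_ratio I B b'"
    using m by (intro typeI_ratio_eq_larger[OF I B j b' c, symmetric]) (auto simp: c_def)
  finally show ?thesis .
qed

end

section \<open>The constant in one variable\<close>

lemma set_1_6: "{1..6} = {1, 2, 3, 4, 5, 6 :: nat}"
  by auto

lemma prod_1_6: "(\<Prod>m=1..6. f m) = f 1 * f 2 * f 3 * f 4 * f 5 * f (6::nat) " for f :: "nat \<Rightarrow> complex"
  unfolding set_1_6 by (simp add: mult.assoc)

lemma pair_prod_1_6:
  "pair_prod f {1..6} = (f 1 2 * f 1 3 * f 1 4 * f 1 5 * f 1 6) * (f 2 3 * f 2 4 * f 2 5 * f 2 6) *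
     (f 3 4 * f 3 5 * f 3 6) * (f 4 5 * f 4 6) * f 5 6"
proof -
  have "{k \<in> {1..6}. (1::nat) < k} = {2, 3, 4, 5, 6}" "{k \<in> {1..6}. (2::nat) < k} = {3, 4, 5, 6}"
    "{k \<in> {1..6}. (3::nat) < k} = {4, 5, 6}" "{k \<in> {1..6}. (4::nat) < k} = {5, 6}"
    "{k \<in> {1..6}. (5::nat) < k} = {6}" "{k \<in> {1..6}. (6::nat) < k} = {}" by auto
  note sets = this
  show ?thesis
    unfolding pair_prod_def prod_1_6 sets by (simp add: mult.assoc)
qed

lemma norm_square_eq_1: "norm (u\<^sup>2) = 1 \<Longrightarrow> norm (u :: complex) = 1"
  using power2_eq_iff_nonneg[of "norm u" 1] by (simp add: norm_power)

text \<open>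
  With \<open>A z = \<alpha> + (z\<^sup>2 + 1) * g z\<close> the integrand is \<open>\<alpha>\<close> times a function with mean value 1, plus \<open>g v * (v\<^sup>2 - 1)\<close>
  at \<open>v = R z\<close>, which is holomorphic and antisymmetric under \<open>v \<mapsto> 1 / v\<close> and thus has mean value 0. This is the limit of averaging \<open>A\<close> against a
  Poisson kernel that concentrates at the two points \<open>\<plusminus>\<i>\<close>; the contour has been moved outwards, off these points.
\<close>

lemma integral_circ_pole_average:
  assumes R: "1 < R" "R < R'" and A: "A holomorphic_on {z. 1 / R' < norm z \<and> norm z < R'}"
    and sym: "\<And>z. z \<noteq> 0 \<Longrightarrow> A (1 / z) = A z" and val: "A \<i> = \<alpha>" "A (-\<i>) = \<alpha>"
  shows "(\<integral>z. A (of_real R * z) * (((of_real R * z)\<^sup>2 - 1) / ((of_real R * z)\<^sup>2 + 1)) \<partial>circ) = \<alpha>"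
proof -
  define S where "S = {z::complex. 1 / R' < norm z \<and> norm z < R'}"
  define R1 where "R1 = complex_of_real R"
  have openS: "open S" unfolding S_def by (intro open_Collect_conj open_Collect_less continuous_intros)
  have connS: "connected S" unfolding S_def using connected_annulus(1)[of "1 / R'" "0::complex" R'] by simp
  have S1: "norm z = 1 \<Longrightarrow> z \<in> S" for z using R by (auto simp: S_def)
  have nR: "norm R1 = R" "R1 \<noteq> 0" using R by (auto simp: R1_def)
  have "1 / R' < 1" "1 / R < 1" "1 / R' < 1 / R" using R by (auto simp: frac_less2)
  then have "1 / R' < R" "1 / R < R'" using R by linarith+
  then have RS: "R1 \<in> S" "1 / R1 \<in> S" using \<open>1 / R' < 1 / R\<close> R nR(1) by (simp_all add: S_def norm_divide)
  have rot: "c * z \<in> S" if "c \<in> S" "norm z = 1" for c z using that by (auto simp: S_def norm_mult)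
  have S0: "z \<noteq> 0" if "z \<in> S" for z using that R by (auto simp: S_def)
  have "A holomorphic_on S" using A by (simp only: S_def)
  then have holA: "(\<lambda>z. A z - \<alpha>) holomorphic_on S" by (intro holomorphic_intros)
  have "\<exists>g. g holomorphic_on S \<and> (\<forall>z\<in>S. A z - \<alpha> = (\<Prod>y\<in>{\<i>, -\<i>}. z - y) * g z)"
    by (rule factor_out_finite_zeros[OF _ openS _ holA]) (use S1[of \<i>] S1[of "-\<i>"] val in auto)
  then obtain g where g: "g holomorphic_on S" "\<And>z. z \<in> S \<Longrightarrow> A z - \<alpha> = (\<Prod>y\<in>{\<i>, -\<i>}. z - y) * g z"
    by (elim exE conjE) (rule that, assumption, erule bspec)
  have ne: "\<i> \<noteq> - \<i>" by (simp add: complex_eq_iff)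
  have Ag: "A z = \<alpha> + (z\<^sup>2 + 1) * g z" if "z \<in> S" for z
  proof -
    have "(\<Prod>y\<in>{\<i>, -\<i>}. z - y) = z\<^sup>2 + 1" using ne by (simp add: power2_eq_square algebra_simps)
    with g(2)[OF that] have "A z - \<alpha> = (z\<^sup>2 + 1) * g z" by (simp only:)
    then show ?thesis by (simp only: diff_eq_eq add.commute)
  qed
  define \<phi> where "\<phi> v = g v * (v\<^sup>2 - 1)" for v
  have hol\<phi>: "\<phi> holomorphic_on S" unfolding \<phi>_def using g by (intro holomorphic_intros)
  have anti: "\<phi> (1 / v) = - \<phi> v" if v: "v \<in> S" "v\<^sup>2 \<noteq> -1" for v
  proof -
    have v0: "v \<noteq> 0" by (rule S0[OF v(1)])
    have "0 < norm v" "1 < norm v * R'" "norm v < R'" using v(1) v0 R by (auto simp: S_def pos_divide_less_eq)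
    then have "1 / v \<in> S" using R by (auto simp: S_def norm_divide frac_less2 pos_divide_less_eq mult.commute)
    have v1: "v\<^sup>2 + 1 \<noteq> 0" using v(2) by (simp add: eq_neg_iff_add_eq_0)
    have "(v\<^sup>2 + 1) * g v = ((1 / v)\<^sup>2 + 1) * g (1 / v)"
      using Ag[OF v(1)] Ag[OF \<open>1 / v \<in> S\<close>] sym[OF v0] by simp
    also have "\<dots> = (v\<^sup>2 + 1) * (g (1 / v) / v\<^sup>2)" using v0 by (simp add: field_simps)
    finally have "g v = g (1 / v) / v\<^sup>2" using mult_left_cancel[OF v1] by blast
    then have "g (1 / v) = g v * v\<^sup>2" using v0 by simp
    then show ?thesis unfolding \<phi>_def using v0 by (simp add: field_simps)
  qed
  have v2: "(R1 * z)\<^sup>2 \<noteq> -1" if "norm z = 1" for z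
  proof
    assume "(R1 * z)\<^sup>2 = -1"
    then have "norm ((R1 * z)\<^sup>2) = 1" by simp
    then have "norm (R1 * z) = 1" by (rule norm_square_eq_1)
    then show False using R that nR by (simp add: norm_mult)
  qed
  have meas: "(\<lambda>z. f (c * z)) \<in> borel_measurable circ" if "f holomorphic_on D" "\<And>z. norm z = 1 \<Longrightarrow> c * z \<in> D" for f c D
  proof -
    have "continuous_on (sphere 0 1) (\<lambda>z. f (c * z))"
      using that by (intro continuous_on_compose2[OF holomorphic_on_imp_continuous_on[OF that(1)]] continuous_intros) auto
    then show ?thesis
      by (subst measurable_cong_sets[OF sets_circ refl]) (rule borel_measurable_continuous_on_restrict)
  qed
  have int: "integrable circ (\<lambda>z. f (c * z))" if "f holomorphic_on D" "\<And>z. norm z = 1 \<Longrightarrow> c * z \<in> D" for f c D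
  proof -
    have "tame circ (\<lambda>w. f (c * w))" by (rule tame_family_compose[OF _ that(1)]) (use that(2) in auto)
    then show ?thesis by (rule tame_integrable[OF circ.finite_measure_axioms])
  qed
  have "(\<integral>z. \<phi> (R1 * z) \<partial>circ) = (\<integral>z. \<phi> (R1 * (1 / z)) \<partial>circ)"
    using rot[OF RS(1)] by (intro integral_circ_inverse[symmetric] meas[OF hol\<phi>]) auto
  also have "\<dots> = (\<integral>z. - \<phi> (1 / R1 * z) \<partial>circ)"
  proof (intro Bochner_Integration.integral_cong refl)
    fix z assume "z \<in> space circ"
    then have z: "norm z = 1" "z \<noteq> 0" "norm (1 / z) = 1" by (auto simp: norm_divide)
    show "\<phi> (R1 * (1 / z)) = - \<phi> (1 / R1 * z)"
      using anti[OF rot[OF RS(1) z(3)] v2[OF z(3)]] z nR by simp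
  qed
  also have "\<dots> = - (\<integral>z. \<phi> (R1 * z) \<partial>circ)"
    using integral_circ_scale[OF openS connS hol\<phi> rot RS(2,1)] by simp
  finally have \<phi>0: "(\<integral>z. \<phi> (R1 * z) \<partial>circ) = 0" by (simp add: equation_minus_iff)
  define f1 where "f1 v = (v\<^sup>2 - 1) / (v\<^sup>2 + 1)" for v :: complex
  define f3 where "f3 u = (1 - u\<^sup>2) / (1 + u\<^sup>2)" for u :: complex
  have f1h: "f1 holomorphic_on {v. v\<^sup>2 \<noteq> -1}" unfolding f1_def by (intro holomorphic_intros) (auto simp: eq_neg_iff_add_eq_0)
  have "u\<^sup>2 \<noteq> -1" if "norm u < 1" for u :: complex
  proof
    assume "u\<^sup>2 = -1"
    then have "norm (u\<^sup>2) = 1" by simp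
    then have "norm u = 1" by (rule norm_square_eq_1)
    then show False using that by simp
  qed
  then have f3h: "f3 holomorphic_on ball 0 1"
    unfolding f3_def by (intro holomorphic_intros) (auto simp: add.commute[of 1] eq_neg_iff_add_eq_0)
  have f13: "f1 w = f3 (1 / w)" if "w \<noteq> 0" for w
  proof -
    have "1 - (1 / w)\<^sup>2 = (w\<^sup>2 - 1) / w\<^sup>2" "1 + (1 / w)\<^sup>2 = (w\<^sup>2 + 1) / w\<^sup>2" using that by (simp_all add: field_simps)
    note e = this
    show ?thesis unfolding f1_def f3_def e using that by simp
  qed
  have "(\<integral>z. f1 (R1 * z) \<partial>circ) = (\<integral>z. f1 (R1 * (1 / z)) \<partial>circ)"
    using v2 by (intro integral_circ_inverse[symmetric] meas[OF f1h]) auto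
  also have "\<dots> = (\<integral>z. f3 (1 / R1 * z) \<partial>circ)"
  proof (intro Bochner_Integration.integral_cong refl)
    fix z assume "z \<in> space circ"
    then have "R1 * (1 / z) \<noteq> 0" using nR by auto
    from f13[OF this] show "f1 (R1 * (1 / z)) = f3 (1 / R1 * z)" by simp
  qed
  also have "\<dots> = (\<integral>z. f3 (0 * z) \<partial>circ)"
    by (rule integral_circ_scale[of "ball 0 1"]) (use f3h R nR in \<open>auto simp: norm_mult norm_divide\<close>)
  also have "\<dots> = 1" using emeasure_circ_space by (simp add: f3_def measure_def)
  finally have f1i: "(\<integral>z. f1 (R1 * z) \<partial>circ) = 1" .
  have alg: "X \<noteq> 0 \<Longrightarrow> (a + X * G) * (N / X) = a * (N / X) + G * N" for a X G N :: complex
    by (simp add: field_simps)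
  have "(\<integral>z. A (R1 * z) * (((R1 * z)\<^sup>2 - 1) / ((R1 * z)\<^sup>2 + 1)) \<partial>circ) = (\<integral>z. \<alpha> * f1 (R1 * z) + \<phi> (R1 * z) \<partial>circ)"
  proof (intro Bochner_Integration.integral_cong refl)
    fix z assume "z \<in> space circ"
    then have z: "norm z = 1" by simp
    have "(R1 * z)\<^sup>2 + 1 \<noteq> 0" using v2[OF z] by (simp add: eq_neg_iff_add_eq_0)
    then show "A (R1 * z) * (((R1 * z)\<^sup>2 - 1) / ((R1 * z)\<^sup>2 + 1)) = \<alpha> * f1 (R1 * z) + \<phi> (R1 * z)"
      unfolding Ag[OF rot[OF RS(1) z]] f1_def \<phi>_def by (rule alg)
  qed
  also have "\<dots> = \<alpha>"
  proof -
    have "integrable circ (\<lambda>z. f1 (R1 * z))" by (rule int[OF f1h]) (use v2 in auto)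
    moreover have "integrable circ (\<lambda>z. \<phi> (R1 * z))" by (rule int[OF hol\<phi> rot[OF RS(1)]])
    ultimately show ?thesis using \<phi>0 f1i by simp
  qed
  finally show ?thesis by (simp add: R1_def)
qed

context elliptic_bases
begin

lemma \<omega>_inverse: "z \<noteq> 0 \<Longrightarrow> \<omega> (1 / z) = \<omega> z"
  using theta_inverse[OF norm_p, of "z\<^sup>2"] theta_inverse[OF norm_q, of "z\<^sup>2"] norm_p norm_q
  by (simp add: \<omega>_def power_divide)

lemma \<omega>_at_i: "\<omega> \<i> = 4 / (Gamma_reg (-1))\<^sup>2" "\<omega> (-\<i>) = 4 / (Gamma_reg (-1))\<^sup>2"
proof -
  have "\<omega> \<i> = 1 / (\<Gamma> (-1) * \<Gamma> (1 / (-1)))"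
    using inverse_Gamma_Gamma[of "-1"] by (simp add: \<omega>_def)
  also have "\<dots> = 4 / (Gamma_reg (-1))\<^sup>2"
    by (simp add: Gamma_conv_reg power2_eq_square)
  finally show "\<omega> \<i> = 4 / (Gamma_reg (-1))\<^sup>2" .
  then show "\<omega> (-\<i>) = 4 / (Gamma_reg (-1))\<^sup>2" by (simp add: \<omega>_def)
qed

lemma Gamma_reg_nonzero:
  assumes "u \<noteq> 0" "norm (p * q) < norm u" "norm (p * u) < 1" "norm (q * u) < 1"
  shows "Gamma_reg u \<noteq> 0"
proof -
  have "norm (p * q / u) < 1" using assms(1,2) by (simp add: norm_divide divide_less_eq)
  then show ?thesis unfolding Gamma_reg_def using norm_p norm_q assms qpoch2_nonzero qpoch_nonzero by simp
qed

text \<open>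
  For \<open>n = 1\<close> the parameters \<open>\<plusminus> \<i> s\<^sup>2\<close> and four times \<open>\<beta> / s\<close> are taken, \<open>\<beta>\<^sup>4 = p q\<close>, and \<open>s\<close> tends to 1, where
  poles approach the circle at \<open>\<plusminus> \<i>\<close>. The function \<open>poisson_density\<close> is the integrand without the
  factors that have these poles.
\<close>

definition poisson_density :: "complex \<Rightarrow> complex \<Rightarrow> complex \<Rightarrow> complex" where
  "poisson_density \<beta> s z = Gamma_reg (\<i> * s\<^sup>2 * z) * Gamma_reg (\<i> * s\<^sup>2 / z) * Gamma_reg (- \<i> * s\<^sup>2 * z) * Gamma_reg (- \<i> * s\<^sup>2 / z) *
     (\<Gamma> (\<beta> / s * z) * \<Gamma> (\<beta> / s / z)) ^ 4 * \<omega> z"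

lemma poisson_density_inverse: "z \<noteq> 0 \<Longrightarrow> poisson_density \<beta> s (1 / z) = poisson_density \<beta> s z"
  by (simp add: poisson_density_def \<omega>_inverse mult_ac)

lemma holomorphic_poisson_density:
  assumes s: "s \<noteq> 0" and \<beta>: "\<beta> \<noteq> 0"
    and A: "\<And>z. z \<in> A \<Longrightarrow> z \<noteq> 0" 
    "\<And>z. z \<in> A \<Longrightarrow> norm (p * s\<^sup>2) * norm z < 1" "\<And>z. z \<in> A \<Longrightarrow> norm (q * s\<^sup>2) * norm z < 1"
    "\<And>z. z \<in> A \<Longrightarrow> norm (p * s\<^sup>2) < norm z" "\<And>z. z \<in> A \<Longrightarrow> norm (q * s\<^sup>2) < norm z"
    "\<And>z. z \<in> A \<Longrightarrow> norm (\<beta> / s) * norm z < 1" "\<And>z. z \<in> A \<Longrightarrow> norm (\<beta> / s) < norm z"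
  shows "poisson_density \<beta> s holomorphic_on A"
  unfolding poisson_density_def using assms
  by (intro holomorphic_intros holomorphic_Gamma_reg holomorphic_Gamma holomorphic_\<omega>)
     (auto simp: norm_mult norm_divide divide_less_eq mult_ac)

text \<open>
  The quotient is computed on the family of parameters \<open>\<plusminus> \<i> s\<^sup>2\<close>, \<open>\<beta> / s\<close>. Both the integral and the value
  have a simple pole at \<open>s = 1\<close>: in the value it is that of \<open>\<Gamma> (s ^ 4)\<close>, in the integral it comes from the poles
  of the integrand that pinch the circle at \<open>\<plusminus>\<i>\<close>. After multiplication with \<open>1 - s ^ 8\<close> both have a limit.
  On the integral side symmetrisation in \<open>y \<mapsto> 1 / y\<close> leaves only poles inside the circle, so that
  the contour can be moved to the radius \<open>R\<close> before \<open>s\<close> tends to 1.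
\<close>

lemma typeI_ratio_one_variable:
  assumes b: "balanced {1..6} b"
  shows "typeI_ratio {1} {1..6} b = 2 * Gamma_reg 1"
proof -
  define C where "C = typeI_ratio {1} {1..6} b"
  define \<beta> where "\<beta> = csqrt (csqrt (p * q))"
  have \<beta>4: "\<beta> ^ 4 = p * q"
  proof -
    have "\<beta> ^ 4 = (\<beta>\<^sup>2)\<^sup>2" by (simp flip: power_mult)
    then show ?thesis by (simp add: \<beta>_def)
  qed
  then have \<beta>0: "\<beta> \<noteq> 0" using p_nz q_nz by auto
  have n\<beta>4: "norm \<beta> ^ 4 = norm (p * q)" using \<beta>4 by (metis norm_power)
  have n\<beta>: "norm \<beta> < 1"
  proof (rule ccontr)
    assume "\<not> norm \<beta> < 1"
    then have "1 \<le> norm \<beta> ^ 4" by (intro one_le_power) auto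
    then show False using n\<beta>4 norm_pq by simp
  qed
  define \<mu>0 where "\<mu>0 = max (norm p) (max (norm q) (norm \<beta>))"
  have "\<mu>0 < 1" using norm_p norm_q n\<beta> by (simp add: \<mu>0_def)
  then obtain \<mu> where \<mu>: "\<mu>0 < \<mu>" "\<mu> < 1" using dense by blast
  have \<mu>le: "norm p < \<mu>" "norm q < \<mu>" "norm \<beta> < \<mu>" using \<mu> by (auto simp: \<mu>0_def)
  have \<mu>0': "0 < \<mu>" using \<mu>le(1) norm_ge_zero[of p] by linarith
  have "1 < 1 / \<mu>" using \<mu> \<mu>0' by simp
  then obtain R where R: "1 < R" "R < 1 / \<mu>" using dense by blast
  have R\<mu>: "R * \<mu> < 1" using R(2) \<mu>0' by (simp add: pos_less_divide_eq)
  \<comment> \<open>\<open>R\<close> is so close to 1 that the circle of radius \<open>R\<close> stays away from the other poles, for \<open>s\<close> near 1.\<close>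
  define R1 where "R1 = complex_of_real R"
  have nR: "norm R1 = R" "R1 \<noteq> 0" using R by (auto simp: R1_def)
  define S where "S = {s::complex. norm s ^ 2 * R * \<mu> < 1 \<and> \<mu> * R < norm s \<and> norm s ^ 2 < R}"
  have openS: "open S" unfolding S_def by (intro open_Collect_conj open_Collect_less continuous_intros)
  have S1: "1 \<in> S" using R R\<mu> by (simp add: S_def mult.commute)
  have S: "s \<noteq> 0" "norm s ^ 2 * R * \<mu> < 1" "\<mu> * R < norm s" "norm s ^ 2 < R" if "s \<in> S" for s
  proof -
    have "0 < \<mu> * R" using \<mu>0' R by simp
    then have "0 < norm s" using that unfolding S_def by (simp only: mem_Collect_eq) linarith
    then show "s \<noteq> 0" by simp
  qed (use that in \<open>auto simp: S_def\<close>)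
  \<comment> \<open>\<open>K s\<close> and, further below, \<open>V s\<close> are \<open>1 - s ^ 8\<close> times the integral and \<open>C\<close> times the value if \<open>s < 1\<close>.\<close>
  define K where "K s = (\<integral>z. poisson_density \<beta> s (R1 * z) * (((R1 * z)\<^sup>2 - s ^ 4) / ((R1 * z)\<^sup>2 + s ^ 4)) \<partial>circ)" for s
  have "K holomorphic_on S"
  proof -
    have "tame_family S circ (\<lambda>s z. Gamma_reg (\<i> * s\<^sup>2 * R1 * z) * Gamma_reg (\<i> * s\<^sup>2 / R1 * (1 / z)) * Gamma_reg (- \<i> * s\<^sup>2 * R1 * z) * Gamma_reg (- \<i> * s\<^sup>2 / R1 * (1 / z)) *
     (\<Gamma> (\<beta> / s * R1 * z) * \<Gamma> (\<beta> / s / R1 * (1 / z))) ^ 4 * \<omega> (R1 * z) * (\<lambda>v. (v\<^sup>2 - 1) / (v\<^sup>2 + 1)) (R1 / s\<^sup>2 * z))"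
    proof (intro tame_family_mult tame_family_power openS)
      let ?D = "{u. u \<noteq> 0 \<and> norm (p * u) < 1 \<and> norm (q * u) < 1}"
      have hD: "Gamma_reg holomorphic_on ?D" by (rule holomorphic_Gamma_reg) auto
      have D: "u \<in> ?D" if "u \<noteq> 0" "norm u * \<mu> < 1" for u
      proof -
        have "norm (p * u) \<le> norm u * \<mu>" "norm (q * u) \<le> norm u * \<mu>"
          using mult_right_mono[of "norm p" \<mu> "norm u"] mult_right_mono[of "norm q" \<mu> "norm u"] \<mu>le by (auto simp: norm_mult mult.commute)
        then show ?thesis using that by auto
      qed
      have ms: "tame_family S circ (\<lambda>s z. Gamma_reg (c s * z))" "tame_family S circ (\<lambda>s z. Gamma_reg (c s * (1 / z)))"
        if "c holomorphic_on S" "\<And>s. s \<in> S \<Longrightarrow> c s \<noteq> 0" "\<And>s. s \<in> S \<Longrightarrow> norm (c s) * \<mu> < 1" for c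
      proof -
        have cD: "c s * v \<in> ?D" if "s \<in> S" "norm v = 1" for s v
          using \<open>s \<in> S\<close> \<open>norm v = 1\<close> that
          by (intro D) (auto simp: norm_mult \<open>\<And>s. s \<in> S \<Longrightarrow> c s \<noteq> 0\<close> \<open>\<And>s. s \<in> S \<Longrightarrow> norm (c s) * \<mu> < 1\<close>)
        show "tame_family S circ (\<lambda>s z. Gamma_reg (c s * z))"
          by (rule tame_family_compose[OF openS hD that(1) cD]) (auto intro!: circ_ident_measurable)
        show "tame_family S circ (\<lambda>s z. Gamma_reg (c s * (1 / z)))"
          by (rule tame_family_compose[OF openS hD that(1) cD]) (auto intro!: borel_measurable_divide simp: norm_divide)
      qed
      have b1: "norm (s\<^sup>2 * R1) * \<mu> < 1" "norm (s\<^sup>2 / R1) * \<mu> < 1" if "s \<in> S" for s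
      proof -
        show *: "norm (s\<^sup>2 * R1) * \<mu> < 1" using S(2)[OF that] nR by (simp add: norm_mult norm_power)
        have "norm (s\<^sup>2 / R1) \<le> norm (s\<^sup>2) / 1" unfolding norm_divide nR using R by (intro divide_left_mono) auto
        also have "\<dots> \<le> norm (s\<^sup>2 * R1)" using R nR mult_left_mono[of 1 R "norm (s\<^sup>2)"] by (simp add: norm_mult)
        finally show "norm (s\<^sup>2 / R1) * \<mu> < 1" using * \<mu>0' by (meson le_less_trans less_imp_le mult_right_mono)
      qed
      show "tame_family S circ (\<lambda>s z. Gamma_reg (\<i> * s\<^sup>2 * R1 * z))"
        using b1 S(1) nR by (intro ms holomorphic_intros) (auto simp: norm_mult norm_divide)
      show "tame_family S circ (\<lambda>s z. Gamma_reg (\<i> * s\<^sup>2 / R1 * (1 / z)))"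
        using b1 S(1) nR by (intro ms holomorphic_intros) (auto simp: norm_mult norm_divide)
      show "tame_family S circ (\<lambda>s z. Gamma_reg (- \<i> * s\<^sup>2 * R1 * z))"
        using b1 S(1) nR by (intro ms holomorphic_intros) (auto simp: norm_mult norm_divide)
      show "tame_family S circ (\<lambda>s z. Gamma_reg (- \<i> * s\<^sup>2 / R1 * (1 / z)))"
        using b1 S(1) nR by (intro ms holomorphic_intros) (auto simp: norm_mult norm_divide)
      have b2: "norm (\<beta> / s * R1) < 1" "norm (\<beta> / s / R1) < 1" if "s \<in> S" for s
      proof -
        have "norm \<beta> * R < \<mu> * R" using \<mu>le R by simp
        then have "norm \<beta> * R < norm s" using S(3)[OF that] by simp
        then show *: "norm (\<beta> / s * R1) < 1" using S(1)[OF that] nR by (simp add: norm_mult norm_divide divide_less_eq)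
        have "norm (\<beta> / s / R1) \<le> norm (\<beta> / s) / 1" unfolding norm_divide[of _ R1] nR using R by (intro divide_left_mono) auto
        also have "\<dots> \<le> norm (\<beta> / s * R1)" unfolding norm_mult nR using R mult_left_mono[of 1 R "norm (\<beta> / s)"] by simp
        finally show "norm (\<beta> / s / R1) < 1" using * by simp
      qed
      show "tame_family S circ (\<lambda>s z. \<Gamma> (\<beta> / s * R1 * z))"
        using b2 S(1) \<beta>0 nR by (intro tame_family_Gamma openS holomorphic_intros) (auto intro!: circ_ident_measurable)
      show "tame_family S circ (\<lambda>s z. \<Gamma> (\<beta> / s / R1 * (1 / z)))"
        using b2 S(1) \<beta>0 nR by (intro tame_family_Gamma openS holomorphic_intros) (auto intro!: borel_measurable_divide simp: norm_divide)
      have "\<omega> holomorphic_on - {0}" by (rule holomorphic_\<omega>) auto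
      then show "tame_family S circ (\<lambda>s z. \<omega> (R1 * z))"
        by (rule tame_family_compose[OF openS, of _ _ "\<lambda>_. R1"]) (use nR in \<open>auto intro!: circ_ident_measurable\<close>)
      have "(\<lambda>v. (v\<^sup>2 - 1) / (v\<^sup>2 + 1)) holomorphic_on {v::complex. 1 < norm v}"
      proof (intro holomorphic_intros)
        fix v :: complex assume v: "v \<in> {v. 1 < norm v}"
        show "v\<^sup>2 + 1 \<noteq> 0"
        proof
          assume "v\<^sup>2 + 1 = 0"
          then have "norm (v\<^sup>2) = 1" by (simp add: add_eq_0_iff2)
          then have "norm v = 1" by (rule norm_square_eq_1)
          then show False using v by simp
        qed
      qed
      then show "tame_family S circ (\<lambda>s z. (\<lambda>v. (v\<^sup>2 - 1) / (v\<^sup>2 + 1)) (R1 / s\<^sup>2 * z))"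
        by (rule tame_family_compose[OF openS, of _ _ "\<lambda>s. R1 / s\<^sup>2"])
           (use S nR in \<open>auto simp: norm_mult norm_divide norm_power intro!: circ_ident_measurable holomorphic_intros\<close>)
    qed
    from tame_family_holomorphic_integral[OF circ.finite_measure_axioms openS this]
    show ?thesis
    proof (rule holomorphic_transform)
      fix s assume s: "s \<in> S"
      show "(\<integral>z. Gamma_reg (\<i> * s\<^sup>2 * R1 * z) * Gamma_reg (\<i> * s\<^sup>2 / R1 * (1 / z)) * Gamma_reg (- \<i> * s\<^sup>2 * R1 * z) * Gamma_reg (- \<i> * s\<^sup>2 / R1 * (1 / z)) *
     (\<Gamma> (\<beta> / s * R1 * z) * \<Gamma> (\<beta> / s / R1 * (1 / z))) ^ 4 * \<omega> (R1 * z) * (((R1 / s\<^sup>2 * z)\<^sup>2 - 1) / ((R1 / s\<^sup>2 * z)\<^sup>2 + 1)) \<partial>circ) = K s"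
        unfolding K_def
      proof (intro Bochner_Integration.integral_cong refl)
        fix z
        have "((R1 / s\<^sup>2 * z)\<^sup>2 - 1) / ((R1 / s\<^sup>2 * z)\<^sup>2 + 1) = (((R1 * z)\<^sup>2 - s ^ 4) / s ^ 4) / (((R1 * z)\<^sup>2 + s ^ 4) / s ^ 4)"
          using S(1)[OF s] by (simp add: diff_divide_distrib add_divide_distrib power_mult_distrib power_divide flip: power_mult)
        also have "\<dots> = ((R1 * z)\<^sup>2 - s ^ 4) / ((R1 * z)\<^sup>2 + s ^ 4)" using S(1)[OF s] by simp
        finally show "Gamma_reg (\<i> * s\<^sup>2 * R1 * z) * Gamma_reg (\<i> * s\<^sup>2 / R1 * (1 / z)) * Gamma_reg (- \<i> * s\<^sup>2 * R1 * z) * Gamma_reg (- \<i> * s\<^sup>2 / R1 * (1 / z)) *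
     (\<Gamma> (\<beta> / s * R1 * z) * \<Gamma> (\<beta> / s / R1 * (1 / z))) ^ 4 * \<omega> (R1 * z) * (((R1 / s\<^sup>2 * z)\<^sup>2 - 1) / ((R1 / s\<^sup>2 * z)\<^sup>2 + 1)) =
     poisson_density \<beta> s (R1 * z) * (((R1 * z)\<^sup>2 - s ^ 4) / ((R1 * z)\<^sup>2 + s ^ 4))"
          by (simp add: poisson_density_def mult.assoc)
      qed
    qed
  qed
  then have "isCont K 1" using openS S1 by (metis continuous_on_eq_continuous_at holomorphic_on_imp_continuous_on)
  then have lim1: "((\<lambda>s. K (of_real s)) \<longlongrightarrow> K 1) (at_left (1::real))"
    by (intro isCont_tendsto_compose[of "1::complex" K]) (auto intro!: tendsto_eq_intros)
  define V where "V s = C * (1 + s ^ 4) * Gamma_reg (s ^ 4) * (\<Gamma> (\<i> * s * \<beta>) * \<Gamma> (- \<i> * s * \<beta>)) ^ 4 * \<Gamma> (\<beta>\<^sup>2 / s\<^sup>2) ^ 6" for s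
  have "isCont V 1"
  proof -
    define T where "T = {s::complex. norm \<beta> < norm s \<and> norm p * norm s ^ 4 < 1 \<and> norm q * norm s ^ 4 < 1 \<and> norm \<beta> * norm s < 1}"
    have "open T" unfolding T_def by (intro open_Collect_conj open_Collect_less continuous_intros)
    moreover have "1 \<in> T" using norm_p norm_q n\<beta> by (simp add: T_def)
    moreover have T: "s \<noteq> 0" "norm (\<beta>\<^sup>2 / s\<^sup>2) < 1" if "s \<in> T" for s
    proof -
      show s0: "s \<noteq> 0" using that by (auto simp: T_def)
      have "norm \<beta> ^ 2 < norm s ^ 2" using that by (intro power_strict_mono) (auto simp: T_def)
      then show "norm (\<beta>\<^sup>2 / s\<^sup>2) < 1" using s0 by (simp add: norm_divide norm_power divide_less_eq)
    qed
    then have "V holomorphic_on T"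
      unfolding V_def using \<beta>0 by (intro holomorphic_intros holomorphic_Gamma_reg holomorphic_Gamma)
        (auto simp: T_def norm_mult norm_power mult_ac)
    ultimately show ?thesis by (metis continuous_on_eq_continuous_at holomorphic_on_imp_continuous_on)
  qed
  then have lim2: "((\<lambda>s. V (of_real s)) \<longlongrightarrow> V 1) (at_left (1::real))"
    by (intro isCont_tendsto_compose[of "1::complex" V]) (auto intro!: tendsto_eq_intros)
  have KV: "K (of_real r) = V (of_real r)" if r: "\<mu> * R < r" "r < 1" for r
  proof -
    have r0: "0 < r" using r(1) \<mu>0' R mult_pos_pos[of \<mu> R] by linarith
    define s where "s = complex_of_real r"
    have ns: "norm s = r" "s \<noteq> 0" using r0 by (auto simp: s_def)
    have r2: "r ^ 2 < 1" using r0 r by (simp add: power_less_one_iff abs_square_less_1)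
    have \<mu>r: "\<mu> < r"
    proof -
      have "\<mu> * 1 \<le> \<mu> * R" using \<mu>0' R by (intro mult_left_mono) auto
      then show ?thesis using r by linarith
    qed
    define c where "c = (\<lambda>m::nat. if m = 1 then \<i> * s\<^sup>2 else if m = 2 then - \<i> * s\<^sup>2 else \<beta> / s)"
    have cn: "norm (\<i> * s\<^sup>2) < 1" "norm (\<beta> / s) < 1"
      using ns r2 \<mu>r \<mu>le r0 by (auto simp: norm_mult norm_power norm_divide)
    have ii: "\<i> * a * (- \<i> * a) = a * a" for a
      by (simp add: mult.assoc mult.left_commute[of a \<i>])
    have bal: "balanced {1..6} c"
    proof -
      have "(\<Prod>m=1..6. c m) = \<i> * s\<^sup>2 * (- \<i> * s\<^sup>2) * (\<beta> / s) ^ 4"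
        unfolding prod_1_6 by (simp add: c_def power4_eq_xxxx)
      also have "\<dots> = \<beta> ^ 4 * (s\<^sup>2 * s\<^sup>2 / s ^ 4)" unfolding ii by (simp add: power_divide)
      also have "s\<^sup>2 * s\<^sup>2 / s ^ 4 = 1" using ns(2) by (simp add: power2_eq_square power4_eq_xxxx)
      finally show ?thesis using cn ns \<beta>0 by (auto simp: balanced_def \<beta>4 c_def norm_mult)
    qed
    have ratio: "typeI_integral {1} {1..6} c = C * typeI_value {1..6} c"
    proof -
      have "typeI_ratio {1} {1..6} c = C" unfolding C_def using bal b by (intro typeI_ratio_const) auto
      moreover have "typeI_value {1..6} c \<noteq> 0" using bal by (intro typeI_value_nonzero) auto
      ultimately show ?thesis by (simp add: typeI_ratio_def field_simps)
    qed
    have s4: "1 - s ^ 4 \<noteq> 0"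
    proof
      assume "1 - s ^ 4 = 0"
      then have "norm ((s\<^sup>2)\<^sup>2) = 1" by (simp flip: power_mult)
      then have "norm (s\<^sup>2) = 1" by (rule norm_square_eq_1)
      then have "norm s = 1" by (rule norm_square_eq_1)
      then show False using ns r by simp
    qed
    have val: "(1 - s ^ 4) * (1 + s ^ 4) * (C * typeI_value {1..6} c) = V s"
    proof -
      have e: "\<i> * s\<^sup>2 * (- \<i> * s\<^sup>2) = s ^ 4" unfolding ii by (simp flip: power_add)
      have e2: "\<i> * s\<^sup>2 * (\<beta> / s) = \<i> * s * \<beta>" "- \<i> * s\<^sup>2 * (\<beta> / s) = - \<i> * s * \<beta>" using ns(2) by (simp_all add: power2_eq_square)
      have e3: "\<beta> / s * (\<beta> / s) = \<beta>\<^sup>2 / s\<^sup>2" by (simp add: power2_eq_square)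
      have "typeI_value {1..6} c = \<Gamma> (s ^ 4) * (\<Gamma> (\<i> * s * \<beta>) * \<Gamma> (- \<i> * s * \<beta>)) ^ 4 * \<Gamma> (\<beta>\<^sup>2 / s\<^sup>2) ^ 6"
      proof -
        have alg: "(g * a * a * a * a) * (b * b * b * b) * (d * d * d) * (d * d) * d = g * (a * b) ^ 4 * d ^ 6" for g a b d :: complex
          by (simp add: eval_nat_numeral mult_ac)
        have cs: "c 1 = \<i> * s\<^sup>2" "c 2 = - \<i> * s\<^sup>2" "c 3 = \<beta> / s" "c 4 = \<beta> / s" "c 5 = \<beta> / s" "c 6 = \<beta> / s"
          by (simp_all add: c_def)
        show ?thesis unfolding typeI_value_def pair_prod_1_6 cs e e2 e3 by (rule alg)
      qed
      then show ?thesis using s4 by (simp add: V_def Gamma_conv_reg[of "s ^ 4"])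
    qed
    have int1: "typeI_integral {1} {1..6} c = (\<integral>y. params {1..6} c y * \<omega> y \<partial>circ)"
    proof -
      have m: "(\<lambda>y. params {1..6} c y * \<omega> y) \<in> borel_measurable circ"
      proof -
        have "tame circ (\<lambda>y. params {1..6} c y * \<omega> y)"
          using balancedD(1,2)[OF bal] by (intro tame_intros tame_family_params) (auto intro!: circ_ident_measurable)
        then show ?thesis by (rule tame_measurable)
      qed
      have w: "typeI_weight {1} {1..6} c = (\<lambda>z. params {1..6} c (z 1) * \<omega> (z 1))"
        by (simp add: typeI_weight_def fun_eq_iff)
      show ?thesis
        unfolding typeI_integral_def w by (rule circs.product_integral_singleton[OF m])
    qed
    define \<psi> where "\<psi> z = poisson_density \<beta> s z * ((z\<^sup>2 - s ^ 4) / (z\<^sup>2 + s ^ 4))" for z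
    define U where "U = {z::complex. max (r ^ 2) (\<mu> / r) < norm z \<and> norm z < r / \<mu>}"
    have openU: "open U" unfolding U_def by (intro open_Collect_conj open_Collect_less continuous_intros)
    have connU: "connected U" unfolding U_def using connected_annulus(1)[of "max (r ^ 2) (\<mu> / r)" "0::complex" "r / \<mu>"] by simp
    have rotU: "c * z \<in> U" if "c \<in> U" "norm z = 1" for c z using that by (auto simp: U_def norm_mult)
    have U1: "1 \<in> U" "R1 \<in> U"
    proof -
      have a: "\<mu> / r < 1" using \<mu>r r0 by simp
      have b: "R < r / \<mu>" using r(1) \<mu>0' by (simp add: pos_less_divide_eq mult.commute)
      show "R1 \<in> U" using a b r2 R nR by (simp add: U_def)
      show "1 \<in> U" using a b r2 R by (simp add: U_def)
    qed
    have U0: "z \<noteq> 0" if "z \<in> U" for z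
    proof -
      have "r ^ 2 < norm z" using that by (simp add: U_def)
      moreover have "0 < r ^ 2" using r0 by simp
      ultimately have "0 < norm z" by linarith
      then show ?thesis by simp
    qed
    have U2: "z\<^sup>2 + s ^ 4 \<noteq> 0" if "z \<in> U" for z
    proof
      assume "z\<^sup>2 + s ^ 4 = 0"
      then have "norm (z\<^sup>2) = norm (s ^ 4)" by (metis add_eq_0_iff norm_minus_cancel)
      then have "norm z ^ 2 = (r ^ 2) ^ 2" using ns by (simp add: norm_power flip: power_mult)
      moreover have "r ^ 2 < norm z" using that by (simp add: U_def)
      then have "(r ^ 2) ^ 2 < norm z ^ 2" by (intro power_strict_mono) auto
      ultimately show False by simp
    qed
    have hol\<psi>: "\<psi> holomorphic_on U"
    proof -
      have z: "\<mu> < r * norm z" "\<mu> * norm z < r" if "z \<in> U" for z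
        using that r0 \<mu>0' by (auto simp: U_def field_simps)
      have "poisson_density \<beta> s holomorphic_on U"
      proof (rule holomorphic_poisson_density[OF ns(2) \<beta>0 U0])
        fix z assume zU: "z \<in> U"
        have r1: "r ^ 2 * t \<le> t" if "t \<ge> 0" for t using r2 that by (simp add: mult_left_le_one_le)
        have zz: "norm z * \<mu> < 1" "\<mu> < norm z"
        proof -
          show "norm z * \<mu> < 1" using z(2)[OF zU] r by (simp add: mult.commute)
          have "r * norm z \<le> norm z" using r r0 by (simp add: mult_left_le_one_le)
          then show "\<mu> < norm z" using z(1)[OF zU] by linarith
        qed
        have lt: "norm w * norm (s\<^sup>2) < \<mu>" if "norm w < \<mu>" for w :: complex
          using r1[of "norm w"] that ns by (simp add: norm_power mult.commute)
        have le: "norm (w * s\<^sup>2) * norm z < 1" if "norm w < \<mu>" for w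
        proof -
          have "norm (w * s\<^sup>2) * norm z \<le> \<mu> * norm z"
            unfolding norm_mult using lt[OF that] by (intro mult_right_mono) auto
          then show ?thesis using zz by (simp add: mult.commute)
        qed
        show "norm (p * s\<^sup>2) * norm z < 1" "norm (q * s\<^sup>2) * norm z < 1" using le \<mu>le by auto
        show "norm (p * s\<^sup>2) < norm z" "norm (q * s\<^sup>2) < norm z"
          using lt[OF \<mu>le(1)] lt[OF \<mu>le(2)] zz by (auto simp: norm_mult)
        have "norm \<beta> * norm z \<le> \<mu> * norm z" using \<mu>le by (intro mult_right_mono) auto
        then show "norm (\<beta> / s) * norm z < 1" using z(2)[OF zU] r0 ns by (simp add: norm_divide)
        show "norm (\<beta> / s) < norm z" using z(1)[OF zU] \<mu>le r0 ns by (simp add: norm_divide divide_less_eq mult.commute)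
      qed
      then show ?thesis unfolding \<psi>_def using U2 by (intro holomorphic_intros) auto
    qed
    have subU: "sphere 0 1 \<subseteq> U" using rotU[OF U1(1)] by auto
    have tame\<psi>: "tame circ \<psi>" "tame circ (\<lambda>z. \<psi> (1 / z))"
      using subU by (auto intro!: tame_family_unit_circle[OF _ hol\<psi>] borel_measurable_divide simp: norm_divide)
    \<comment> \<open>\<open>\<psi> y + \<psi> (1 / y)\<close> is \<open>2 * (1 - s ^ 8)\<close> times the integrand, and the poles of \<open>\<psi>\<close> near the circle lie inside.\<close>
    have "(1 - s ^ 4) * (1 + s ^ 4) * (2 * (\<integral>y. params {1..6} c y * \<omega> y \<partial>circ)) = (\<integral>y. \<psi> y + \<psi> (1 / y) \<partial>circ)"
      unfolding integral_mult_right_zero[symmetric] mult.assoc[symmetric]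
    proof (intro Bochner_Integration.integral_cong refl)
      fix y assume "y \<in> space circ"
      then have y: "norm y = 1" "y \<noteq> 0" by auto
      have yU: "y \<in> U" "1 / y \<in> U" using subU y by (auto simp: norm_divide)
      have n1: "1 + s ^ 4 * y\<^sup>2 \<noteq> 0" "1 + s ^ 4 / y\<^sup>2 \<noteq> 0"
      proof -
        have "(1 / y)\<^sup>2 + s ^ 4 = (1 + s ^ 4 * y\<^sup>2) / y\<^sup>2" "y\<^sup>2 + s ^ 4 = (1 + s ^ 4 / y\<^sup>2) * y\<^sup>2" using y by (simp_all add: field_simps)
        then show "1 + s ^ 4 * y\<^sup>2 \<noteq> 0" "1 + s ^ 4 / y\<^sup>2 \<noteq> 0" using U2[OF yU(1)] U2[OF yU(2)] by auto
      qed
      have G: "\<Gamma> (\<i> * s\<^sup>2 * v) * \<Gamma> (- \<i> * s\<^sup>2 * v) = Gamma_reg (\<i> * s\<^sup>2 * v) * Gamma_reg (- \<i> * s\<^sup>2 * v) / (1 + s ^ 4 * v\<^sup>2)" for v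
      proof -
        have "(1 - \<i> * s\<^sup>2 * v) * (1 - - \<i> * s\<^sup>2 * v) = 1 + s ^ 4 * v\<^sup>2" by (simp add: algebra_simps power2_eq_square power4_eq_xxxx)
        then show ?thesis unfolding Gamma_conv_reg times_divide_times_eq by simp
      qed
      have "params {1..6} c y = (\<Gamma> (\<i> * s\<^sup>2 * y) * \<Gamma> (- \<i> * s\<^sup>2 * y)) * (\<Gamma> (\<i> * s\<^sup>2 * (1 / y)) * \<Gamma> (- \<i> * s\<^sup>2 * (1 / y))) * (\<Gamma> (\<beta> / s * y) * \<Gamma> (\<beta> / s / y)) ^ 4"
      proof -
        have alg: "(a * a') * (d * d') * (x * v) * (x * v) * (x * v) * (x * v) = (a * d) * (a' * d') * (x * v) ^ 4" for a a' d d' x v :: complex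
          by (simp add: power4_eq_xxxx mult_ac)
        have cs: "c 1 = \<i> * s\<^sup>2" "c 2 = - \<i> * s\<^sup>2" "c 3 = \<beta> / s" "c 4 = \<beta> / s" "c 5 = \<beta> / s" "c 6 = \<beta> / s" "\<i> * s\<^sup>2 / y = \<i> * s\<^sup>2 * (1 / y)" "- \<i> * s\<^sup>2 / y = - \<i> * s\<^sup>2 * (1 / y)"
          by (simp_all add: c_def)
        show ?thesis unfolding params_def prod_1_6 cs by (rule alg)
      qed
      then have w: "params {1..6} c y * \<omega> y = poisson_density \<beta> s y / ((1 + s ^ 4 * y\<^sup>2) * (1 + s ^ 4 / y\<^sup>2))"
        unfolding G poisson_density_def by (simp add: power_divide mult_ac)
      have k1: "(y\<^sup>2 - s ^ 4) / (y\<^sup>2 + s ^ 4) = (1 - s ^ 4 / y\<^sup>2) / (1 + s ^ 4 / y\<^sup>2)"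
      proof -
        have "1 - s ^ 4 / y\<^sup>2 = (y\<^sup>2 - s ^ 4) / y\<^sup>2" "1 + s ^ 4 / y\<^sup>2 = (y\<^sup>2 + s ^ 4) / y\<^sup>2" using y by (simp_all add: field_simps)
        then show ?thesis using y by simp
      qed
      have k2: "((1 / y)\<^sup>2 - s ^ 4) / ((1 / y)\<^sup>2 + s ^ 4) = (1 - s ^ 4 * y\<^sup>2) / (1 + s ^ 4 * y\<^sup>2)"
      proof -
        have "(1 / y)\<^sup>2 - s ^ 4 = (1 - s ^ 4 * y\<^sup>2) / y\<^sup>2" "(1 / y)\<^sup>2 + s ^ 4 = (1 + s ^ 4 * y\<^sup>2) / y\<^sup>2" using y by (simp_all add: field_simps)
        then show ?thesis using y by simp
      qed
      have k3: "(1 - u) / (1 + u) + (1 - v) / (1 + v) = 2 * (1 - u * v) / ((1 + v) * (1 + u))" if "1 + u \<noteq> 0" "1 + v \<noteq> 0" for u v :: complex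
        using that by (simp add: field_simps)
      have "\<psi> y + \<psi> (1 / y) = poisson_density \<beta> s y * ((1 - s ^ 4 / y\<^sup>2) / (1 + s ^ 4 / y\<^sup>2) + (1 - s ^ 4 * y\<^sup>2) / (1 + s ^ 4 * y\<^sup>2))"
        unfolding \<psi>_def k1 k2 poisson_density_inverse[OF y(2)] by (simp only: distrib_left)
      also have "\<dots> = poisson_density \<beta> s y * (2 * (1 - s ^ 4 * s ^ 4) / ((1 + s ^ 4 * y\<^sup>2) * (1 + s ^ 4 / y\<^sup>2)))"
        unfolding k3[OF n1(2,1)] using y by simp
      also have "\<dots> = (1 - s ^ 4) * (1 + s ^ 4) * 2 * (params {1..6} c y * \<omega> y)"
      proof -
        have "(1 - s ^ 4) * (1 + s ^ 4) = 1 - s ^ 4 * s ^ 4" by (simp add: algebra_simps)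
        then show ?thesis unfolding w by simp
      qed
      finally show "(1 - s ^ 4) * (1 + s ^ 4) * 2 * params {1..6} c y * \<omega> y = \<psi> y + \<psi> (1 / y)" by (simp add: mult.assoc)
    qed
    also have "\<dots> = (\<integral>y. \<psi> y \<partial>circ) + (\<integral>y. \<psi> (1 / y) \<partial>circ)"
      using tame\<psi> by (intro Bochner_Integration.integral_add tame_integrable circ.finite_measure_axioms)
    also have "(\<integral>y. \<psi> (1 / y) \<partial>circ) = (\<integral>y. \<psi> y \<partial>circ)"
      by (rule integral_circ_inverse[OF tame_measurable[OF tame\<psi>(1)]])
    finally have "(1 - s ^ 4) * (1 + s ^ 4) * (\<integral>y. params {1..6} c y * \<omega> y \<partial>circ) = (\<integral>y. \<psi> y \<partial>circ)" by (simp add: mult.assoc)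
    also have "\<dots> = K s"
      using integral_circ_scale[OF openU connU hol\<psi> rotU U1] by (simp add: K_def \<psi>_def)
    finally show ?thesis unfolding s_def[symmetric] val[symmetric] ratio[symmetric] int1 by simp
  qed
  have "\<forall>\<^sub>F r in at_left (1::real). K (of_real r) = V (of_real r)"
    using eventually_at_left_real[of "\<mu> * R" "1::real"] R\<mu> KV by (auto simp: mult.commute elim!: eventually_mono)
  then have "((\<lambda>s. K (of_real s)) \<longlongrightarrow> V 1) (at_left (1::real))" using lim2 by (simp add: tendsto_cong)
  then have "K 1 = V 1" using lim1 by (intro tendsto_unique[OF _ lim1]) auto
  define g where "g = (\<Gamma> (\<i> * \<beta>) * \<Gamma> (- \<i> * \<beta>)) ^ 4"
  have m1: "Gamma_reg (-1) \<noteq> 0" using norm_p norm_q norm_pq by (intro Gamma_reg_nonzero) auto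
  have "K 1 = 4 * (Gamma_reg 1)\<^sup>2 * g"
  proof -
    have "(\<integral>z. poisson_density \<beta> 1 (of_real R * z) * (((of_real R * z)\<^sup>2 - 1) / ((of_real R * z)\<^sup>2 + 1)) \<partial>circ) = 4 * (Gamma_reg 1)\<^sup>2 * g"
    proof (rule integral_circ_pole_average[OF R(1) R(2)])
      have z: "\<mu> < norm z" "norm z * \<mu> < 1" if "z \<in> {z. 1 / (1 / \<mu>) < norm z \<and> norm z < 1 / \<mu>}" for z :: complex
        using that \<mu>0' by (auto simp: pos_less_divide_eq)
      have le: "norm w * norm z \<le> norm z * \<mu>" if "norm w < \<mu>" for w z :: complex
        using that by (subst mult.commute) (intro mult_left_mono, auto)
      show "poisson_density \<beta> 1 holomorphic_on {z. 1 / (1 / \<mu>) < norm z \<and> norm z < 1 / \<mu>}"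
      proof (rule holomorphic_poisson_density[OF _ \<beta>0])
        fix x :: complex assume x: "x \<in> {z. 1 / (1 / \<mu>) < norm z \<and> norm z < 1 / \<mu>}"
        note zx = z[OF x] le[OF \<mu>le(1), of x] le[OF \<mu>le(2), of x] le[OF \<mu>le(3), of x]
        show "x \<noteq> 0" using zx(1) \<mu>0' by auto
        show "norm (p * 1\<^sup>2) * norm x < 1" "norm (q * 1\<^sup>2) * norm x < 1" "norm (\<beta> / 1) * norm x < 1"
          using zx by simp_all
        show "norm (p * 1\<^sup>2) < norm x" "norm (q * 1\<^sup>2) < norm x" "norm (\<beta> / 1) < norm x"
          using zx(1) \<mu>le by simp_all
      qed simp
      show "poisson_density \<beta> 1 (1 / z) = poisson_density \<beta> 1 z" if "z \<noteq> 0" for z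
        by (rule poisson_density_inverse[OF that])
      show "poisson_density \<beta> 1 \<i> = 4 * (Gamma_reg 1)\<^sup>2 * g" "poisson_density \<beta> 1 (- \<i>) = 4 * (Gamma_reg 1)\<^sup>2 * g"
      proof -
        have alg: "m \<noteq> 0 \<Longrightarrow> m * h * h * m * x * (4 / m\<^sup>2) = 4 * h\<^sup>2 * x" "m \<noteq> 0 \<Longrightarrow> h * m * m * h * x * (4 / m\<^sup>2) = 4 * h\<^sup>2 * x" for m h x :: complex
          by (simp_all add: power2_eq_square)
        have a: "\<i> * 1\<^sup>2 * \<i> = -1" "\<i> * 1\<^sup>2 / \<i> = 1" "- \<i> * 1\<^sup>2 * \<i> = 1" "- \<i> * 1\<^sup>2 / \<i> = -1"
          "\<i> * 1\<^sup>2 * (- \<i>) = 1" "\<i> * 1\<^sup>2 / (- \<i>) = -1" "- \<i> * 1\<^sup>2 * (- \<i>) = -1" "- \<i> * 1\<^sup>2 / (- \<i>) = 1"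
          "\<beta> / 1 * \<i> = \<i> * \<beta>" "\<beta> / 1 / \<i> = - \<i> * \<beta>" "\<beta> / 1 * (- \<i>) = - \<i> * \<beta>" "\<beta> / 1 / (- \<i>) = \<i> * \<beta>"
          by (simp_all add: divide_eq_eq)
        have g': "g = (\<Gamma> (- \<i> * \<beta>) * \<Gamma> (\<i> * \<beta>)) ^ 4" by (simp add: g_def mult.commute)
        show "poisson_density \<beta> 1 \<i> = 4 * (Gamma_reg 1)\<^sup>2 * g"
          unfolding poisson_density_def a \<omega>_at_i g_def by (rule alg(1)[OF m1])
        show "poisson_density \<beta> 1 (- \<i>) = 4 * (Gamma_reg 1)\<^sup>2 * g"
          unfolding poisson_density_def a \<omega>_at_i g' by (rule alg(2)[OF m1])
      qed
    qed
    then show ?thesis by (simp add: K_def R1_def)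
  qed
  moreover have "V 1 = C * 2 * Gamma_reg 1 * g"
  proof -
    have "\<Gamma> (\<beta>\<^sup>2) * \<Gamma> (p * q / \<beta>\<^sup>2) = 1"
    proof (rule Gamma_reflect)
      have b2: "norm (\<beta>\<^sup>2) < 1" using n\<beta> by (simp add: norm_power power_less_one_iff abs_square_less_1)
      then show "norm (\<beta>\<^sup>2) < 1" .
      have "norm (p * q) = norm (\<beta>\<^sup>2) * norm (\<beta>\<^sup>2)" unfolding norm_power using n\<beta>4 by (simp flip: power_add)
      also have "\<dots> < norm (\<beta>\<^sup>2) * 1" using b2 \<beta>0 by (intro mult_strict_left_mono) auto
      finally show "norm (p * q) < norm (\<beta>\<^sup>2)" by simp
    qed (use \<beta>0 in auto)
    moreover have "p * q / \<beta>\<^sup>2 = \<beta>\<^sup>2" using \<beta>4 \<beta>0 by (simp add: power2_eq_square power4_eq_xxxx field_simps)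
    ultimately have "\<Gamma> (\<beta>\<^sup>2) ^ 2 = 1" by (simp add: power2_eq_square)
    moreover have "\<Gamma> (\<beta>\<^sup>2) ^ 6 = (\<Gamma> (\<beta>\<^sup>2) ^ 2) ^ 3" by (simp flip: power_mult)
    ultimately have "\<Gamma> (\<beta>\<^sup>2) ^ 6 = 1" by simp
    then show ?thesis by (simp add: V_def g_def)
  qed
  moreover have "g \<noteq> 0"
  proof -
    have "norm (p * q) < norm \<beta>"
    proof -
      have "norm (p * q) = norm \<beta> * norm \<beta> ^ 3" using n\<beta>4 by (simp add: power4_eq_xxxx power3_eq_cube mult_ac)
      also have "\<dots> < norm \<beta> * 1"
        using n\<beta> \<beta>0 power_Suc_less_one[of "norm \<beta>" 2] by (intro mult_strict_left_mono) (simp_all add: eval_nat_numeral)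
      finally show ?thesis by simp
    qed
    then have "\<Gamma> (\<i> * \<beta>) \<noteq> 0" "\<Gamma> (- \<i> * \<beta>) \<noteq> 0" using n\<beta> by (intro Gamma_nonzero; simp add: norm_mult)+
    then show ?thesis by (simp add: g_def)
  qed
  ultimately have "C = 2 * Gamma_reg 1"
    using \<open>K 1 = V 1\<close> Gamma_reg_1_nonzero by (simp add: power2_eq_square)
  then show ?thesis by (simp add: C_def)
qed

end

section \<open>The integral of type II\<close>

text \<open>
  Appending the pairs \<open>\<tau> u\<^sub>k, \<tau> / u\<^sub>k\<close> to the parameters \<open>c\<^sub>1, \<dots>, c\<^sub>e\<close> makes the interaction
  \<open>\<Gamma>(\<tau> z\<^sub>i\<^sup>\<plusminus>\<^sup>1 u\<^sub>k\<^sup>\<plusminus>\<^sup>1)\<close> with other variables \<open>u\<^sub>k\<close> a part of an integrand of type I.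
\<close>

definition with_pairs :: "nat \<Rightarrow> (nat \<Rightarrow> complex) \<Rightarrow> complex \<Rightarrow> (nat \<Rightarrow> complex) \<Rightarrow> nat \<Rightarrow> complex" where
  "with_pairs e c \<tau> u m = (if m \<le> e then c m else if odd (m - e) then \<tau> * u ((m - e + 1) div 2) else \<tau> / u ((m - e) div 2))"

lemma with_pairs_simps:
  "m \<le> e \<Longrightarrow> with_pairs e c \<tau> u m = c m"
  "with_pairs e c \<tau> u (Suc (e + 2 * N)) = \<tau> * u (Suc N)"
  "with_pairs e c \<tau> u (Suc (Suc (e + 2 * N))) = \<tau> / u (Suc N)"
proof -
  have "Suc (e + 2 * N) - e = 2 * N + 1" "Suc (Suc (e + 2 * N)) - e = 2 * (N + 1)" by auto
  then show "with_pairs e c \<tau> u (Suc (e + 2 * N)) = \<tau> * u (Suc N)"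
    "with_pairs e c \<tau> u (Suc (Suc (e + 2 * N))) = \<tau> / u (Suc N)"
    by (simp_all add: with_pairs_def)
qed (simp add: with_pairs_def)

lemma atLeastAtMost_Suc_Suc: "{1..e + 2 * Suc N} = insert (Suc (Suc (e + 2 * N))) (insert (Suc (e + 2 * N)) {1..e + 2 * N})"
  by auto

lemma prod_with_pairs:
  fixes f :: "complex \<Rightarrow> complex"
  shows "(\<Prod>m\<in>{1..e + 2 * N}. f (with_pairs e c \<tau> u m)) = (\<Prod>m\<in>{1..e}. f (c m)) * (\<Prod>k\<in>{1..N}. f (\<tau> * u k) * f (\<tau> / u k))"
proof (induction N)
  case 0
  then show ?case by (simp add: with_pairs_simps)
next
  case (Suc N)
  have "(\<Prod>m\<in>{1..e + 2 * Suc N}. f (with_pairs e c \<tau> u m)) = f (\<tau> / u (Suc N)) * (f (\<tau> * u (Suc N)) * (\<Prod>m\<in>{1..e + 2 * N}. f (with_pairs e c \<tau> u m)))"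
    unfolding atLeastAtMost_Suc_Suc by (simp add: with_pairs_simps)
  then show ?case unfolding Suc by (simp add: mult_ac)
qed

lemma with_pairs_cases:
  assumes "m \<in> {1..e + 2 * N}"
  obtains "m \<in> {1..e}" "with_pairs e c \<tau> u m = c m" | k where "k \<in> {1..N}" "with_pairs e c \<tau> u m = \<tau> * u k"
    | k where "k \<in> {1..N}" "with_pairs e c \<tau> u m = \<tau> / u k"
proof -
  consider "m \<le> e" | "m > e" "odd (m - e)" | "m > e" "even (m - e)" by linarith
  then show ?thesis
  proof cases
    case 1
    then show ?thesis using assms by (intro that(1)) (auto simp: with_pairs_def)
  next
    case 2
    then have "with_pairs e c \<tau> u m = \<tau> * u ((m - e + 1) div 2)" by (simp add: with_pairs_def)
    moreover have "(m - e + 1) div 2 \<in> {1..N}"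
    proof -
      obtain k where k: "m - e = 2 * k + 1" using 2(2) by (rule oddE)
      then have "m = e + 2 * k + 1" using 2(1) by simp
      then show ?thesis using assms unfolding k by simp
    qed
    ultimately show ?thesis by (intro that(2))
  next
    case 3
    then have "with_pairs e c \<tau> u m = \<tau> / u ((m - e) div 2)" by (simp add: with_pairs_def)
    moreover have "(m - e) div 2 \<in> {1..N}"
    proof -
      obtain k where k: "m - e = 2 * k" using 3(2) by (rule evenE)
      then have "m = e + 2 * k" using 3(1) by simp
      then show ?thesis using 3(1) assms unfolding k by simp
    qed
    ultimately show ?thesis by (intro that(3))
  qed
qed

context elliptic_bases
begin

abbreviation \<Gamma>pp :: "complex \<Rightarrow> complex \<Rightarrow> complex \<Rightarrow> complex" where
  "\<Gamma>pp t z w \<equiv> ell_gamma_pm_pm t z w p q"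

lemma \<Gamma>pp_sym: "\<Gamma>pp t z w = \<Gamma>pp t w z"
  by (simp add: ell_gamma_pm_pm_def mult_ac)

lemma params_with_pairs:
  "params {1..e + 2 * N} (with_pairs e c \<tau> u) y = params {1..e} c y * (\<Prod>k\<in>{1..N}. \<Gamma>pp \<tau> y (u k))"
  unfolding params_def prod_with_pairs[where f = "\<lambda>v. \<Gamma> (v * y) * \<Gamma> (v / y)"]
  by (simp add: ell_gamma_pm_pm_def mult_ac)

text \<open>
  The products \<open>b\<^sub>m b\<^sub>k\<close> of two parameters from different pairs give the interaction \<open>\<Gamma>(t z\<^sub>j\<^sup>\<plusminus>\<^sup>1 z\<^sub>k\<^sup>\<plusminus>\<^sup>1)\<close> of type II with
  \<open>t = \<tau>\<^sup>2\<close>, and those of the two members of one pair give \<open>\<Gamma>(t)\<close>.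
\<close>

lemma typeI_value_with_pairs:
  assumes u: "\<And>k. k \<in> {1..N} \<Longrightarrow> u k \<noteq> 0"
  shows "typeI_value {1..e + 2 * N} (with_pairs e c \<tau> u) =
    typeI_value {1..e} c * (\<Prod>k\<in>{1..N}. params {1..e} (\<lambda>m. \<tau> * c m) (u k)) * \<Gamma> (\<tau>\<^sup>2) ^ N *
    pair_prod (\<lambda>j k. \<Gamma>pp (\<tau>\<^sup>2) (u j) (u k)) {1..N}"
  using u
proof (induction N)
  case 0
  have "typeI_value {1..e + 2 * 0} (with_pairs e c \<tau> u) = typeI_value {1..e} c"
    unfolding typeI_value_def by (simp, intro pair_prod_cong) (auto simp: with_pairs_simps)
  then show ?case by simp
next
  case (Suc N)
  let ?w = "with_pairs e c \<tau> u" and ?A = "{1..e + 2 * N}" and ?v = "u (Suc N)"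
  let ?f = "\<lambda>v. \<Gamma> (\<tau> * ?v * v) * \<Gamma> (\<tau> / ?v * v)"
  have v0: "?v \<noteq> 0" using Suc.prems by auto
  have "typeI_value {1..e + 2 * Suc N} ?w =
     (\<Prod>k\<in>insert (Suc (e + 2 * N)) ?A. \<Gamma> (\<tau> / ?v * ?w k)) * pair_prod (\<lambda>m k. \<Gamma> (?w m * ?w k)) (insert (Suc (e + 2 * N)) ?A)"
    unfolding typeI_value_def atLeastAtMost_Suc_Suc
    using pair_prod_insert[of "insert (Suc (e + 2 * N)) ?A" "Suc (Suc (e + 2 * N))" "\<lambda>m k. \<Gamma> (?w m * ?w k)"]
    unfolding with_pairs_simps(3) by (simp only: mult.commute finite_insert finite_atLeastAtMost) simp
  also have "pair_prod (\<lambda>m k. \<Gamma> (?w m * ?w k)) (insert (Suc (e + 2 * N)) ?A) = (\<Prod>k\<in>?A. \<Gamma> (\<tau> * ?v * ?w k)) * typeI_value ?A ?w"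
    unfolding typeI_value_def
    using pair_prod_insert[of ?A "Suc (e + 2 * N)" "\<lambda>m k. \<Gamma> (?w m * ?w k)"]
    unfolding with_pairs_simps(2) by (simp only: mult.commute finite_insert finite_atLeastAtMost) simp
  also have "(\<Prod>k\<in>insert (Suc (e + 2 * N)) ?A. \<Gamma> (\<tau> / ?v * ?w k)) = \<Gamma> (\<tau>\<^sup>2) * (\<Prod>k\<in>?A. \<Gamma> (\<tau> / ?v * ?w k))"
    using v0 by (simp add: with_pairs_simps power2_eq_square)
  also have "\<Gamma> (\<tau>\<^sup>2) * (\<Prod>k\<in>?A. \<Gamma> (\<tau> / ?v * ?w k)) * ((\<Prod>k\<in>?A. \<Gamma> (\<tau> * ?v * ?w k)) * typeI_value ?A ?w)
     = \<Gamma> (\<tau>\<^sup>2) * (\<Prod>k\<in>?A. ?f (?w k)) * typeI_value ?A ?w"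
    by (simp add: prod.distrib mult_ac)
  also have "(\<Prod>k\<in>?A. ?f (?w k)) = (\<Prod>m\<in>{1..e}. ?f (c m)) * (\<Prod>k\<in>{1..N}. ?f (\<tau> * u k) * ?f (\<tau> / u k))"
    by (rule prod_with_pairs)
  also have "(\<Prod>m\<in>{1..e}. ?f (c m)) = params {1..e} (\<lambda>m. \<tau> * c m) ?v"
    unfolding params_def by (intro prod.cong refl) (simp add: mult_ac)
  also have "(\<Prod>k\<in>{1..N}. ?f (\<tau> * u k) * ?f (\<tau> / u k)) = (\<Prod>k\<in>{1..N}. \<Gamma>pp (\<tau>\<^sup>2) ?v (u k))"
    unfolding ell_gamma_pm_pm_def by (intro prod.cong refl) (simp add: power2_eq_square mult_ac)
  also have "typeI_value ?A ?w = typeI_value {1..e} c * (\<Prod>k\<in>{1..N}. params {1..e} (\<lambda>m. \<tau> * c m) (u k)) * \<Gamma> (\<tau>\<^sup>2) ^ N *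
    pair_prod (\<lambda>j k. \<Gamma>pp (\<tau>\<^sup>2) (u j) (u k)) {1..N}"
    using Suc by auto
  finally have eq: "typeI_value {1..e + 2 * Suc N} ?w = \<Gamma> (\<tau>\<^sup>2) * (params {1..e} (\<lambda>m. \<tau> * c m) ?v * (\<Prod>k\<in>{1..N}. \<Gamma>pp (\<tau>\<^sup>2) ?v (u k))) *
    (typeI_value {1..e} c * (\<Prod>k\<in>{1..N}. params {1..e} (\<lambda>m. \<tau> * c m) (u k)) * \<Gamma> (\<tau>\<^sup>2) ^ N * pair_prod (\<lambda>j k. \<Gamma>pp (\<tau>\<^sup>2) (u j) (u k)) {1..N})" .
  have "pair_prod (\<lambda>j k. \<Gamma>pp (\<tau>\<^sup>2) (u j) (u k)) {1..Suc N} = (\<Prod>k\<in>{1..N}. \<Gamma>pp (\<tau>\<^sup>2) ?v (u k)) * pair_prod (\<lambda>j k. \<Gamma>pp (\<tau>\<^sup>2) (u j) (u k)) {1..N}"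
  proof -
    have eq: "{1..Suc N} = insert (Suc N) {1..N}" by auto
    show ?thesis unfolding eq by (rule pair_prod_insert) (auto simp: \<Gamma>pp_sym)
  qed
  moreover have "(\<Prod>k\<in>{1..Suc N}. params {1..e} (\<lambda>m. \<tau> * c m) (u k)) = params {1..e} (\<lambda>m. \<tau> * c m) ?v * (\<Prod>k\<in>{1..N}. params {1..e} (\<lambda>m. \<tau> * c m) (u k))"
    by (simp add: mult.commute)
  ultimately show ?case unfolding eq by (simp only: power_Suc mult_ac)
qed

text \<open>
  By \<open>typeI_ratio_const\<close> the choice of the parameters does not matter.
\<close>

definition typeI_const :: "nat \<Rightarrow> complex" where
  "typeI_const n = typeI_ratio {1..n} {1..2 * n + 4} (SOME b. balanced {1..2 * n + 4} b)"

lemma typeI_integral_eq: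
  assumes "balanced {1..2 * n + 4} b"
  shows "typeI_integral {1..n} {1..2 * n + 4} b = typeI_const n * typeI_value {1..2 * n + 4} b"
proof -
  have "balanced {1..2 * n + 4} (SOME b. balanced {1..2 * n + 4} b)" 
    by (rule someI[where P = "\<lambda>b. balanced {1..2 * n + 4} b", OF assms])
  then have "typeI_ratio {1..n} {1..2 * n + 4} b = typeI_const n"
    unfolding typeI_const_def using assms by (intro typeI_ratio_const) auto
  moreover have "typeI_value {1..2 * n + 4} b \<noteq> 0" using assms by (intro typeI_value_nonzero) auto
  ultimately show ?thesis by (simp add: typeI_ratio_def divide_eq_eq)
qed

definition typeII_weight :: "nat \<Rightarrow> complex \<Rightarrow> (nat \<Rightarrow> complex) \<Rightarrow> (nat \<Rightarrow> complex) \<Rightarrow> complex" where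
  "typeII_weight n t a z = typeI_weight {1..n} {1..6} a z * pair_prod (\<lambda>j k. \<Gamma>pp t (z j) (z k)) {1..n}"

definition typeII_integral :: "nat \<Rightarrow> complex \<Rightarrow> (nat \<Rightarrow> complex) \<Rightarrow> complex" where
  "typeII_integral n t a = (\<integral>z. typeII_weight n t a z \<partial>torus {1..n})"

definition typeII_value :: "nat \<Rightarrow> complex \<Rightarrow> (nat \<Rightarrow> complex) \<Rightarrow> complex" where
  "typeII_value n t a = (\<Prod>i=1..n. ell_gamma_quot i t p q * pair_prod (\<lambda>j k. \<Gamma> (t ^ (i - 1) * a j * a k)) {1..6})"

definition typeII_balanced :: "nat \<Rightarrow> complex \<Rightarrow> (nat \<Rightarrow> complex) \<Rightarrow> bool" where
  "typeII_balanced n t a \<longleftrightarrow> t \<noteq> 0 \<and> norm t < 1 \<and> (\<forall>m\<in>{1..6}. a m \<noteq> 0 \<and> norm (a m) < 1) \<and>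
     (\<Prod>m=1..6. a m) * t ^ (2 * n - 2) = p * q"

lemma tame_family_\<Gamma>pp [tame_intros]:
  assumes S: "open S" and t: "t holomorphic_on S" "\<And>s. s \<in> S \<Longrightarrow> t s \<noteq> 0" "\<And>s. s \<in> S \<Longrightarrow> norm (t s) < 1"
    and u: "u \<in> borel_measurable M" "\<And>w. w \<in> space M \<Longrightarrow> norm (u w) = 1"
    and v: "v \<in> borel_measurable M" "\<And>w. w \<in> space M \<Longrightarrow> norm (v w) = 1"
  shows "tame_family S M (\<lambda>s w. \<Gamma>pp (t s) (u w) (v w))"
proof -
  have "tame_family S M (\<lambda>s w. \<Gamma> (t s * (u w * v w)) * \<Gamma> (t s * (u w / v w)) * \<Gamma> (t s * (v w / u w)) * \<Gamma> (t s * (1 / (u w * v w))))"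
    using assms by (intro tame_intros tame_family_Gamma borel_measurable_times borel_measurable_divide) (auto simp: norm_mult norm_divide)
  then show ?thesis by (simp add: ell_gamma_pm_pm_def mult.assoc)
qed

lemma tame_family_typeII_weight:
  assumes S: "open S" and a: "\<And>m. m \<in> {1..6} \<Longrightarrow> (\<lambda>s. a s m) holomorphic_on S" and t: "t holomorphic_on S"
    and bal: "\<And>s. s \<in> S \<Longrightarrow> typeII_balanced n (t s) (a s)"
  shows "tame_family S (torus {1..n}) (\<lambda>s. typeII_weight n (t s) (a s))"
  unfolding typeII_weight_def
  using bal unfolding typeII_balanced_def
  by (intro tame_family_mult tame_family_typeI_weight tame_family_pair_prod tame_family_\<Gamma>pp S a t torus_component)
     (auto intro: norm_torus)

text \<open>
  If \<open>b m * b' k = p * q\<close>, then \<open>\<Gamma>(b m y\<^sup>\<plusminus>\<^sup>1) \<Gamma>(b' k y\<^sup>\<plusminus>\<^sup>1) = 1\<close> by reflection.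
\<close>

lemma params_cancel:
  assumes "finite B" "m \<in> B" "k \<in> B'" "finite B'" and cancel: "b m * b' k = p * q" "norm (b m) < 1" "norm (b' k) < 1"
    and y: "norm y = 1"
  shows "params B b y * params B' b' y = params (B - {m}) b y * params (B' - {k}) b' y"
proof -
  have b0: "b m \<noteq> 0" "b' k \<noteq> 0" "y \<noteq> 0" using cancel(1) p_nz q_nz y by auto
  have n: "norm (p * q) < norm (b m)"
    using cancel(3) b0 unfolding cancel(1)[symmetric] norm_mult by simp
  have "\<Gamma> (b m * y) * \<Gamma> (p * q / (b m * y)) = 1" "\<Gamma> (b m / y) * \<Gamma> (p * q / (b m / y)) = 1"
    using b0 y n cancel(2) by (intro Gamma_reflect; simp add: norm_mult[of "b m"] norm_divide)+
  moreover have "p * q / (b m * y) = b' k / y" "p * q / (b m / y) = b' k * y"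
    using b0 unfolding cancel(1)[symmetric] by auto
  ultimately have one: "(\<Gamma> (b m * y) * \<Gamma> (b m / y)) * (\<Gamma> (b' k * y) * \<Gamma> (b' k / y)) = 1"
    by (simp add: mult_ac) (metis mult.assoc mult.commute mult_1)
  have "params B b y = (\<Gamma> (b m * y) * \<Gamma> (b m / y)) * params (B - {m}) b y"
    "params B' b' y = (\<Gamma> (b' k * y) * \<Gamma> (b' k / y)) * params (B' - {k}) b' y"
    unfolding params_def using assms by (simp_all add: prod.remove)
  then have "params B b y * params B' b' y = ((\<Gamma> (b m * y) * \<Gamma> (b m / y)) * (\<Gamma> (b' k * y) * \<Gamma> (b' k / y))) * (params (B - {m}) b y * params (B' - {k}) b' y)"
    by (simp only: mult_ac)
  then show ?thesis unfolding one by simp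
qed

lemma typeI_integral_with_pairs:
  assumes "\<And>k. k \<in> {1..N} \<Longrightarrow> norm (u k) = 1"
  shows "(\<integral>z. typeI_weight {1..n} {1..e} c z * (\<Prod>i\<in>{1..n}. \<Prod>k\<in>{1..N}. \<Gamma>pp \<tau> (z i) (u k)) \<partial>torus {1..n})
     = typeI_integral {1..n} {1..e + 2 * N} (with_pairs e c \<tau> u)"
  unfolding typeI_integral_def typeI_weight_def params_with_pairs
  by (intro Bochner_Integration.integral_cong refl) (simp add: prod.distrib mult_ac)

text \<open>
  One function of \<open>N + 1\<close> variables \<open>z\<close> and \<open>N\<close> variables \<open>w\<close> is integrated in both orders, each inner integral
  being of type I. In \<open>z\<close> the fixed parameters are \<open>a\<^sub>1, \<dots>, a\<^sub>5, t\<^sup>N a\<^sub>6\<close>, in \<open>w\<close> they are \<open>s\<^sub>1, s\<^sub>2\<close>. These are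
  chosen such that both systems are balanced and that, after the inner integration, one fixed
  parameter cancels against the factors that the inner value contributes: the product of the sixth
  parameter and \<open>\<tau> s\<^sub>1\<close> is \<open>p q\<close>. This determines \<open>s\<^sub>1 = p q / (\<tau> t\<^sup>N a\<^sub>6)\<close>, and \<open>s\<^sub>2 = a\<^sub>6 / \<tau>\<close> leads to the
  parameter \<open>\<tau> s\<^sub>2 = a\<^sub>6\<close> in \<open>z\<close>. The hypothesis \<open>small\<close> is \<open>norm s\<^sub>2 < 1\<close>.
\<close>

lemma typeII_recursion:
  assumes N: "N \<ge> 1" and bal: "typeII_balanced (Suc N) t a" and small: "norm (a 6) ^ 2 < norm t" and \<tau>: "\<tau>\<^sup>2 = t"
  shows "typeI_const N * \<Gamma> (p * q / t ^ Suc N) * \<Gamma> t ^ Suc N * typeII_integral (Suc N) t a =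
    typeI_const (Suc N) * typeI_value {1..6} (a(6 := t ^ N * a 6)) * \<Gamma> t ^ N *
    typeII_integral N t (\<lambda>m. if m = 6 then a 6 / \<tau> else \<tau> * a m)"
proof -
  have t: "t \<noteq> 0" "norm t < 1" and a: "\<And>m. m \<in> {1..6} \<Longrightarrow> a m \<noteq> 0" "\<And>m. m \<in> {1..6} \<Longrightarrow> norm (a m) < 1"
    and abal: "(\<Prod>m=1..6. a m) * t ^ (2 * N) = p * q"
    using bal by (auto simp: typeII_balanced_def)
  have \<tau>0: "\<tau> \<noteq> 0" using \<tau> t by auto
  have \<tau>n: "norm \<tau> ^ 2 = norm t" using \<tau> by (metis norm_power)
  have \<tau>1: "norm \<tau> < 1" using \<tau>n t(2) by (metis abs_norm_cancel abs_square_less_1)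
  define c where "c = a(6 := t ^ N * a 6)"
  define a' where "a' = (\<lambda>m::nat. if m = 6 then a 6 / \<tau> else \<tau> * a m)"
  define s where "s = (\<lambda>m::nat. if m = 1 then p * q / (\<tau> * t ^ N * a 6) else a 6 / \<tau>)"
  have a6: "a 6 \<noteq> 0" "norm (a 6) < 1" using a by auto
  have tN: "norm (t ^ N) \<le> 1" using t by (simp add: norm_power power_le_one)
  have c: "c m \<noteq> 0" "norm (c m) < 1" if "m \<in> {1..6}" for m
  proof -
    have "norm (t ^ N) * norm (a 6) \<le> norm (a 6)" using tN by (simp add: mult_left_le_one_le)
    then have "norm (t ^ N * a 6) < 1" using a6(2) unfolding norm_mult by linarith
    then show "c m \<noteq> 0" "norm (c m) < 1" using a[OF that] t a6 by (simp_all add: c_def)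
  qed
  have s2: "norm (s 2) < 1"
  proof -
    have "norm (a 6) < norm \<tau>" 
      using small unfolding \<tau>n[symmetric] by (rule power2_less_imp_less) simp
    then show ?thesis using \<tau>0 by (simp add: s_def norm_divide)
  qed
  have s1: "norm (s 1) < 1"
  proof -
    have "p * q = a 1 * a 2 * a 3 * a 4 * a 5 * a 6 * (t ^ N * t ^ N)"
      using abal unfolding prod_1_6 by (simp flip: power_add mult_2)
    then have "s 1 = a 1 * a 2 * a 3 * a 4 * a 5 * (t ^ N / \<tau>)"
      using a6 t \<tau>0 by (simp add: s_def)
    then have s1: "norm (s 1) = norm (a 1) * norm (a 2) * norm (a 3) * norm (a 4) * norm (a 5) * norm (t ^ N / \<tau>)"
      by (simp only: norm_mult)
    obtain N' where N': "N = Suc N'" using N by (metis Suc_le_D One_nat_def)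
    have "t ^ N / \<tau> = t ^ N' * \<tau>" using \<tau>0 unfolding N' by (simp add: \<tau>[symmetric] power2_eq_square)
    moreover have "norm (t ^ N' * \<tau>) \<le> 1" using t \<tau>1 by (simp add: norm_mult norm_power mult_le_one power_le_one)
    ultimately have le: "norm (t ^ N / \<tau>) \<le> 1" by simp
    have shrink: "x * y < 1" if "0 \<le> x" "x < 1" "0 \<le> y" "y \<le> 1" for x y :: real
      using that mult_right_le_one_le[of x y] by linarith
    have less: "norm (a m) < 1" "norm (a m) \<le> 1" if "m \<in> {1..6}" for m using a(2)[OF that] by auto
    show ?thesis unfolding s1
      by (intro shrink mult_nonneg_nonneg norm_ge_zero less le; simp)
  qed
  have s0: "s m \<noteq> 0" for m using a6 t \<tau>0 p_nz q_nz by (simp add: s_def)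
  have sn: "norm (s m) < 1" if "m \<in> {1..2}" for m
    using that s1 s2 by (cases "m = 1") (auto simp: le_Suc_eq numeral_2_eq_2)
  have ss: "s 1 * s 2 = p * q / t ^ Suc N"
    using a6 \<tau>0 t by (simp add: s_def \<tau>[symmetric] power2_eq_square)
  have set2: "{1..2::nat} = {1, 2}" by auto
  have balz: "balanced {1..6 + 2 * N} (with_pairs 6 c \<tau> u)" if u: "\<And>k. k \<in> {1..N} \<Longrightarrow> norm (u k) = 1" for u
  proof -
    have "with_pairs 6 c \<tau> u m \<noteq> 0 \<and> norm (with_pairs 6 c \<tau> u m) < 1" if "m \<in> {1..6 + 2 * N}" for m
    proof (rule with_pairs_cases[OF that])
      fix k assume "k \<in> {1..N}" "with_pairs 6 c \<tau> u m = \<tau> * u k"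
      then show ?thesis using u[of k] \<tau>0 \<tau>1 by (auto simp: norm_mult)
    next
      fix k assume "k \<in> {1..N}" "with_pairs 6 c \<tau> u m = \<tau> / u k"
      then show ?thesis using u[of k] \<tau>0 \<tau>1 by (auto simp: norm_divide)
    qed (use c in auto)
    moreover have "(\<Prod>m\<in>{1..6 + 2 * N}. with_pairs 6 c \<tau> u m) = p * q"
    proof -
      have "(\<Prod>m\<in>{1..6 + 2 * N}. with_pairs 6 c \<tau> u m) = (\<Prod>m=1..6. c m) * (\<Prod>k\<in>{1..N}. \<tau> * u k * (\<tau> / u k))"
        by (rule prod_with_pairs[where f = "\<lambda>v. v"])
      also have "(\<Prod>k\<in>{1..N}. \<tau> * u k * (\<tau> / u k)) = (\<Prod>k\<in>{1..N}. t)"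
      proof (intro prod.cong refl)
        fix k assume "k \<in> {1..N}"
        then have "u k \<noteq> 0" using u[of k] by auto
        then show "\<tau> * u k * (\<tau> / u k) = t" by (simp add: \<tau>[symmetric] power2_eq_square)
      qed
      also have "\<dots> = t ^ N" by simp
      also have "(\<Prod>m=1..6. c m) * t ^ N = (\<Prod>m=1..6. a m) * (t ^ N * t ^ N)"
        unfolding prod_1_6 by (simp add: c_def mult_ac)
      also have "\<dots> = p * q" using abal by (simp flip: power_add mult_2)
      finally show ?thesis .
    qed
    ultimately show ?thesis by (auto simp: balanced_def)
  qed
  have balw: "balanced {1..2 + 2 * Suc N} (with_pairs 2 s \<tau> u)" if u: "\<And>k. k \<in> {1..Suc N} \<Longrightarrow> norm (u k) = 1" for u
  proof -
    have "with_pairs 2 s \<tau> u m \<noteq> 0 \<and> norm (with_pairs 2 s \<tau> u m) < 1" if "m \<in> {1..2 + 2 * Suc N}" for m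
    proof (rule with_pairs_cases[OF that])
      fix k assume "k \<in> {1..Suc N}" "with_pairs 2 s \<tau> u m = \<tau> * u k"
      then show ?thesis using u[of k] \<tau>0 \<tau>1 by (auto simp: norm_mult)
    next
      fix k assume "k \<in> {1..Suc N}" "with_pairs 2 s \<tau> u m = \<tau> / u k"
      then show ?thesis using u[of k] \<tau>0 \<tau>1 by (auto simp: norm_divide)
    qed (use s0 sn in auto)
    moreover have "(\<Prod>m\<in>{1..2 + 2 * Suc N}. with_pairs 2 s \<tau> u m) = p * q"
    proof -
      have "(\<Prod>m\<in>{1..2 + 2 * Suc N}. with_pairs 2 s \<tau> u m) = (\<Prod>m=1..2. s m) * (\<Prod>k\<in>{1..Suc N}. \<tau> * u k * (\<tau> / u k))"
        by (rule prod_with_pairs[where f = "\<lambda>v. v"])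
      also have "(\<Prod>k\<in>{1..Suc N}. \<tau> * u k * (\<tau> / u k)) = (\<Prod>k\<in>{1..Suc N}. t)"
      proof (intro prod.cong refl)
        fix k assume "k \<in> {1..Suc N}"
        then have "u k \<noteq> 0" using u[of k] by auto
        then show "\<tau> * u k * (\<tau> / u k) = t" by (simp add: \<tau>[symmetric] power2_eq_square)
      qed
      also have "\<dots> = t ^ Suc N" by simp
      also have "(\<Prod>m=1..2. s m) = p * q / t ^ Suc N" unfolding set2 using ss by simp
      finally show ?thesis using t by simp
    qed
    ultimately show ?thesis by (auto simp: balanced_def)
  qed
  let ?Z = "torus {1..Suc N}" and ?W = "torus {1..N}"
  define \<Psi> where "\<Psi> z w = typeI_weight {1..Suc N} {1..6} c z * typeI_weight {1..N} {1..2} s w *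
     (\<Prod>i\<in>{1..Suc N}. \<Prod>k\<in>{1..N}. \<Gamma>pp \<tau> (z i) (w k))" for z w
  have fubini: "(\<integral>z. (\<integral>w. \<Psi> z w \<partial>?W) \<partial>?Z) = (\<integral>w. (\<integral>z. \<Psi> z w \<partial>?Z) \<partial>?W)"
  proof -
    interpret Z: finite_measure ?Z by (rule finite_measure_torus) simp
    interpret W: finite_measure ?W by (rule finite_measure_torus) simp
    interpret ZW: pair_sigma_finite ?Z ?W ..
    have int: "integrable (?Z \<Otimes>\<^sub>M ?W) (\<lambda>(z, w). \<Psi> z w)"
    proof (rule tame_integrable)
      show "finite_measure (?Z \<Otimes>\<^sub>M ?W)"
        by (rule finite_measure_pair_measure) unfold_locales
      have cz: "(\<lambda>x. fst x i) \<in> borel_measurable (?Z \<Otimes>\<^sub>M ?W)" "\<And>x. x \<in> space (?Z \<Otimes>\<^sub>M ?W) \<Longrightarrow> norm (fst x i) = 1" if "i \<in> {1..Suc N}" for i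
        using measurable_compose[OF measurable_fst torus_component[OF that]] norm_torus[OF _ that] by (auto simp: space_pair_measure)
      have cw: "(\<lambda>x. snd x i) \<in> borel_measurable (?Z \<Otimes>\<^sub>M ?W)" "\<And>x. x \<in> space (?Z \<Otimes>\<^sub>M ?W) \<Longrightarrow> norm (snd x i) = 1" if "i \<in> {1..N}" for i
        using measurable_compose[OF measurable_snd torus_component[OF that]] norm_torus[OF _ that] by (auto simp: space_pair_measure)
      have "tame (?Z \<Otimes>\<^sub>M ?W) (\<lambda>x. \<Psi> (fst x) (snd x))"
        unfolding \<Psi>_def typeI_weight_def
        by (intro tame_family_mult tame_family_prod tame_family_pair_prod tame_family_params tame_family_\<kappa> tame_family_\<omega> tame_family_\<Gamma>pp open_UNIV holomorphic_on_const)
           (use c s0 sn \<tau>0 \<tau>1 cz cw in auto)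
      then show "tame (?Z \<Otimes>\<^sub>M ?W) (\<lambda>(z, w). \<Psi> z w)" by (simp add: case_prod_unfold)
    qed
    show ?thesis by (rule ZW.Fubini_integral[OF int, symmetric])
  qed
  have nz: "z i \<noteq> 0" if "z \<in> space (torus I)" "i \<in> I" for z :: "nat \<Rightarrow> complex" and i I using norm_torus[OF that] by auto
  have pc1: "params {1..6} (\<lambda>m. \<tau> * c m) y * params {1..2} s y = params {1..6} a' y" if y: "norm y = 1" for y
  proof -
    have "params {1..6} (\<lambda>m. \<tau> * c m) y * params {1..2} s y = params ({1..6} - {6}) (\<lambda>m. \<tau> * c m) y * params ({1..2} - {1}) s y"
    proof (rule params_cancel)
      show "\<tau> * c 6 * s 1 = p * q" using a6 \<tau>0 t by (simp add: c_def s_def)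
      have "norm \<tau> * norm (c 6) < 1 * 1" using c[of 6] \<tau>1 by (intro mult_strict_mono') auto
      then show "norm (\<tau> * c 6) < 1" by (simp add: norm_mult)
    qed (use y s1 in auto)
    also have "{1..2} - {1::nat} = {2}" by auto
    also have "params ({1..6} - {6}) (\<lambda>m. \<tau> * c m) y = params ({1..6} - {6}) a' y"
      unfolding params_def by (intro prod.cong) (auto simp: c_def a'_def)
    also have "params ({1..6} - {6}) a' y * params {2} s y = params {1..6} a' y"
    proof -
      have "\<Gamma> (s 2 * y) * \<Gamma> (s 2 / y) = \<Gamma> (a' 6 * y) * \<Gamma> (a' 6 / y)" by (simp add: s_def a'_def)
      moreover have "params {1..6} a' y = \<Gamma> (a' 6 * y) * \<Gamma> (a' 6 / y) * params ({1..6} - {6}) a' y"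
        unfolding params_def by (rule prod.remove) auto
      ultimately show ?thesis unfolding params_def[of "{2}"] by simp
    qed
    finally show ?thesis .
  qed
  have pc2: "params {1..2} (\<lambda>m. \<tau> * s m) y * params {1..6} c y = params {1..6} a y" if y: "norm y = 1" for y
  proof -
    have "params {1..2} (\<lambda>m. \<tau> * s m) y * params {1..6} c y = params ({1..2} - {1}) (\<lambda>m. \<tau> * s m) y * params ({1..6} - {6}) c y"
    proof (rule params_cancel)
      show "\<tau> * s 1 * c 6 = p * q" using a6 \<tau>0 t by (simp add: c_def s_def)
      have "norm \<tau> * norm (s 1) < 1 * 1" using s1 \<tau>1 by (intro mult_strict_mono') auto
      then show "norm (\<tau> * s 1) < 1" by (simp add: norm_mult)
    qed (use y c[of 6] in auto)
    also have "{1..2} - {1::nat} = {2}" by auto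
    also have "params ({1..6} - {6}) c y = params ({1..6} - {6}) a y"
      unfolding params_def by (intro prod.cong) (auto simp: c_def)
    also have "params {2} (\<lambda>m. \<tau> * s m) y * params ({1..6} - {6}) a y = params {1..6} a y"
    proof -
      have "\<Gamma> (\<tau> * s 2 * y) * \<Gamma> (\<tau> * s 2 / y) = \<Gamma> (a 6 * y) * \<Gamma> (a 6 / y)" using \<tau>0 by (simp add: s_def)
      moreover have "params {1..6} a y = \<Gamma> (a 6 * y) * \<Gamma> (a 6 / y) * params ({1..6} - {6}) a y"
        unfolding params_def by (rule prod.remove) auto
      ultimately show ?thesis unfolding params_def[of "{2}"] by simp
    qed
    finally show ?thesis .
  qed
  have inner_z: "(\<integral>z. \<Psi> z w \<partial>?Z) = typeI_const (Suc N) * typeI_value {1..6} c * \<Gamma> t ^ N * typeII_weight N t a' w" if w: "w \<in> space ?W" for w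
  proof -
    have "(\<integral>z. \<Psi> z w \<partial>?Z) = typeI_weight {1..N} {1..2} s w *
       (\<integral>z. typeI_weight {1..Suc N} {1..6} c z * (\<Prod>i\<in>{1..Suc N}. \<Prod>k\<in>{1..N}. \<Gamma>pp \<tau> (z i) (w k)) \<partial>?Z)"
      unfolding \<Psi>_def Bochner_Integration.integral_mult_right_zero[symmetric]
      by (intro Bochner_Integration.integral_cong refl) (simp only: mult_ac)
    also have "(\<integral>z. typeI_weight {1..Suc N} {1..6} c z * (\<Prod>i\<in>{1..Suc N}. \<Prod>k\<in>{1..N}. \<Gamma>pp \<tau> (z i) (w k)) \<partial>?Z)
       = typeI_integral {1..Suc N} {1..6 + 2 * N} (with_pairs 6 c \<tau> w)"
      using norm_torus[OF w] by (rule typeI_integral_with_pairs)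
    also have "\<dots> = typeI_const (Suc N) * typeI_value {1..6 + 2 * N} (with_pairs 6 c \<tau> w)"
      using typeI_integral_eq[of "Suc N" "with_pairs 6 c \<tau> w"] balz[OF norm_torus[OF w]] by (simp add: add.commute)
    also have "typeI_value {1..6 + 2 * N} (with_pairs 6 c \<tau> w) = typeI_value {1..6} c * (\<Prod>k\<in>{1..N}. params {1..6} (\<lambda>m. \<tau> * c m) (w k)) * \<Gamma> t ^ N *
        pair_prod (\<lambda>j k. \<Gamma>pp t (w j) (w k)) {1..N}"
      unfolding \<tau>[symmetric] using nz[OF w] by (rule typeI_value_with_pairs)
    also have "typeI_weight {1..N} {1..2} s w * (typeI_const (Suc N) * (typeI_value {1..6} c * (\<Prod>k\<in>{1..N}. params {1..6} (\<lambda>m. \<tau> * c m) (w k)) * \<Gamma> t ^ N * pair_prod (\<lambda>j k. \<Gamma>pp t (w j) (w k)) {1..N}))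
      = typeI_const (Suc N) * typeI_value {1..6} c * \<Gamma> t ^ N * ((\<Prod>k\<in>{1..N}. (params {1..6} (\<lambda>m. \<tau> * c m) (w k) * params {1..2} s (w k)) * \<omega> (w k)) * pair_prod (\<lambda>j k. \<kappa> (w j) (w k)) {1..N} * pair_prod (\<lambda>j k. \<Gamma>pp t (w j) (w k)) {1..N})"
      unfolding typeI_weight_def prod.distrib by (simp only: mult_ac)
    also have "(\<Prod>k\<in>{1..N}. (params {1..6} (\<lambda>m. \<tau> * c m) (w k) * params {1..2} s (w k)) * \<omega> (w k)) = (\<Prod>k\<in>{1..N}. params {1..6} a' (w k) * \<omega> (w k))"
      using pc1 norm_torus[OF w] by (intro prod.cong refl) simp
    finally show ?thesis by (simp only: typeII_weight_def typeI_weight_def)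
  qed
  have inner_w: "(\<integral>w. \<Psi> z w \<partial>?W) = typeI_const N * \<Gamma> (p * q / t ^ Suc N) * \<Gamma> t ^ Suc N * typeII_weight (Suc N) t a z" if z: "z \<in> space ?Z" for z
  proof -
    have "(\<integral>w. \<Psi> z w \<partial>?W) = typeI_weight {1..Suc N} {1..6} c z *
       (\<integral>w. typeI_weight {1..N} {1..2} s w * (\<Prod>k\<in>{1..N}. \<Prod>i\<in>{1..Suc N}. \<Gamma>pp \<tau> (w k) (z i)) \<partial>?W)"
      unfolding \<Psi>_def Bochner_Integration.integral_mult_right_zero[symmetric]
      by (subst prod.swap, subst \<Gamma>pp_sym, intro Bochner_Integration.integral_cong refl) (simp only: mult_ac)
    also have "(\<integral>w. typeI_weight {1..N} {1..2} s w * (\<Prod>k\<in>{1..N}. \<Prod>i\<in>{1..Suc N}. \<Gamma>pp \<tau> (w k) (z i)) \<partial>?W)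
       = typeI_integral {1..N} {1..2 + 2 * Suc N} (with_pairs 2 s \<tau> z)"
      using norm_torus[OF z] by (rule typeI_integral_with_pairs)
    also have "\<dots> = typeI_const N * typeI_value {1..2 + 2 * Suc N} (with_pairs 2 s \<tau> z)"
    proof -
      have eq: "2 * N + 4 = 2 + 2 * Suc N" by simp
      show ?thesis using typeI_integral_eq[of N "with_pairs 2 s \<tau> z"] balw[of z] norm_torus[OF z] unfolding eq by blast
    qed
    also have "typeI_value {1..2 + 2 * Suc N} (with_pairs 2 s \<tau> z) = typeI_value {1..2} s * (\<Prod>k\<in>{1..Suc N}. params {1..2} (\<lambda>m. \<tau> * s m) (z k)) * \<Gamma> t ^ Suc N *
        pair_prod (\<lambda>j k. \<Gamma>pp t (z j) (z k)) {1..Suc N}"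
      unfolding \<tau>[symmetric] using nz[OF z] by (rule typeI_value_with_pairs)
    also have "typeI_value {1..2} s = \<Gamma> (p * q / t ^ Suc N)"
    proof -
      have "{1..2} = insert 1 {2::nat}" by auto
      then show ?thesis unfolding typeI_value_def ss[symmetric] by (simp add: pair_prod_insert mult.commute)
    qed
    also have "typeI_weight {1..Suc N} {1..6} c z * (typeI_const N * (\<Gamma> (p * q / t ^ Suc N) * (\<Prod>k\<in>{1..Suc N}. params {1..2} (\<lambda>m. \<tau> * s m) (z k)) * \<Gamma> t ^ Suc N * pair_prod (\<lambda>j k. \<Gamma>pp t (z j) (z k)) {1..Suc N}))
      = typeI_const N * \<Gamma> (p * q / t ^ Suc N) * \<Gamma> t ^ Suc N * ((\<Prod>k\<in>{1..Suc N}. (params {1..2} (\<lambda>m. \<tau> * s m) (z k) * params {1..6} c (z k)) * \<omega> (z k)) * pair_prod (\<lambda>j k. \<kappa> (z j) (z k)) {1..Suc N} * pair_prod (\<lambda>j k. \<Gamma>pp t (z j) (z k)) {1..Suc N})"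
      unfolding typeI_weight_def prod.distrib by (simp only: mult_ac)
    also have "(\<Prod>k\<in>{1..Suc N}. (params {1..2} (\<lambda>m. \<tau> * s m) (z k) * params {1..6} c (z k)) * \<omega> (z k)) = (\<Prod>k\<in>{1..Suc N}. params {1..6} a (z k) * \<omega> (z k))"
      using pc2 norm_torus[OF z] by (intro prod.cong refl) simp
    finally show ?thesis by (simp only: typeII_weight_def typeI_weight_def)
  qed
  have 1: "typeI_const N * \<Gamma> (p * q / t ^ Suc N) * \<Gamma> t ^ Suc N * typeII_integral (Suc N) t a = (\<integral>z. (\<integral>w. \<Psi> z w \<partial>?W) \<partial>?Z)"
    unfolding typeII_integral_def Bochner_Integration.integral_mult_right_zero[symmetric]
    by (rule Bochner_Integration.integral_cong[OF refl]) (rule inner_w[symmetric])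
  have 3: "(\<integral>w. (\<integral>z. \<Psi> z w \<partial>?Z) \<partial>?W) = typeI_const (Suc N) * typeI_value {1..6} c * \<Gamma> t ^ N * typeII_integral N t a'"
    unfolding typeII_integral_def Bochner_Integration.integral_mult_right_zero[symmetric]
    by (rule Bochner_Integration.integral_cong[OF refl]) (rule inner_z)
  show ?thesis using trans[OF 1 trans[OF fubini 3]] unfolding c_def a'_def .
qed

section \<open>The recursion in the number of variables\<close>

lemma typeII_balanced_norm:
  assumes "typeII_balanced n t a"
  shows "norm (p * q) < norm t ^ (2 * n - 2)"
proof -
  have "norm (\<Prod>m=1..6. a m) < 1"
  proof -
    have "(\<Prod>m=1..6. norm (a m)) < (\<Prod>m=1..6::nat. 1)"
      using assms by (intro prod_mono_strict[where i = 1]) (auto simp: typeII_balanced_def intro: less_imp_le)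
    then show ?thesis by (simp add: prod_norm)
  qed
  moreover have "norm t > 0" and eq: "p * q = (\<Prod>m=1..6. a m) * t ^ (2 * n - 2)"
    using assms by (simp_all add: typeII_balanced_def)
  ultimately show ?thesis unfolding eq norm_mult[of _ "t ^ (2 * n - 2)"] norm_power by simp
qed

text \<open>
  Sorted by whether the index 6 occurs, the products \<open>P\<^sub>i\<close> without it at \<open>t\<^sup>i a\<^sub>j a\<^sub>k\<close> are shifted by one on passing
  to the new parameters, whereas the products \<open>Q\<^sub>i\<close> with it are not. So the value in \<open>N\<close> variables lacks
  \<open>P\<^sub>0\<close> and \<open>Q\<^sub>N\<close>, and these form the value of type I.
\<close>

lemma typeII_value_recursion:
  assumes N: "N \<ge> 1" and bal: "typeII_balanced (Suc N) t a" and \<tau>: "\<tau>\<^sup>2 = t"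
  shows "typeI_value {1..6} (a(6 := t ^ N * a 6)) * typeII_value N t (\<lambda>m. if m = 6 then a 6 / \<tau> else \<tau> * a m)
    = \<Gamma> (p * q / t ^ Suc N) * \<Gamma> t * typeII_value (Suc N) t a"
proof -
  have t: "t \<noteq> 0" "norm t < 1" and a: "\<And>m. m \<in> {1..6} \<Longrightarrow> a m \<noteq> 0" "\<And>m. m \<in> {1..6} \<Longrightarrow> norm (a m) < 1"
    using bal by (auto simp: typeII_balanced_def)
  have \<tau>0: "\<tau> \<noteq> 0" using \<tau> t by auto
  have set6: "{1..6} = insert 6 {1..5::nat}" by auto
  define P where "P i = pair_prod (\<lambda>j k. \<Gamma> (t ^ i * a j * a k)) {1..5}" for i
  define Q where "Q i = (\<Prod>j\<in>{1..5}. \<Gamma> (t ^ i * a 6 * a j))" for i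
  have PQ: "pair_prod (\<lambda>j k. \<Gamma> (t ^ i * a j * a k)) {1..6} = Q i * P i" for i
    unfolding set6 Q_def P_def by (rule pair_prod_insert) (auto simp: mult_ac)
  have 1: "typeI_value {1..6} (a(6 := t ^ N * a 6)) = Q N * P 0"
  proof -
    have "typeI_value {1..6} (a(6 := t ^ N * a 6)) = (\<Prod>j\<in>{1..5}. \<Gamma> ((a(6 := t ^ N * a 6)) 6 * (a(6 := t ^ N * a 6)) j)) *
       pair_prod (\<lambda>j k. \<Gamma> ((a(6 := t ^ N * a 6)) j * (a(6 := t ^ N * a 6)) k)) {1..5}"
      unfolding set6 typeI_value_def by (rule pair_prod_insert) (auto simp: mult_ac)
    also have "(\<Prod>j\<in>{1..5}. \<Gamma> ((a(6 := t ^ N * a 6)) 6 * (a(6 := t ^ N * a 6)) j)) = Q N"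
      unfolding Q_def by (intro prod.cong) auto
    also have "pair_prod (\<lambda>j k. \<Gamma> ((a(6 := t ^ N * a 6)) j * (a(6 := t ^ N * a 6)) k)) {1..5} = P 0"
      unfolding P_def by (intro pair_prod_cong) auto
    finally show ?thesis .
  qed
  let ?a' = "\<lambda>m. if m = 6 then a 6 / \<tau> else \<tau> * a m"
  have 2: "pair_prod (\<lambda>j k. \<Gamma> (t ^ (i - 1) * ?a' j * ?a' k)) {1..6} = Q (i - 1) * P i" if i: "i \<ge> 1" for i
  proof -
    have ti: "t ^ i = t ^ (i - 1) * \<tau>\<^sup>2" using i \<tau> by (cases i) auto
    have "pair_prod (\<lambda>j k. \<Gamma> (t ^ (i - 1) * ?a' j * ?a' k)) {1..6} =
      (\<Prod>j\<in>{1..5}. \<Gamma> (t ^ (i - 1) * ?a' 6 * ?a' j)) * pair_prod (\<lambda>j k. \<Gamma> (t ^ (i - 1) * ?a' j * ?a' k)) {1..5}"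
      unfolding set6 by (rule pair_prod_insert) (auto simp: mult_ac)
    also have "(\<Prod>j\<in>{1..5}. \<Gamma> (t ^ (i - 1) * ?a' 6 * ?a' j)) = Q (i - 1)"
      unfolding Q_def using \<tau>0 by (intro prod.cong) (auto simp: mult.assoc)
    also have "pair_prod (\<lambda>j k. \<Gamma> (t ^ (i - 1) * ?a' j * ?a' k)) {1..5} = P i"
      unfolding P_def ti by (intro pair_prod_cong) (auto simp: power2_eq_square mult_ac)
    finally show ?thesis .
  qed
  let ?E = "\<Prod>i=1..N. ell_gamma_quot i t p q"
  have "typeII_value N t ?a' = ?E * (\<Prod>i=1..N. Q (i - 1) * P i)"
    unfolding typeII_value_def prod.distrib[symmetric] using 2 by (intro prod.cong refl) auto
  then have L: "typeI_value {1..6} (a(6 := t ^ N * a 6)) * typeII_value N t ?a' = ?E * (Q N * (\<Prod>i=1..N. Q (i - 1))) * (P 0 * (\<Prod>i=1..N. P i))"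
    unfolding 1 prod.distrib by (simp only: mult_ac)
  have Qs: "Q N * (\<Prod>i=1..N. Q (i - 1)) = (\<Prod>i=1..Suc N. Q (i - 1))" by simp
  have Ps: "P 0 * (\<Prod>i=1..N. P i) = (\<Prod>i=1..Suc N. P (i - 1))"
  proof -
    have "(\<Prod>i=1..Suc N. P (i - 1)) = (\<Prod>i=0..N. P i)"
      using prod.shift_bounds_cl_Suc_ivl[of "\<lambda>i. P (i - 1)" 0 N] by simp
    also have "\<dots> = P 0 * (\<Prod>i=1..N. P i)" by (simp add: prod.atLeast_Suc_atMost)
    finally show ?thesis by simp
  qed
  have R: "typeII_value (Suc N) t a = ell_gamma_quot (Suc N) t p q * ?E * (\<Prod>i=1..Suc N. Q (i - 1)) * (\<Prod>i=1..Suc N. P (i - 1))"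
  proof -
    have "typeII_value (Suc N) t a = (\<Prod>i=1..Suc N. ell_gamma_quot i t p q) * ((\<Prod>i=1..Suc N. Q (i - 1)) * (\<Prod>i=1..Suc N. P (i - 1)))"
      unfolding typeII_value_def PQ prod.distrib by (rule refl)
    moreover have "(\<Prod>i=1..Suc N. ell_gamma_quot i t p q) = ell_gamma_quot (Suc N) t p q * ?E" by simp
    ultimately show ?thesis by (simp only: mult_ac)
  qed
  have pq: "norm (p * q) < norm t ^ (2 * N)" using typeII_balanced_norm[OF bal] by simp
  have "norm t ^ (2 * N) \<le> norm t ^ Suc N" "norm t ^ Suc N \<le> norm t"
    using t N power_decreasing[of "Suc N" "2 * N" "norm t"] power_decreasing[of 1 "Suc N" "norm t"] by auto
  then have "norm (p * q) < norm (t ^ Suc N)" "norm (p * q) < norm t" using pq unfolding norm_power by linarith+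
  moreover have "norm (t ^ Suc N) < 1" using t unfolding norm_power by (intro power_less_one_iff[THEN iffD2]) auto
  ultimately have "\<Gamma> (t ^ Suc N) * \<Gamma> (p * q / t ^ Suc N) = 1" "\<Gamma> t \<noteq> 0"
    using t Gamma_nonzero[of t] by (auto intro!: Gamma_reflect simp del: power_Suc)
  then have "\<Gamma> (p * q / t ^ Suc N) * \<Gamma> t * ell_gamma_quot (Suc N) t p q = 1"
    using N unfolding ell_gamma_quot_def by (simp add: mult.commute del: power_Suc)
  then have "\<Gamma> (p * q / t ^ Suc N) * \<Gamma> t * typeII_value (Suc N) t a = ?E * (\<Prod>i=1..Suc N. Q (i - 1)) * (\<Prod>i=1..Suc N. P (i - 1))"
    unfolding R by (metis (no_types, lifting) mult.assoc mult_1)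
  then show ?thesis unfolding L Qs Ps by simp
qed

lemma typeII_balanced_shift:
  assumes N: "N \<ge> 1" and bal: "typeII_balanced (Suc N) t a" and small: "norm (a 6) ^ 2 < norm t" and \<tau>: "\<tau>\<^sup>2 = t"
  shows "typeII_balanced N t (\<lambda>m. if m = 6 then a 6 / \<tau> else \<tau> * a m)"
proof -
  let ?a' = "\<lambda>m. if m = 6 then a 6 / \<tau> else \<tau> * a m"
  have t: "t \<noteq> 0" "norm t < 1" and a: "\<And>m. m \<in> {1..6} \<Longrightarrow> a m \<noteq> 0" "\<And>m. m \<in> {1..6} \<Longrightarrow> norm (a m) < 1"
    and abal: "(\<Prod>m=1..6. a m) * t ^ (2 * N) = p * q"
    using bal by (auto simp: typeII_balanced_def)
  have \<tau>0: "\<tau> \<noteq> 0" using \<tau> t by auto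
  have \<tau>n: "norm \<tau> ^ 2 = norm t" using \<tau> by (metis norm_power)
  have \<tau>1: "norm \<tau> < 1" using \<tau>n t(2) by (metis abs_norm_cancel abs_square_less_1)
  have "norm (a 6) < norm \<tau>" using small unfolding \<tau>n[symmetric] by (rule power2_less_imp_less) simp
  then have n6: "norm (a 6 / \<tau>) < 1" using \<tau>0 by (simp add: norm_divide)
  have n: "norm (\<tau> * a m) < 1" if "m \<in> {1..6}" for m
    using mult_strict_mono'[OF \<tau>1 a(2)[OF that]] by (simp add: norm_mult)
  obtain N' where N': "N = Suc N'" using N by (cases N) auto
  have e: "t ^ (2 * N) = \<tau>\<^sup>2 * \<tau>\<^sup>2 * t ^ (2 * N - 2)" unfolding N' by (simp add: \<tau>)
  have "(\<Prod>m=1..6. ?a' m) * t ^ (2 * N - 2) = p * q"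
    unfolding abal[symmetric] e prod_1_6 using \<tau>0 by (simp add: power2_eq_square)
  then show ?thesis unfolding typeII_balanced_def using t a \<tau>0 n n6 by auto
qed

lemma typeII_integral_step:
  assumes N: "N \<ge> 1" and bal: "typeII_balanced (Suc N) t a" and small: "norm (a 6) ^ 2 < norm t"
    and const: "typeI_const N \<noteq> 0" and IH: "\<And>b. typeII_balanced N t b \<Longrightarrow> typeII_integral N t b = typeI_const N * typeII_value N t b"
  shows "typeII_integral (Suc N) t a = typeI_const (Suc N) * typeII_value (Suc N) t a"
proof -
  define \<tau> where "\<tau> = csqrt t"
  have \<tau>: "\<tau>\<^sup>2 = t" by (simp add: \<tau>_def)
  let ?a' = "\<lambda>m. if m = 6 then a 6 / \<tau> else \<tau> * a m"
  have t: "t \<noteq> 0" "norm t < 1" and a: "\<And>m. m \<in> {1..6} \<Longrightarrow> a m \<noteq> 0" "\<And>m. m \<in> {1..6} \<Longrightarrow> norm (a m) < 1"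
    using bal by (auto simp: typeII_balanced_def)
  define G where "G = \<Gamma> (p * q / t ^ Suc N)"
  have "typeI_const N * G * \<Gamma> t ^ Suc N * typeII_integral (Suc N) t a =
    typeI_const (Suc N) * typeI_value {1..6} (a(6 := t ^ N * a 6)) * \<Gamma> t ^ N * typeII_integral N t ?a'"
    unfolding G_def by (rule typeII_recursion[OF N bal small \<tau>])
  also have "typeII_integral N t ?a' = typeI_const N * typeII_value N t ?a'"
    by (rule IH[OF typeII_balanced_shift[OF N bal small \<tau>]])
  also have "typeI_const (Suc N) * typeI_value {1..6} (a(6 := t ^ N * a 6)) * \<Gamma> t ^ N * (typeI_const N * typeII_value N t ?a')
    = typeI_const (Suc N) * \<Gamma> t ^ N * typeI_const N * (typeI_value {1..6} (a(6 := t ^ N * a 6)) * typeII_value N t ?a')"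
    by (simp only: mult_ac)
  also have "\<dots> = typeI_const (Suc N) * \<Gamma> t ^ N * typeI_const N * (G * \<Gamma> t * typeII_value (Suc N) t a)"
    unfolding G_def typeII_value_recursion[OF N bal \<tau>] ..
  finally have eq: "(typeI_const N * G * \<Gamma> t ^ Suc N) * typeII_integral (Suc N) t a = (typeI_const N * G * \<Gamma> t ^ Suc N) * (typeI_const (Suc N) * typeII_value (Suc N) t a)"
    by (simp only: mult_ac power_Suc)
  have pq: "norm (p * q) < norm t ^ (2 * N)" using typeII_balanced_norm[OF bal] by simp
  have "norm t ^ (2 * N) \<le> norm t ^ Suc N" "norm t ^ Suc N \<le> norm t"
    using t N power_decreasing[of "Suc N" "2 * N" "norm t"] power_decreasing[of 1 "Suc N" "norm t"] by auto
  then have "norm (p * q) < norm (t ^ Suc N)" "norm (p * q) < norm t" using pq unfolding norm_power by linarith+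
  moreover have "norm (t ^ Suc N) < 1" using t unfolding norm_power by (intro power_less_one_iff[THEN iffD2]) auto
  ultimately have "\<Gamma> (t ^ Suc N) * G = 1" "\<Gamma> t \<noteq> 0"
    unfolding G_def using t Gamma_nonzero[of t] by (auto intro!: Gamma_reflect simp del: power_Suc)
  then have "typeI_const N * G * \<Gamma> t ^ Suc N \<noteq> 0" using const by auto
  then show ?thesis using eq by (simp only: mult_cancel_left) simp
qed

lemma typeII_Gamma_nonzero:
  assumes "typeII_balanced n t a" "n \<ge> 2"
  shows "\<Gamma> t \<noteq> 0"
proof -
  have "norm t < 1" "norm t > 0" using assms by (auto simp: typeII_balanced_def)
  then have "norm t ^ (2 * n - 2) \<le> norm t ^ 1" using assms(2) by (intro power_decreasing) auto
  then show ?thesis using typeII_balanced_norm[OF assms(1)] \<open>norm t < 1\<close> by (intro Gamma_nonzero) auto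
qed

lemma holomorphic_typeII_value:
  assumes n: "n \<ge> 2" and a: "\<And>m. m \<in> {1..6} \<Longrightarrow> (\<lambda>s. a s m) holomorphic_on S" and t: "t holomorphic_on S"
    and bal: "\<And>s. s \<in> S \<Longrightarrow> typeII_balanced n (t s) (a s)"
  shows "(\<lambda>s. typeII_value n (t s) (a s)) holomorphic_on S"
proof -
  have t01: "t s \<noteq> 0" "norm (t s) < 1" if "s \<in> S" for s using bal[OF that] by (auto simp: typeII_balanced_def)
  have a01: "a s m \<noteq> 0" "norm (a s m) < 1" if "s \<in> S" "m \<in> {1..6}" for s m
    using bal[OF that(1)] that(2) by (auto simp: typeII_balanced_def)
  have quot: "(\<lambda>s. ell_gamma_quot i (t s) p q) holomorphic_on S" if i: "i \<ge> 1" for i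
  proof (cases "i = 1")
    case False
    have "(\<lambda>s. \<Gamma> (t s ^ i) / \<Gamma> (t s)) holomorphic_on S"
      using t01 i by (intro holomorphic_intros holomorphic_Gamma t typeII_Gamma_nonzero[OF bal n]) (auto simp: norm_power power_less_one_iff)
    then show ?thesis using False by (simp add: ell_gamma_quot_def)
  qed (simp add: ell_gamma_quot_def)
  have arg: "norm (t s ^ i * a s j * a s k) < 1" if "s \<in> S" "j \<in> {1..6}" "k \<in> {1..6}" for s i j k
  proof -
    have "norm (t s) ^ i * norm (a s j) \<le> 1" using t01[OF that(1)] a01[OF that(1,2)] by (intro mult_le_one power_le_one) auto
    then have "norm (t s) ^ i * norm (a s j) * norm (a s k) \<le> norm (a s k)"
      by (intro mult_left_le_one_le) auto
    then show ?thesis using a01(2)[OF that(1,3)] unfolding norm_mult norm_power by linarith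
  qed
  show ?thesis
    unfolding typeII_value_def
    by (intro holomorphic_intros holomorphic_on_pair_prod quot holomorphic_Gamma t a arg)
       (use t01 a01 in auto)
qed

text \<open>
  Scaling \<open>t\<close> by \<open>exp (3 s)\<close> and all \<open>a\<^sub>m\<close> by \<open>exp (-(n - 1) s)\<close> keeps the balancing condition. When \<open>Re s\<close> grows,
  \<open>norm t\<close> approaches 1 and the \<open>norm a\<^sub>m\<close> decrease, so \<open>norm a\<^sub>6\<^sup>2 < norm t\<close> holds in a part of the admissible strip.
\<close>

lemma typeII_continuation:
  assumes n: "n \<ge> 2" and bal: "typeII_balanced n t a"
    and small: "\<And>t a. typeII_balanced n t a \<Longrightarrow> norm (a 6) ^ 2 < norm t \<Longrightarrow> typeII_integral n t a = C * typeII_value n t a"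
  shows "typeII_integral n t a = C * typeII_value n t a"
proof -
  have t: "t \<noteq> 0" "norm t < 1" and a: "\<And>m. m \<in> {1..6} \<Longrightarrow> a m \<noteq> 0" "\<And>m. m \<in> {1..6} \<Longrightarrow> norm (a m) < 1"
    and abal: "(\<Prod>m=1..6. a m) * t ^ (2 * n - 2) = p * q"
    using bal by (auto simp: typeII_balanced_def)
  define N where "N = real n - 1"
  have N: "N > 0" using n by (simp add: N_def)
  define L where "L m = ln (norm (a m)) / N" for m
  define \<beta> where "\<beta> = - ln (norm t) / 3"
  define S where "S = {s. Re s < \<beta>} \<inter> (\<Inter>m\<in>{1..6}. {s. L m < Re s})"
  define T where "T s = t * exp (3 * s)" for s :: complex
  define A where "A s = (\<lambda>m. a m * exp (- (of_nat n - 1) * s))" for s :: complex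
  have L0: "L m < 0" if "m \<in> {1..6}" for m
    using a[OF that] N by (simp add: L_def divide_neg_pos)
  have \<beta>0: "\<beta> > 0" using t by (simp add: \<beta>_def)
  have S: "open S" "connected S"
    unfolding S_def
    by (auto intro!: open_Int open_INT open_halfspace_Re_lt open_halfspace_Re_gt convex_connected convex_Int convex_INT
        convex_halfspace_Re_lt convex_halfspace_Re_gt)
  have 0: "0 \<in> S" using L0 \<beta>0 by (auto simp: S_def)
  have nT: "norm (T s) = exp (ln (norm t) + 3 * Re s)" for s
    using t by (simp add: T_def norm_mult exp_add)
  have nA: "norm (A s m) = exp (ln (norm (a m)) - N * Re s)" if "m \<in> {1..6}" for s m
  proof -
    have "norm (exp (- (of_nat n - 1) * s)) = exp (- (N * Re s))"
      unfolding norm_exp_eq_Re by (simp add: N_def algebra_simps)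
    then show ?thesis using a[OF that] unfolding A_def norm_mult by (simp add: exp_diff exp_minus divide_inverse)
  qed
  have balS: "typeII_balanced n (T s) (A s)" if s: "s \<in> S" for s
  proof -
    have 1: "norm (T s) < 1" using s unfolding nT by (simp add: S_def \<beta>_def)
    have 2: "norm (A s m) < 1" if "m \<in> {1..6}" for m
    proof -
      have "L m < Re s" using s that by (auto simp: S_def)
      then have "ln (norm (a m)) < N * Re s" using N by (simp add: L_def divide_less_eq mult.commute)
      then show ?thesis unfolding nA[OF that] by simp
    qed
    obtain n' where n': "n = Suc n'" using n by (cases n) auto
    have "exp (- (of_nat n - 1) * s) ^ 6 * exp (3 * s) ^ (2 * n - 2) = exp (6 * (- (of_nat n - 1) * s) + of_nat (2 * n - 2) * (3 * s))"
      unfolding exp_add exp_of_nat_mult by (simp add: exp_of_nat_mult[of 6, simplified])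
    also have "6 * (- (of_nat n - 1) * s) + of_nat (2 * n - 2) * (3 * s) = 0" unfolding n' by (simp add: algebra_simps)
    finally have "exp (- (of_nat n - 1) * s) ^ 6 * exp (3 * s) ^ (2 * n - 2) = 1" by simp
    then have "(\<Prod>m=1..6. A s m) * T s ^ (2 * n - 2) = (\<Prod>m=1..6. a m) * t ^ (2 * n - 2)"
      by (simp add: A_def T_def prod.distrib power_mult_distrib mult_ac)
    then show ?thesis using 1 2 t a abal by (auto simp: typeII_balanced_def T_def A_def)
  qed
  have hT: "T holomorphic_on S" and hA: "(\<lambda>s. A s m) holomorphic_on S" for m
    unfolding T_def A_def by (intro holomorphic_intros)+
  have hJ: "(\<lambda>s. typeII_integral n (T s) (A s)) holomorphic_on S"
    unfolding typeII_integral_def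
    by (intro tame_family_holomorphic_integral finite_measure_torus finite_atLeastAtMost S tame_family_typeII_weight hA hT balS)
  have hV: "(\<lambda>s. C * typeII_value n (T s) (A s)) holomorphic_on S"
    by (intro holomorphic_intros holomorphic_typeII_value n hA hT balS)
  define \<gamma> where "\<gamma> = (2 * ln (norm (a 6)) - ln (norm t)) / (2 * N + 3)"
  define U where "U = S \<inter> {s. \<gamma> < Re s}"
  have "2 * ln (norm (a 6)) - ln (norm t) < \<beta> * (2 * N + 3)"
  proof -
    have "ln (norm (a 6)) < 0" "ln (norm t) < 0" using a[of 6] t by auto
    moreover from this have "N * ln (norm t) < 0" using N by (simp add: mult_pos_neg)
    ultimately show ?thesis by (simp add: \<beta>_def algebra_simps)
  qed
  then have \<gamma>: "\<gamma> < \<beta>" using N by (simp add: \<gamma>_def divide_less_eq)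
  have "of_real ((\<beta> + max 0 \<gamma>) / 2) \<in> U"
  proof -
    have "0 < (\<beta> + max 0 \<gamma>) / 2" "\<gamma> < (\<beta> + max 0 \<gamma>) / 2" "(\<beta> + max 0 \<gamma>) / 2 < \<beta>" using \<beta>0 \<gamma> by auto
    moreover have "L m < (\<beta> + max 0 \<gamma>) / 2" if "m \<in> {1..6}" for m using L0[OF that] calculation(1) by linarith
    ultimately show ?thesis unfolding U_def S_def by simp
  qed
  then have Une: "U \<noteq> {}" by auto
  have Uo: "open U" unfolding U_def using S by (intro open_Int open_halfspace_Re_gt)
  have eqU: "typeII_integral n (T s) (A s) = C * typeII_value n (T s) (A s)" if "s \<in> U" for s
  proof (rule small[OF balS])
    show "s \<in> S" using that by (simp add: U_def)
    have "2 * ln (norm (a 6)) - ln (norm t) < Re s * (2 * N + 3)"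
      using that N by (simp add: U_def \<gamma>_def divide_less_eq)
    then have "2 * (ln (norm (a 6)) - N * Re s) < ln (norm t) + 3 * Re s" by (simp add: algebra_simps)
    moreover have "exp (ln (norm (a 6)) - N * Re s) ^ 2 = exp (2 * (ln (norm (a 6)) - N * Re s))"
      by (rule exp_double[symmetric])
    ultimately show "norm (A s 6) ^ 2 < norm (T s)" using nA[of 6 s] unfolding nT by simp
  qed
  have "U \<subseteq> S" by (simp add: U_def)
  from analytic_continuation_open[OF Uo S(1) Une S(2) this hJ hV eqU 0]
  have "typeII_integral n (T 0) (A 0) = C * typeII_value n (T 0) (A 0)" by simp
  then show ?thesis by (simp add: T_def A_def)
qed

end

section \<open>The limit of a vanishing interaction\<close>

lemma AE_circ_neq: "AE z in circ. z \<noteq> c"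
proof -
  have "countable {\<theta>. cis \<theta> = c}"
  proof (cases "\<exists>\<theta>\<^sub>0. cis \<theta>\<^sub>0 = c")
    case True
    then obtain \<theta>\<^sub>0 where c: "c = cis \<theta>\<^sub>0" by blast
    have "{\<theta>. cis \<theta> = c} \<subseteq> range (\<lambda>n::int. \<theta>\<^sub>0 + 2 * pi * of_int n)"
    proof
      fix \<theta> assume "\<theta> \<in> {\<theta>. cis \<theta> = c}"
      then have "sin \<theta> = sin \<theta>\<^sub>0 \<and> cos \<theta> = cos \<theta>\<^sub>0" unfolding c by (simp add: complex_eq_iff)
      then obtain n :: int where "\<theta> = \<theta>\<^sub>0 + 2 * pi * of_int n" unfolding sin_cos_eq_iff by blast
      then show "\<theta> \<in> range (\<lambda>n::int. \<theta>\<^sub>0 + 2 * pi * of_int n)" by blast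
    qed
    then show ?thesis by (rule countable_subset) simp
  next
    case False
    then have "{\<theta>. cis \<theta> = c} = {}" by blast
    then show ?thesis by simp
  qed
  from AE_not_in[OF countable_imp_null_set_lborel[OF this]]
  have "AE \<theta> in lborel. cis \<theta> \<noteq> c" by simp
  then have "AE \<theta> in angle_measure. cis \<theta> \<noteq> c"
    unfolding angle_measure_def by (subst AE_density) auto
  moreover have "{x \<in> space (restrict_space borel (sphere 0 1)). x \<noteq> c} \<in> sets (restrict_space borel (sphere 0 1))"
    by (auto simp: sets_restrict_space space_restrict_space intro!: image_eqI[where x = "- {c}"])
  ultimately show ?thesis unfolding circ_def by (subst AE_distr_iff[OF measurable_cis_angle]) auto
qed

text \<open>
  Given all other variables, one value of \<open>z j\<close> is excluded, and points have measure 0.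
\<close>

lemma AE_torus_neq:
  assumes I: "finite I" "j \<in> I" "k \<in> I" "j \<noteq> k" and h [measurable]: "h \<in> borel_measurable borel"
  shows "AE z in torus I. z j \<noteq> h (z k)"
proof -
  let ?f = "\<lambda>z. if z j = h (z k) then 1 else 0 :: ennreal"
  have [measurable]: "(\<lambda>z. z j) \<in> torus I \<rightarrow>\<^sub>M borel" "(\<lambda>z. z k) \<in> torus I \<rightarrow>\<^sub>M borel"
    using I by (auto intro: torus_component)
  have m: "?f \<in> borel_measurable (torus I)" by measurable
  have eq: "insert j (I - {j}) = I" using I by auto
  have "(\<integral>\<^sup>+z. ?f z \<partial>torus I) = (\<integral>\<^sup>+x. (\<integral>\<^sup>+y. ?f (x(j := y)) \<partial>circ) \<partial>torus (I - {j}))"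
    using circs.product_nn_integral_insert[of "I - {j}" j ?f] I m unfolding eq by simp
  also have "\<dots> = (\<integral>\<^sup>+x. 0 \<partial>torus (I - {j}))"
  proof (intro nn_integral_cong)
    fix x
    have "AE y in circ. ?f (x(j := y)) = 0" using AE_circ_neq[of "h (x k)"] by eventually_elim (use I in auto)
    then have "(\<integral>\<^sup>+y. ?f (x(j := y)) \<partial>circ) = (\<integral>\<^sup>+y. 0 \<partial>circ)" by (rule nn_integral_cong_AE)
    then show "(\<integral>\<^sup>+y. ?f (x(j := y)) \<partial>circ) = 0" by simp
  qed
  finally have "(\<integral>\<^sup>+z. ?f z \<partial>torus I) = 0" by simp
  then have "AE z in torus I. ?f z = 0" using m by (simp add: nn_integral_0_iff_AE)
  then show ?thesis by eventually_elim (auto split: if_splits)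
qed

lemma norm_pair_prod_le:
  assumes "\<And>j k. j \<in> A \<Longrightarrow> k \<in> A \<Longrightarrow> norm (f j k) \<le> L"
  shows "norm (pair_prod f A) \<le> (\<Prod>j\<in>A. \<Prod>k\<in>{k\<in>A. j < k}. L)"
  unfolding pair_prod_def prod_norm[symmetric]
  using assms by (intro prod_mono conjI prod_nonneg norm_ge_zero) auto

context elliptic_bases
begin

lemma isCont_Gamma: "u \<noteq> 0 \<Longrightarrow> norm u < 1 \<Longrightarrow> isCont \<Gamma> u"
proof -
  assume u: "u \<noteq> 0" "norm u < 1"
  have "\<Gamma> holomorphic_on (ball 0 1 - {0})" by (rule holomorphic_Gamma) auto
  then have "continuous_on (ball 0 1 - {0}) \<Gamma>" by (rule holomorphic_on_imp_continuous_on)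
  moreover have "open (ball (0::complex) 1 - {0})" by auto
  ultimately show ?thesis using u by (simp add: continuous_on_eq_continuous_at)
qed

lemma continuous_on_Gamma_reg: "A \<subseteq> cball 0 1 - {0} \<Longrightarrow> continuous_on A Gamma_reg"
proof -
  assume A: "A \<subseteq> cball 0 1 - {0}"
  have "norm (r * u) < 1" if "norm r < 1" "u \<in> A" for r u
    using that A mult_left_le[of "norm u" "norm r"] by (auto simp: norm_mult)
  then show ?thesis
    using A norm_p norm_q by (intro holomorphic_on_imp_continuous_on holomorphic_Gamma_reg) auto
qed

lemma tendsto_Gamma_reg:
  assumes "T \<longlonglongrightarrow> u" "norm u = 1" "\<And>k. norm (T k) \<le> 1"
  shows "(\<lambda>k. Gamma_reg (T k)) \<longlonglongrightarrow> Gamma_reg u"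
proof -
  have "eventually (\<lambda>k. T k \<noteq> 0) sequentially" using assms(1,2) by (intro tendsto_imp_eventually_ne) auto
  then have "eventually (\<lambda>k. T k \<in> cball 0 1 - {0}) sequentially" by eventually_elim (use assms(3) in auto)
  moreover have "u \<in> cball 0 1 - {0}" using assms(2) by auto
  ultimately show ?thesis using continuous_on_tendsto_compose[OF continuous_on_Gamma_reg[OF order_refl] assms(1)] by blast
qed

lemma Gamma_reg_unit_nonzero: "norm u = 1 \<Longrightarrow> Gamma_reg u \<noteq> 0"
  using norm_pq norm_p norm_q by (intro Gamma_reg_nonzero) (auto simp: norm_mult)

lemma Gamma_ratio: "\<Gamma> v / \<Gamma> u = Gamma_reg v / Gamma_reg u * ((1 - u) / (1 - v))"
  by (simp add: Gamma_conv_reg[of u] Gamma_conv_reg[of v])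

text \<open>
  The zero \<open>u = 1\<close> of \<open>1 / \<Gamma> u\<close> compensates for the pole that approaches it:
  \<open>norm (1 - u) \<le> 2 * norm (1 - T * u)\<close>.
\<close>

lemma Gamma_ratio_bounded:
  obtains K where "\<And>T u. 1/2 \<le> T \<Longrightarrow> T < 1 \<Longrightarrow> norm u = 1 \<Longrightarrow> norm (\<Gamma> (of_real T * u) / \<Gamma> u) \<le> K"
proof -
  have "compact (cball 0 1 - ball 0 (1/2) :: complex set)" by (intro compact_diff) auto
  then have "bounded (Gamma_reg ` (cball 0 1 - ball 0 (1/2)))"
    by (intro compact_imp_bounded compact_continuous_image continuous_on_Gamma_reg) auto
  then obtain K1 where K1: "norm (Gamma_reg v) \<le> K1" if "v \<in> cball 0 1 - ball 0 (1/2)" for v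
    unfolding bounded_iff by blast
  have "continuous_on (sphere 0 1) (\<lambda>u. 1 / Gamma_reg u)"
    by (intro continuous_intros continuous_on_Gamma_reg) (auto simp: Gamma_reg_unit_nonzero)
  then have "bounded ((\<lambda>u. 1 / Gamma_reg u) ` sphere 0 1)"
    by (intro compact_imp_bounded compact_continuous_image) auto
  then obtain K2 where K2: "norm (1 / Gamma_reg u) \<le> K2" if "u \<in> sphere 0 1" for u
    unfolding bounded_iff by blast
  have "norm (\<Gamma> (of_real T * u) / \<Gamma> u) \<le> K1 * K2 * 2" if T: "1/2 \<le> T" "T < 1" and u: "norm u = 1" for T u
  proof -
    have "norm (of_real T * u) = T" using T u by (simp add: norm_mult)
    then have 1: "norm (Gamma_reg (of_real T * u)) \<le> K1" using T by (intro K1) simp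
    have 2: "norm (1 / Gamma_reg u) \<le> K2" using u by (intro K2) simp
    have "norm (of_real T * u - u) = 1 - T"
    proof -
      have eq: "of_real T * u - u = of_real (T - 1) * u" by (simp add: algebra_simps)
      show ?thesis unfolding eq norm_mult norm_of_real u using T by simp
    qed
    then have "norm (1 - u) \<le> norm (1 - of_real T * u) + (1 - T)"
      using norm_triangle_ineq[of "1 - of_real T * u" "of_real T * u - u"] by simp
    moreover have less: "1 - T \<le> norm (1 - of_real T * u)"
      using norm_triangle_ineq2[of 1 "of_real T * u"] \<open>norm (of_real T * u) = T\<close> by simp
    ultimately have "norm (1 - u) \<le> 2 * norm (1 - of_real T * u)" by simp
    then have 3: "norm ((1 - u) / (1 - of_real T * u)) \<le> 2" using less T by (simp add: norm_divide divide_le_eq)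
    have "norm (\<Gamma> (of_real T * u) / \<Gamma> u) = norm (Gamma_reg (of_real T * u)) * norm (1 / Gamma_reg u) * norm ((1 - u) / (1 - of_real T * u))"
      unfolding Gamma_ratio by (simp add: norm_mult norm_divide)
    also have "\<dots> \<le> K1 * K2 * 2"
      using 1 2 3 order_trans[OF norm_ge_zero 1] order_trans[OF norm_ge_zero 2] by (intro mult_mono mult_nonneg_nonneg norm_ge_zero)
    finally show ?thesis .
  qed
  then show ?thesis by (rule that)
qed

lemma tendsto_Gamma_ratio:
  assumes T: "T \<longlonglongrightarrow> 1" "\<And>k. 1/2 \<le> T k" "\<And>k. T k < 1" and u: "norm u = 1" "u \<noteq> 1"
  shows "(\<lambda>k. \<Gamma> (of_real (T k) * u) / \<Gamma> u) \<longlonglongrightarrow> 1"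
proof -
  have lim: "(\<lambda>k. of_real (T k) * u) \<longlonglongrightarrow> of_real 1 * u" using T by (intro tendsto_intros)
  have n: "norm (of_real (T k) * u) \<le> 1" for k using T(2)[of k] T(3)[of k] u by (simp add: norm_mult)
  have "(\<lambda>k. Gamma_reg (of_real (T k) * u) / Gamma_reg u * ((1 - u) / (1 - of_real (T k) * u)))
      \<longlonglongrightarrow> Gamma_reg (of_real 1 * u) / Gamma_reg u * ((1 - u) / (1 - of_real 1 * u))"
    using u lim n T(1) by (intro tendsto_intros tendsto_Gamma_reg) (auto simp: Gamma_reg_unit_nonzero)
  then show ?thesis unfolding Gamma_ratio using u by (simp add: Gamma_reg_unit_nonzero)
qed

lemma \<kappa>_\<Gamma>pp:
  assumes "norm z = 1" "norm w = 1"
  shows "\<kappa> z w * \<Gamma>pp t z w = (\<Gamma> (t * (z * w)) / \<Gamma> (z * w)) * (\<Gamma> (t * (z / w)) / \<Gamma> (z / w)) *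
     (\<Gamma> (t * (w / z)) / \<Gamma> (w / z)) * (\<Gamma> (t * (1 / (z * w))) / \<Gamma> (1 / (z * w)))"
  unfolding inverse_ell_gamma_pm_pm[OF assms, symmetric] by (simp add: ell_gamma_pm_pm_def mult_ac)

lemma tendsto_ell_gamma_quot:
  assumes T: "T \<longlonglongrightarrow> 1" "\<And>k. 1/2 \<le> T k" "\<And>k. T k < 1" and i: "i \<ge> 1"
  shows "(\<lambda>k. ell_gamma_quot i (of_real (T k)) p q) \<longlonglongrightarrow> 1 / of_nat i"
proof (cases "i = 1")
  case False
  have n: "norm (of_real (T k) :: complex) \<le> 1" for k using T(2)[of k] T(3)[of k] by simp
  have n': "norm (of_real (T k) ^ i :: complex) \<le> 1" for k using n by (simp add: norm_power power_le_one)
  have lim: "(\<lambda>k. of_real (T k) :: complex) \<longlonglongrightarrow> 1" using tendsto_of_real[OF T(1), where ?'a = complex] by simp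
  have limi: "(\<lambda>k. of_real (T k) ^ i :: complex) \<longlonglongrightarrow> 1" using tendsto_power[OF lim, of i] by simp
  have ne: "Gamma_reg 1 \<noteq> 0" by (rule Gamma_reg_1_nonzero)
  have "(\<lambda>k. Gamma_reg (of_real (T k) ^ i) / Gamma_reg (of_real (T k)) * (1 / (\<Sum>m<i. of_real (T k) ^ m)))
     \<longlonglongrightarrow> Gamma_reg 1 / Gamma_reg 1 * (1 / (\<Sum>m<i. 1 ^ m))"
    using i ne by (intro tendsto_intros tendsto_Gamma_reg lim limi n n') auto
  moreover have "ell_gamma_quot i (of_real (T k)) p q = Gamma_reg (of_real (T k) ^ i) / Gamma_reg (of_real (T k)) * (1 / (\<Sum>m<i. of_real (T k) ^ m))" for k
  proof -
    have "T k \<noteq> 1" using T(3)[of k] by auto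
    then have "of_real (T k) \<noteq> (1 :: complex)" by simp
    then show ?thesis using False unfolding ell_gamma_quot_def
      by (simp add: Gamma_ratio one_diff_power_eq[of "of_real (T k)" i])
  qed
  ultimately show ?thesis using ne by simp
qed (simp add: ell_gamma_quot_def)

text \<open>
  As \<open>t \<rightarrow> 1\<close> the interaction between the variables tends to 1 wherever \<open>z\<^sub>j \<noteq> z\<^sub>k\<close> and \<open>z\<^sub>j \<noteq> 1 / z\<^sub>k\<close>, and
  dominated convergence turns the integral into the \<open>n\<close>-th power of an integral in one variable. A
  single family of parameters suffices to compare the two sides: five of them are \<open>r = norm (p q) powr (1/6)\<close>,
  and the sixth makes the system balanced.
\<close>

lemma typeII_constant:
  assumes n: "n \<ge> 1" and C: "\<And>t a. typeII_balanced n t a \<Longrightarrow> typeII_integral n t a = C * typeII_value n t a"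
  shows "C = fact n * (2 * Gamma_reg 1) ^ n"
proof -
  define r where "r = norm (p * q) powr (1/6)"
  have pq0: "norm (p * q) > 0" using p_nz q_nz by simp
  have r0: "r > 0" using pq0 by (simp add: r_def)
  have r6: "r ^ 6 = norm (p * q)" using pq0 by (simp add: r_def powr_powr flip: powr_realpow)
  have r1: "r < 1"
  proof (rule ccontr)
    assume "\<not> r < 1"
    then have "1 \<le> r ^ 6" by (intro one_le_power) simp
    then show False using r6 norm_pq by simp
  qed
  define A where "A s m = (if m = 6 then p * q / (of_real r ^ 5 * s ^ (2 * n - 2)) else of_real r)" for s :: complex and m :: nat
  define S where "S = - {0} \<inter> {s::complex. r < norm s ^ (2 * n - 2)}"
  have S: "open S" unfolding S_def by (intro open_Int open_Collect_less continuous_intros)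
  have S1: "1 \<in> S" using r1 by (simp add: S_def)
  have A0: "A s m \<noteq> 0" if "s \<in> S" for s m using that p_nz q_nz r0 by (auto simp: A_def S_def)
  have A1: "norm (A s m) < 1" if "s \<in> S" for s m
  proof -
    have "norm (p * q) / r ^ 5 = r" using r0 unfolding r6[symmetric] by (simp add: power_numeral_reduce)
    then have "norm (A s 6) = r / norm s ^ (2 * n - 2)"
      using r0 by (simp add: A_def norm_divide norm_mult norm_power flip: divide_divide_eq_left)
    also have "\<dots> < 1" using that r0 by (simp add: S_def divide_less_eq)
    finally show ?thesis using r0 r1 by (cases "m = 6") (auto simp: A_def)
  qed
  have hA: "(\<lambda>s. A s m) holomorphic_on S" for m
    unfolding A_def using r0 by (cases "m = 6") (auto intro!: holomorphic_intros simp: S_def)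
  have prodA: "(\<Prod>m=1..6. A s m) * s ^ (2 * n - 2) = p * q" if "s \<in> S" for s
    using that r0 unfolding prod_1_6 by (simp add: A_def S_def power_numeral_reduce)
  have balS: "typeII_balanced n s (A s)" if "s \<in> S" "norm s < 1" for s
    unfolding typeII_balanced_def using that A0 A1 prodA by (auto simp: S_def)
  have bal1: "balanced {1..6} (A 1)"
    unfolding balanced_def using prodA[OF S1] A0[OF S1] A1[OF S1] by auto
  define H where "H s z = (\<Prod>i=1..n. params {1..6} (A s) (z i) * \<omega> (z i))" for s and z :: "nat \<Rightarrow> complex"
  have tameH: "tame_family S (torus {1..n}) H"
    unfolding H_def
    by (intro tame_family_prod tame_family_mult tame_family_params tame_family_\<omega> S hA A0 A1 torus_component) (auto intro: norm_torus)
  obtain \<delta>' KH where \<delta>': "\<delta>' > 0" "cball 1 \<delta>' \<subseteq> S" and KH: "\<And>s z. s \<in> cball 1 \<delta>' \<Longrightarrow> z \<in> space (torus {1..n}) \<Longrightarrow> norm (H s z) \<le> KH"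
    using tameH S1 unfolding tame_family_def by blast
  define \<delta> where "\<delta> = min \<delta>' (1/2)"
  have \<delta>: "0 < \<delta>" "\<delta> \<le> \<delta>'" "\<delta> \<le> 1/2" using \<delta>' by (auto simp: \<delta>_def)
  define T where "T k = 1 - \<delta> / real (Suc k)" for k
  have Tlim: "T \<longlonglongrightarrow> 1"
  proof -
    have "(\<lambda>k. 1 - \<delta> / real (Suc k)) \<longlonglongrightarrow> 1 - 0"
      by (intro tendsto_intros LIMSEQ_Suc[OF lim_const_over_n])
    then show ?thesis by (simp add: T_def[abs_def])
  qed
  have \<delta>k: "0 < \<delta> / real (Suc k)" "\<delta> / real (Suc k) \<le> \<delta>" for k
  proof -
    show "0 < \<delta> / real (Suc k)" using \<delta> by simp
    have "\<delta> / real (Suc k) \<le> \<delta> / 1" using \<delta> by (intro divide_left_mono) auto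
    then show "\<delta> / real (Suc k) \<le> \<delta>" by simp
  qed
  have T: "1/2 \<le> T k" "T k < 1" for k using \<delta>k[of k] \<delta> by (auto simp: T_def)
  have Tball: "of_real (T k) \<in> cball (1::complex) \<delta>'" for k
  proof -
    have "dist (1::complex) (of_real (T k)) = norm (of_real (1 - T k) :: complex)" unfolding dist_norm by simp
    also have "\<dots> = \<delta> / real (Suc k)" unfolding norm_of_real using \<delta>k(1)[of k] \<delta>(1) by (simp add: T_def)
    finally show ?thesis using \<delta>k(2)[of k] \<delta>(2) by simp
  qed
  have TS: "of_real (T k) \<in> S" for k using Tball \<delta>' by blast
  have Tlimc: "(\<lambda>k. of_real (T k) :: complex) \<longlonglongrightarrow> 1" using tendsto_of_real[OF Tlim, where ?'a = complex] by simp
  have limS: "(\<lambda>k. f (of_real (T k))) \<longlonglongrightarrow> f 1" if "f holomorphic_on S" for f :: "complex \<Rightarrow> complex"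
    using continuous_on_tendsto_compose[OF holomorphic_on_imp_continuous_on[OF that] Tlimc S1] TS by simp
  define V where "V = typeI_value {1..6} (A 1)"
  have V0: "V \<noteq> 0" unfolding V_def using bal1 by (intro typeI_value_nonzero) auto
  define R where "R t z w = \<kappa> z w * \<Gamma>pp t z w" for t z w
  obtain K where K: "\<And>T u. 1/2 \<le> T \<Longrightarrow> T < 1 \<Longrightarrow> norm u = 1 \<Longrightarrow> norm (\<Gamma> (of_real T * u) / \<Gamma> u) \<le> K"
    using Gamma_ratio_bounded by blast
  have K0: "K \<ge> 0" using order_trans[OF norm_ge_zero K[of "1/2" 1]] by simp
  have Rle: "norm (R (of_real (T k)) z w) \<le> K * K * K * K" if "norm z = 1" "norm w = 1" for k z w
    unfolding R_def \<kappa>_\<Gamma>pp[OF that] norm_mult[of "_ / _" "_ / _"] norm_mult[of "_ * _" "_ / _"]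
    using that K0 by (intro mult_mono K T mult_nonneg_nonneg norm_ge_zero) (auto simp: norm_mult norm_divide)
  have Rlim: "(\<lambda>k. R (of_real (T k)) z w) \<longlonglongrightarrow> 1" if zw: "norm z = 1" "norm w = 1" and ne: "z \<noteq> w" "z \<noteq> inverse w" for z w
  proof -
    have "z \<noteq> 0" "w \<noteq> 0" using zw by auto
    then have u: "z * w \<noteq> 1" "z / w \<noteq> 1" "w / z \<noteq> 1" "1 / (z * w) \<noteq> 1"
      using ne by (auto simp: field_simps)
    have "(\<lambda>k. R (of_real (T k)) z w) \<longlonglongrightarrow> 1 * 1 * 1 * 1"
      unfolding R_def \<kappa>_\<Gamma>pp[OF zw]
      using u zw by (intro tendsto_mult tendsto_Gamma_ratio Tlim T) (auto simp: norm_mult norm_divide)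
    then show ?thesis by simp
  qed
  have weight: "typeII_weight n t (A s) z = H s z * pair_prod (\<lambda>j k. R t (z j) (z k)) {1..n}" for t s z
    unfolding typeII_weight_def typeI_weight_def H_def R_def pair_prod_mult by (simp only: mult.assoc)
  let ?M = "torus {1..n}"
  interpret M: finite_measure ?M by (rule finite_measure_torus) simp
  define L where "L = KH * (\<Prod>j\<in>{1..n}. \<Prod>k\<in>{k\<in>{1..n}. j < k}. K * K * K * K)"
  have lim_int: "(\<lambda>k. \<integral>z. typeII_weight n (of_real (T k)) (A (of_real (T k))) z \<partial>?M) \<longlonglongrightarrow> (\<integral>z. H 1 z \<partial>?M)"
  proof (rule integral_dominated_convergence[where w = "\<lambda>_. L"])
    show "H 1 \<in> borel_measurable ?M" using tameH S1 by (simp add: tame_family_def)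
    show "typeII_weight n (of_real (T k)) (A (of_real (T k))) \<in> borel_measurable ?M" for k
    proof (rule tame_measurable)
      show "tame ?M (typeII_weight n (of_real (T k)) (A (of_real (T k))))"
        using balS[OF TS] T[of k] by (intro tame_family_typeII_weight) auto
    qed
    show "integrable ?M (\<lambda>_. L)" by (rule M.integrable_const)
    show "AE z in ?M. norm (typeII_weight n (of_real (T k)) (A (of_real (T k))) z) \<le> L" for k
    proof (rule AE_I2)
      fix z assume z: "z \<in> space ?M"
      have "norm (pair_prod (\<lambda>j i. R (of_real (T k)) (z j) (z i)) {1..n}) \<le> (\<Prod>j\<in>{1..n}. \<Prod>k\<in>{k\<in>{1..n}. j < k}. K * K * K * K)"
        by (intro norm_pair_prod_le Rle norm_torus[OF z])
      then show "norm (typeII_weight n (of_real (T k)) (A (of_real (T k))) z) \<le> L"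
        unfolding weight norm_mult L_def
        using KH[OF Tball z] order_trans[OF norm_ge_zero KH[OF Tball z]] by (intro mult_mono norm_ge_zero)
    qed
    have "AE z in ?M. \<forall>x\<in>{1..n} \<times> {1..n}. fst x \<noteq> snd x \<longrightarrow> z (fst x) \<noteq> z (snd x) \<and> z (fst x) \<noteq> inverse (z (snd x))"
    proof (rule AE_finite_allI)
      fix x :: "nat \<times> nat" assume x: "x \<in> {1..n} \<times> {1..n}"
      show "AE z in ?M. fst x \<noteq> snd x \<longrightarrow> z (fst x) \<noteq> z (snd x) \<and> z (fst x) \<noteq> inverse (z (snd x))"
      proof (cases "fst x = snd x")
        case False
        have "AE z in ?M. z (fst x) \<noteq> z (snd x)" "AE z in ?M. z (fst x) \<noteq> inverse (z (snd x))"
          using x False by (auto intro!: AE_torus_neq)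
        then show ?thesis by eventually_elim auto
      qed simp
    qed simp
    then show "AE z in ?M. (\<lambda>k. typeII_weight n (of_real (T k)) (A (of_real (T k))) z) \<longlonglongrightarrow> H 1 z"
    proof (rule AE_mp, intro AE_I2 impI)
      fix z assume z: "z \<in> space ?M" and ne: "\<forall>x\<in>{1..n} \<times> {1..n}. fst x \<noteq> snd x \<longrightarrow> z (fst x) \<noteq> z (snd x) \<and> z (fst x) \<noteq> inverse (z (snd x))"
      have "(\<lambda>k. R (of_real (T k)) (z j) (z i)) \<longlonglongrightarrow> 1" if "j \<in> {1..n}" "i \<in> {k \<in> {1..n}. j < k}" for j i
        using that bspec[OF ne, of "(j, i)"] by (intro Rlim norm_torus[OF z]) auto
      then have "(\<lambda>k. pair_prod (\<lambda>j i. R (of_real (T k)) (z j) (z i)) {1..n}) \<longlonglongrightarrow> (\<Prod>j\<in>{1..n}. \<Prod>i\<in>{k \<in> {1..n}. j < k}. 1)"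
        unfolding pair_prod_def by (intro tendsto_prod)
      moreover have "(\<lambda>s. H s z) holomorphic_on S" using tameH z by (simp add: tame_family_def)
      then have "(\<lambda>k. H (of_real (T k)) z) \<longlonglongrightarrow> H 1 z" by (rule limS)
      ultimately have "(\<lambda>k. H (of_real (T k)) z * pair_prod (\<lambda>j i. R (of_real (T k)) (z j) (z i)) {1..n}) \<longlonglongrightarrow> H 1 z * (\<Prod>j\<in>{1..n}. \<Prod>i\<in>{k \<in> {1..n}. j < k}. 1)"
        by (intro tendsto_mult)
      then show "(\<lambda>k. typeII_weight n (of_real (T k)) (A (of_real (T k))) z) \<longlonglongrightarrow> H 1 z" unfolding weight by simp
    qed
  qed
  define h where "h y = params {1..6} (A 1) y * \<omega> y" for y
  have h: "integrable circ h"
  proof (rule tame_integrable[OF circ.finite_measure_axioms])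
    show "tame circ h"
      unfolding h_def using A0[OF S1] A1[OF S1] by (intro tame_family_mult tame_family_params tame_family_\<omega>) auto
  qed
  have factor: "(\<integral>z. (\<Prod>i\<in>I. h (z i)) \<partial>torus I) = (\<integral>y. h y \<partial>circ) ^ card I" if "finite I" for I
    using circs.product_integral_prod[OF that, of "\<lambda>_. h"] h by simp
  have "(\<integral>z. H 1 z \<partial>?M) = (\<integral>y. h y \<partial>circ) ^ n" using factor[of "{1..n}"] by (simp add: H_def h_def)
  moreover have "(\<integral>y. h y \<partial>circ) = 2 * Gamma_reg 1 * V"
  proof -
    have "(\<integral>y. h y \<partial>circ) = typeI_integral {1} {1..6} (A 1)"
      using factor[of "{1}"] by (simp add: typeI_integral_def typeI_weight_def h_def)
    also have "\<dots> = typeI_ratio {1} {1..6} (A 1) * V" using V0 unfolding typeI_ratio_def V_def by simp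
    finally show ?thesis unfolding typeI_ratio_one_variable[OF bal1] .
  qed
  ultimately have lim1: "(\<lambda>k. typeII_integral n (of_real (T k)) (A (of_real (T k)))) \<longlonglongrightarrow> (2 * Gamma_reg 1 * V) ^ n"
    using lim_int unfolding typeII_integral_def by simp
  have arg: "norm (A 1 j * A 1 k) < 1" for j k
    using mult_strict_mono'[OF A1[OF S1, of j] A1[OF S1, of k]] by (simp add: norm_mult)
  have "(\<lambda>k. pair_prod (\<lambda>j l. \<Gamma> (of_real (T k) ^ (i - 1) * A (of_real (T k)) j * A (of_real (T k)) l)) {1..6}) \<longlonglongrightarrow> V" for i
    unfolding V_def typeI_value_def pair_prod_def
  proof (intro tendsto_prod)
    fix j l
    have "(\<lambda>k. of_real (T k) ^ (i - 1) * A (of_real (T k)) j * A (of_real (T k)) l) \<longlonglongrightarrow> 1 ^ (i - 1) * A 1 j * A 1 l"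
      by (intro tendsto_intros Tlimc limS[OF hA])
    then show "(\<lambda>k. \<Gamma> (of_real (T k) ^ (i - 1) * A (of_real (T k)) j * A (of_real (T k)) l)) \<longlonglongrightarrow> \<Gamma> (A 1 j * A 1 l)"
      using A0[OF S1] arg by (intro isCont_tendsto_compose[OF isCont_Gamma]) auto
  qed
  then have "(\<lambda>k. typeII_value n (of_real (T k)) (A (of_real (T k)))) \<longlonglongrightarrow> (\<Prod>i=1..n. 1 / of_nat i * V)"
    unfolding typeII_value_def by (intro tendsto_prod tendsto_mult tendsto_ell_gamma_quot Tlim T) auto
  moreover have "(\<Prod>i=1..n. 1 / of_nat i * V) = V ^ n / fact n"
    by (simp add: prod.distrib prod_dividef fact_prod)
  ultimately have "(\<lambda>k. C * typeII_value n (of_real (T k)) (A (of_real (T k)))) \<longlonglongrightarrow> C * (V ^ n / fact n)"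
    by (intro tendsto_intros) simp
  moreover have "typeII_integral n (of_real (T k)) (A (of_real (T k))) = C * typeII_value n (of_real (T k)) (A (of_real (T k)))" for k
    using T[of k] by (intro C balS TS) simp
  ultimately have "(\<lambda>k. typeII_integral n (of_real (T k)) (A (of_real (T k)))) \<longlonglongrightarrow> C * (V ^ n / fact n)" by simp
  then have "C * (V ^ n / fact n) = (2 * Gamma_reg 1 * V) ^ n" using lim1 by (rule LIMSEQ_unique)
  then have "C * V ^ n = (fact n * (2 * Gamma_reg 1) ^ n) * V ^ n" by (simp add: divide_eq_eq power_mult_distrib mult_ac)
  then show ?thesis using V0 by simp
qed

text \<open>
  The constant in \<open>n\<close> variables has to be known before the step to \<open>n + 1\<close>, because the recursion divides by it.
\<close>

theorem typeII_integral_eq: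
  assumes n: "n \<ge> 1" and bal: "typeII_balanced n t a"
  shows "typeII_integral n t a = fact n * (2 * Gamma_reg 1) ^ n * typeII_value n t a"
proof -
  have "\<And>t a. typeII_balanced n t a \<Longrightarrow> typeII_integral n t a = typeI_const n * typeII_value n t a"
    using n
  proof (induction n rule: dec_induct)
    case base
    fix t a assume "typeII_balanced 1 t a"
    then have bal: "balanced {1..2 * 1 + 4} a" by (auto simp: typeII_balanced_def balanced_def)
    have "typeII_integral 1 t a = typeI_integral {1..1} {1..2 * 1 + 4} a"
      by (simp add: typeII_integral_def typeII_weight_def typeI_integral_def)
    also have "\<dots> = typeI_const 1 * typeI_value {1..2 * 1 + 4} a" by (rule typeI_integral_eq[OF bal])
    also have "typeI_value {1..2 * 1 + 4} a = typeII_value 1 t a"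
      by (simp add: typeI_value_def typeII_value_def ell_gamma_quot_def)
    finally show "typeII_integral 1 t a = typeI_const 1 * typeII_value 1 t a" .
  next
    case (step N)
    fix t a assume bal: "typeII_balanced (Suc N) t a"
    have "typeI_const N = fact N * (2 * Gamma_reg 1) ^ N" by (rule typeII_constant[OF step.hyps(1) step.IH])
    then have const: "typeI_const N \<noteq> 0" using Gamma_reg_1_nonzero by simp
    show "typeII_integral (Suc N) t a = typeI_const (Suc N) * typeII_value (Suc N) t a"
    proof (rule typeII_continuation[OF _ bal])
      show "2 \<le> Suc N" using step.hyps(1) by simp
    qed (rule typeII_integral_step[OF step.hyps(1) _ _ const step.IH])
  qed
  then show ?thesis using typeII_constant[OF n] bal by metis
qed

end

section \<open>The integral over the torus\<close>

lemma pair_prod_atLeastAtMost: "pair_prod f {1..n} = (\<Prod>j=1..n. \<Prod>k\<in>{j<..n}. f j k)"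
  unfolding pair_prod_def by (intro prod.cong refl) auto

theorem mainTheorem1:
  fixes n :: nat and p q t :: complex and a :: "nat \<Rightarrow> complex"
  assumes "n \<ge> 1"
    and "p \<noteq> 0" and "norm p < 1"
    and "q \<noteq> 0" and "norm q < 1"
    and "\<And>m. m \<in> {1..6} \<Longrightarrow> a m \<noteq> 0 \<and> norm (a m) < 1"
    and "t \<noteq> 0" and "norm t < 1"
    and "a 1 * a 2 * a 3 * a 4 * a 5 * a 6 * t ^ (2 * n - 2) = p * q"
  shows
    "1 / (2 * of_real pi * \<i>) ^ n *
       torus_integral n (\<lambda>z.
         (\<Prod>i=1..n. (\<Prod>m=1..6. ell_gamma_pm (a m) (z i) p q) / ell_gamma_pm 1 ((z i)\<^sup>2) p q) *
         (\<Prod>j=1..n. \<Prod>k\<in>{j<..n}. ell_gamma_pm_pm t (z j) (z k) p q / ell_gamma_pm_pm 1 (z j) (z k) p q) /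
         (\<Prod>i=1..n. z i))
     = 2 ^ n * fact n / (qpoch p p ^ n * qpoch q q ^ n) *
       (\<Prod>i=1..n. ell_gamma_quot i t p q *
          (\<Prod>j=1..6. \<Prod>k\<in>{j<..6}. ell_gamma (t ^ (i - 1) * a j * a k) p q))"
proof -
  interpret elliptic_bases p q by standard (use assms in auto)
  have bal: "typeII_balanced n t a"
    unfolding typeII_balanced_def prod_1_6 using assms by auto
  define F where "F z = (\<Prod>i=1..n. (\<Prod>m=1..6. ell_gamma_pm (a m) (z i) p q) / ell_gamma_pm 1 ((z i)\<^sup>2) p q) *
         (\<Prod>j=1..n. \<Prod>k\<in>{j<..n}. ell_gamma_pm_pm t (z j) (z k) p q / ell_gamma_pm_pm 1 (z j) (z k) p q)"
    for z :: "nat \<Rightarrow> complex"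
  have weight: "F z = typeII_weight n t a z" if z: "z \<in> space (torus {1..n})" for z
  proof -
    have "(\<Prod>i=1..n. (\<Prod>m=1..6. ell_gamma_pm (a m) (z i) p q) / ell_gamma_pm 1 ((z i)\<^sup>2) p q)
        = (\<Prod>i=1..n. params {1..6} a (z i) * \<omega> (z i))"
    proof (intro prod.cong refl)
      fix i assume "i \<in> {1..n}"
      then have "norm (z i) = 1" by (rule norm_torus[OF z])
      then show "(\<Prod>m=1..6. ell_gamma_pm (a m) (z i) p q) / ell_gamma_pm 1 ((z i)\<^sup>2) p q = params {1..6} a (z i) * \<omega> (z i)"
        unfolding inverse_ell_gamma_pm[OF \<open>norm (z i) = 1\<close>, symmetric] params_def ell_gamma_pm_def by simp
    qed
    moreover have "(\<Prod>j=1..n. \<Prod>k\<in>{j<..n}. ell_gamma_pm_pm t (z j) (z k) p q / ell_gamma_pm_pm 1 (z j) (z k) p q)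
        = pair_prod (\<lambda>j k. \<kappa> (z j) (z k) * ell_gamma_pm_pm t (z j) (z k) p q) {1..n}"
      unfolding pair_prod_atLeastAtMost
    proof (intro prod.cong refl)
      fix j k assume "j \<in> {1..n}" "k \<in> {j<..n}"
      then have "norm (z j) = 1" "norm (z k) = 1" using norm_torus[OF z] by auto
      then show "ell_gamma_pm_pm t (z j) (z k) p q / ell_gamma_pm_pm 1 (z j) (z k) p q = \<kappa> (z j) (z k) * ell_gamma_pm_pm t (z j) (z k) p q"
        by (simp add: inverse_ell_gamma_pm_pm[symmetric])
    qed
    ultimately show ?thesis
      unfolding F_def typeII_weight_def typeI_weight_def pair_prod_mult by (simp only: mult.assoc)
  qed
  have "tame (torus {1..n}) (typeII_weight n t a)"
    using bal by (intro tame_family_typeII_weight) auto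
  then have "typeII_weight n t a \<in> borel_measurable (torus {1..n})" by (rule tame_measurable)
  then have "F \<in> borel_measurable (torus {1..n})"
    by (subst measurable_cong[OF weight])
  moreover have "F z = F (restrict z {1..n})" for z
    unfolding F_def by (intro arg_cong2[of _ _ _ _ "(*)"] prod.cong refl) auto
  ultimately have "torus_integral n (\<lambda>z. F z / (\<Prod>i=1..n. z i)) = (2 * of_real pi * \<i>) ^ n * (\<integral>z. F z \<partial>torus {1..n})"
    by (rule torus_integral_conv_torus)
  also have "(\<integral>z. F z \<partial>torus {1..n}) = typeII_integral n t a"
    unfolding typeII_integral_def by (intro Bochner_Integration.integral_cong refl weight)
  finally have "1 / (2 * of_real pi * \<i>) ^ n * torus_integral n (\<lambda>z. F z / (\<Prod>i=1..n. z i)) = typeII_integral n t a"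
    by simp
  also have "\<dots> = fact n * (2 * Gamma_reg 1) ^ n * typeII_value n t a"
    by (rule typeII_integral_eq[OF assms(1) bal])
  also have "fact n * (2 * Gamma_reg 1) ^ n = 2 ^ n * fact n / (qpoch p p ^ n * qpoch q q ^ n)"
    by (simp add: Gamma_reg_1 power_mult_distrib power_divide)
  finally show ?thesis
    unfolding F_def typeII_value_def pair_prod_atLeastAtMost .
qed

end
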